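(* Let $n\ge m\ge2$, and let $H\le F_m$ be a closed maximal subgroup of $F_m$ isomorphic to $F_n$. Then there exists an orientation-preserving homeomorphism $\phi\in\operatorname{Homeo}_+(0,1)$ such that $H=F_n^\phi$. Moreover, $\phi$ maps the $n$-adic rationals in $(0,1)$ bijectively to the $m$-adic rationals in $(0,1)$ and has an order-preserving lift $\widetilde\phi:\mathcal C_n\to\mathcal C_m$.
   Context: $F_n$ is the group of increasing piecewise-linear homeomorphisms of $[0,1]$ with finitely many breakpoints, all in $\mathbb Z[1/n]$, and slopes integer powers of $n$; it acts on $(0,1)$. $F_n^\phi$ denotes the conjugate group $\{\phi\circ f\circ\phi^{-1}: f\in F_n\}$ (in the paper's left-to-right notation, $\phi^{-1}F_n\phi$). The $n$-adic rationals in $(0,1)$ are the points of $\mathbb Z[1/n]\cap(0,1)$. A subgroup $H\le F_m$ is closed (in $F_m$) if every piecewise-$H$ function in $F_m$ belongs to $H$, where $f\in F_m$ is piecewise-$H$ if there is a finite subdivision $0=a_0<a_1<\dots<a_k=1$ such that on each $[a_{j-1},a_j]$ the function $f$ agrees with some element of $H$. $\mathcal C_n=\{0,\dots,n-1\}^{\mathbb N}$ with the product topology and the lexicographic order, and $\rho_n:\mathcal C_n\to[0,1]$, $\rho_n(\omega_1\omega_2\cdots)=\sum_j\omega_jn^{-j}$. A lift of $\phi$ (extended to $[0,1]$ by fixing the endpoints) is a homeomorphism $\widetilde\phi:\mathcal C_n\to\mathcal C_m$ with $\rho_m(\widetilde\phi(\omega))=\phi(\rho_n(\omega))$ for all $\omega$;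 order-preserving refers to the lexicographic orders. *)

theory Defs
  imports "HOL-Analysis.Analysis" "HOL-Algebra.Bij"
begin

text \<open>
  The interval \<open>[0,1]\<close> is \<open>{0..1::real}\<close>, and a self-map of a set \<open>S\<close> is a function that is
  \<open>undefined\<close> outside \<open>S\<close> (it lies in \<open>extensional S\<close>), so that equality of such functions is
  equality on \<open>S\<close>, as in \<open>BijGroup\<close>.
\<close>

definition homeo_plus :: "real set \<Rightarrow> (real \<Rightarrow> real) set" where
  "homeo_plus S =
     {f. f \<in> extensional S \<and> strict_mono_on S f \<and> (\<exists>g. homeomorphism S S f g)}"

definition adic_rationals :: "nat \<Rightarrow> real set" where
  "adic_rationals n = {of_int a / of_nat n ^ k | a k. True}"

definition subdivision :: "nat \<Rightarrow> (nat \<Rightarrow> real) \<Rightarrow> bool" where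
  "subdivision k a \<longleftrightarrow> a 0 = 0 \<and> a k = 1 \<and> (\<forall>j<k. a j < a (Suc j))"

text \<open>
  The points of the subdivision below include the breakpoints, but need not all be breakpoints;
  nothing is lost by this, since the endpoints \<open>0\<close> and \<open>1\<close> lie in \<open>adic_rationals n\<close>.
\<close>

definition F_set :: "nat \<Rightarrow> (real \<Rightarrow> real) set" where
  "F_set n =
     {f \<in> homeo_plus {0..1}.
        \<exists>k a. subdivision k a \<and> (\<forall>j\<le>k. a j \<in> adic_rationals n) \<and>
          (\<forall>j<k. \<exists>s::int. \<forall>x\<in>{a j..a (Suc j)}.
             f x = f (a j) + real n powi s * (x - a j))}"

text \<open>
  The product of \<open>BijGroup\<close> is \<open>f \<otimes> g = f \<circ> g\<close>. The left-to-right convention gives the opposite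
  group, which has the same subgroups, and the inversion map is an isomorphism between the two.
\<close>

definition F_group :: "nat \<Rightarrow> (real \<Rightarrow> real) monoid" where
  "F_group n = (BijGroup {0..1})\<lparr>carrier := F_set n\<rparr>"

definition maximal_subgroup :: "'a set \<Rightarrow> ('a, 'b) monoid_scheme \<Rightarrow> bool" where
  "maximal_subgroup H G \<longleftrightarrow>
     subgroup H G \<and> H \<noteq> carrier G \<and>
     (\<forall>K. subgroup K G \<and> H \<subseteq> K \<longrightarrow> K = H \<or> K = carrier G)"

definition piecewise_in :: "(real \<Rightarrow> real) set \<Rightarrow> (real \<Rightarrow> real) \<Rightarrow> bool" where
  "piecewise_in H f \<longleftrightarrow>
     (\<exists>k a. subdivision k a \<and> (\<forall>j<k. \<exists>h\<in>H. \<forall>x\<in>{a j..a (Suc j)}. f x = h x))"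

definition closed_in_F :: "nat \<Rightarrow> (real \<Rightarrow> real) set \<Rightarrow> bool" where
  "closed_in_F m H \<longleftrightarrow> (\<forall>f\<in>F_set m. piecewise_in H f \<longrightarrow> f \<in> H)"

definition fix_endpoints :: "(real \<Rightarrow> real) \<Rightarrow> real \<Rightarrow> real" where
  "fix_endpoints \<phi> = (\<lambda>x\<in>{0..1}. if x \<in> {0<..<1} then \<phi> x else x)"

definition F_conj :: "nat \<Rightarrow> (real \<Rightarrow> real) \<Rightarrow> (real \<Rightarrow> real) set" where
  "F_conj n \<phi> =
     {\<lambda>x\<in>{0..1}. fix_endpoints \<phi> (f (inv_into {0..1} (fix_endpoints \<phi>) x)) | f. f \<in> F_set n}"

definition cantor :: "nat \<Rightarrow> (nat \<Rightarrow> nat) topology" where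
  "cantor n = product_topology (\<lambda>_. discrete_topology {..<n}) UNIV"

definition lex_lt :: "(nat \<Rightarrow> nat) \<Rightarrow> (nat \<Rightarrow> nat) \<Rightarrow> bool" where
  "lex_lt \<omega> \<eta> \<longleftrightarrow> (\<exists>k. (\<forall>j<k. \<omega> j = \<eta> j) \<and> \<omega> k < \<eta> k)"

text \<open>The digit \<open>\<omega>\<^sub>j\<close> (\<open>j \<ge> 1\<close>) is \<open>\<omega> (j - 1)\<close>.\<close>

definition rho :: "nat \<Rightarrow> (nat \<Rightarrow> nat) \<Rightarrow> real" where
  "rho n \<omega> = (\<Sum>j. real (\<omega> j) / real n ^ Suc j)"

definition is_lift ::
  "nat \<Rightarrow> nat \<Rightarrow> (real \<Rightarrow> real) \<Rightarrow> ((nat \<Rightarrow> nat) \<Rightarrow> (nat \<Rightarrow> nat)) \<Rightarrow> bool" where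
  "is_lift n m \<phi> \<Phi> \<longleftrightarrow>
     homeomorphic_map (cantor n) (cantor m) \<Phi> \<and>
     (\<forall>\<omega>\<in>topspace (cantor n). rho m (\<Phi> \<omega>) = fix_endpoints \<phi> (rho n \<omega>))"

definition lex_preserving :: "nat \<Rightarrow> ((nat \<Rightarrow> nat) \<Rightarrow> (nat \<Rightarrow> nat)) \<Rightarrow> bool" where
  "lex_preserving n \<Phi> \<longleftrightarrow>
     (\<forall>\<omega>\<in>topspace (cantor n). \<forall>\<eta>\<in>topspace (cantor n). lex_lt \<omega> \<eta> \<longrightarrow> lex_lt (\<Phi> \<omega>) (\<Phi> \<eta>))"

end

theory Submission
  imports Defs
begin

text \<open>
  Let \<open>\<theta>\<close> be an isomorphism from \<open>F_set n\<close> onto \<open>H\<close>. Two elements of \<open>F_set m\<close> that commute with \<open>b\<close>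
  commute with each other on the support of \<open>b\<close>, because germs at the left end of a bump of \<open>b\<close> are
  linear. So subgroups with disjoint supports have images whose sets of noncommutation are
  disjoint. Together with maximality this shows that \<open>H\<close> has dense orbits in \<open>(0,1)\<close>: otherwise
  \<open>H\<close> would be the stabilizer of an orbit and would contain all of \<open>F_set m\<close> supported in two
  disjoint intervals. After a possible reflection, the supremum of the set where the image of
  the maps supported in \<open>[0,x]\<close> fails to commute is an interior point \<open>\<phi> x\<close>, monotone and
  equivariant in \<open>x\<close>; minimality makes \<open>\<phi>\<close> a homeomorphism.

  A map breaking at an \<open>n\<close>-adic point has an image that breaks at the image point, so \<open>\<phi>\<close> sends
  \<open>n\<close>-adic points to \<open>m\<close>-adic ones. Conversely, finitely many elements of \<open>H\<close> already move every
  standard \<open>m\<close>-adic interval affinely to one of bounded depth. At an \<open>m\<close>-adic point the pigeonhole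
  principle then gives two elements of \<open>H\<close> agreeing there with different slopes; closedness
  lets them be glued, and the gluing can only come from a breakpoint at an \<open>n\<close>-adic point.
\<close>

section \<open>Adic rationals and maps of the interval\<close>

text \<open>The obstacle is that \<open>\<theta>\<close> is an abstract isomorphism: it says nothing
  in advance about where its values act, and nothing yet prevents maps with disjoint supports from
  having images with overlapping supports, such as two powers of one map. What an isomorphism does
  see is commutation. A pair that fails to commute at a point forces every map commuting with both
  to fix that point, so the open set \<open>noncommuting A\<close> is an algebraically visible
  replacement for a support. Maximality serves to identify \<open>H\<close> with a full stabilizer
  as soon as \<open>H\<close> preserves a set that some element of \<open>F_set m\<close> does not
  preserve. The reflection appears because conjugation by \<open>1 - x\<close> is an automorphism of
  \<open>F_set n\<close>, so \<open>\<theta>\<close> may reverse the order; one map moving all of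
  (0,1) to the right decides which case holds. Finally, \<open>\<phi>\<close> has no reason to be
  piecewise linear, so slopes cannot be compared across it. Only fixed points and coincidences of
  maps are transported, and a break must therefore be recognized as the end of a set where two maps
  agree.\<close>

lemma adic_rationals_0 [simp]: "0 \<in> adic_rationals n"
  unfolding adic_rationals_def by (rule CollectI, rule exI[of _ 0], rule exI[of _ 0]) auto

lemma adic_rationals_1 [simp]: "1 \<in> adic_rationals n"
  unfolding adic_rationals_def by (rule CollectI, rule exI[of _ 1], rule exI[of _ 0]) auto

lemma adic_rationals_powi:
  assumes "n \<ge> 1"
  shows "real n powi s \<in> adic_rationals n"
proof (cases "s \<ge> 0")
  case True
  then have "real n powi s = of_int (int n ^ nat s) / of_nat n ^ 0"
    by (simp add: power_int_def)
  then show ?thesis unfolding adic_rationals_def by blast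
next
  case False
  then have "real n powi s = of_int 1 / of_nat n ^ nat (- s)"
    by (simp add: power_int_def field_simps)
  then show ?thesis unfolding adic_rationals_def by blast
qed

lemma adic_rationals_inverse:
  assumes "n \<ge> 1"
  shows "1 / real n \<in> adic_rationals n"
  using adic_rationals_powi[OF assms, of "-1"] by (simp add: power_int_def field_simps)

lemma adic_rationals_add:
  assumes "n \<ge> 1" "x \<in> adic_rationals n" "y \<in> adic_rationals n"
  shows "x + y \<in> adic_rationals n"
proof -
  obtain a k b l where xy: "x = of_int a / of_nat n ^ k" "y = of_int b / of_nat n ^ l"
    using assms unfolding adic_rationals_def by auto
  have "x + y = of_int (a * int n ^ l + b * int n ^ k) / of_nat n ^ (k + l)"
    using assms(1) by (simp add: xy power_add add_frac_eq)
  then show ?thesis unfolding adic_rationals_def by blast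
qed

lemma adic_rationals_uminus:
  assumes "x \<in> adic_rationals n"
  shows "- x \<in> adic_rationals n"
proof -
  obtain a k where x: "x = of_int a / of_nat n ^ k"
    using assms unfolding adic_rationals_def by auto
  have "- x = of_int (- a) / of_nat n ^ k" by (simp add: x)
  then show ?thesis unfolding adic_rationals_def by blast
qed

lemma adic_rationals_diff:
  assumes "n \<ge> 1" "x \<in> adic_rationals n" "y \<in> adic_rationals n"
  shows "x - y \<in> adic_rationals n"
  using adic_rationals_add[OF assms(1,2) adic_rationals_uminus[OF assms(3)]] by simp

lemma adic_rationals_mult:
  assumes "x \<in> adic_rationals n" "y \<in> adic_rationals n"
  shows "x * y \<in> adic_rationals n"
proof -
  obtain a k b l where xy: "x = of_int a / of_nat n ^ k" "y = of_int b / of_nat n ^ l"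
    using assms unfolding adic_rationals_def by auto
  have "x * y = of_int (a * b) / of_nat n ^ (k + l)"
    by (simp add: xy power_add)
  then show ?thesis unfolding adic_rationals_def by blast
qed

lemma adic_rationals_of_nat: "real j \<in> adic_rationals n"
proof -
  have "real j = of_int (int j) / of_nat n ^ 0" by simp
  then show ?thesis unfolding adic_rationals_def by blast
qed

text \<open>Powers of \<open>n\<close> are units of the ring of \<open>n\<close>-adic rationals, so
  an affine map of this shape permutes them. This lets the clause about non-adic points in
  \<open>locally_adic\<close> survive composition and inversion.\<close>

lemma adic_rationals_powi_affine_iff:
  assumes "n \<ge> 1" "c \<in> adic_rationals n"
  shows "real n powi s * x + c \<in> adic_rationals n \<longleftrightarrow> x \<in> adic_rationals n"
proof
  assume "real n powi s * x + c \<in> adic_rationals n"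
  then have "real n powi (- s) * ((real n powi s * x + c) - c) \<in> adic_rationals n"
    using assms by (intro adic_rationals_mult adic_rationals_diff adic_rationals_powi)
  moreover have "real n powi (- s) * real n powi s = 1"
    using assms(1) power_int_add[of "real n" "- s" s] by simp
  then have "real n powi (- s) * ((real n powi s * x + c) - c) = x"
    by (metis add_diff_cancel_right' mult.assoc mult_1)
  ultimately show "x \<in> adic_rationals n" by metis
next
  assume "x \<in> adic_rationals n"
  then show "real n powi s * x + c \<in> adic_rationals n"
    using assms by (intro adic_rationals_add adic_rationals_mult adic_rationals_powi)
qed

lemma adic_rationals_dense:
  assumes "n \<ge> 2" "x < y"
  obtains p where "p \<in> adic_rationals n" "x < p" "p < y"
proof -
  obtain k where k: "1 / (y - x) < real n ^ k"
    using real_arch_pow[of "real n" "1 / (y - x)"] assms(1) by auto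
  have pos: "real n ^ k > 0" using assms(1) by simp
  define a where "a = \<lfloor>x * real n ^ k\<rfloor> + 1"
  have "x * real n ^ k < a" "of_int a \<le> x * real n ^ k + 1" unfolding a_def by linarith+
  moreover have "1 < (y - x) * real n ^ k" using k assms(2) by (simp add: field_simps)
  ultimately have "x * real n ^ k < a" "of_int a < y * real n ^ k" by (simp_all add: algebra_simps)
  then have "x < of_int a / of_nat n ^ k" "of_int a / of_nat n ^ k < y"
    using pos by (simp_all add: field_simps)
  moreover have "of_int a / of_nat n ^ k \<in> adic_rationals n" unfolding adic_rationals_def by blast
  ultimately show thesis using that by blast
qed

text \<open>The device for comparing germs. It is often applied with exponent and constant 0 on one
  side: a germ with two fixed points is the identity.\<close>

lemma powi_affine_unique:
  assumes "n \<ge> 2" "x \<noteq> y"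
    and "real n powi s * x + c = real n powi s' * x + c'"
    and "real n powi s * y + c = real n powi s' * y + c'"
  shows "s = s'" "c = c'"
proof -
  have "real n powi s * (x - y) = real n powi s' * (x - y)"
    using assms(3,4) by (simp add: algebra_simps)
  then have e: "real n powi s = real n powi s'" using assms(2) by simp
  show "s = s'"
  proof (rule ccontr)
    assume "s \<noteq> s'"
    then consider "s < s'" | "s' < s" by linarith
    then show False
      by cases (use e power_int_strict_increasing[of _ _ "real n"] assms(1) in fastforce)+
  qed
  then show "c = c'" using assms(3) by simp
qed

lemma powi_pos: "n \<ge> 2 \<Longrightarrow> real n powi s > 0"
  by (simp add: zero_less_power_int)

section \<open>Increasing homeomorphisms of the unit interval\<close>

lemma homeo_plusD:
  assumes "f \<in> homeo_plus {0..1}"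
  shows "f \<in> extensional {0..1}" "strict_mono_on {0..1} f" "continuous_on {0..1} f"
    "bij_betw f {0..1} {0..1}" "f 0 = 0" "f 1 = 1"
    "\<And>x. x \<in> {0..1} \<Longrightarrow> f x \<in> {0..1}"
    "\<And>x y. x \<in> {0..1} \<Longrightarrow> y \<in> {0..1} \<Longrightarrow> f x < f y \<longleftrightarrow> x < y"
    "\<And>x y. x \<in> {0..1} \<Longrightarrow> y \<in> {0..1} \<Longrightarrow> f x \<le> f y \<longleftrightarrow> x \<le> y"
    "\<And>x y. x \<in> {0..1} \<Longrightarrow> y \<in> {0..1} \<Longrightarrow> f x = f y \<longleftrightarrow> x = y"
proof -
  show ext: "f \<in> extensional {0..1}" and sm: "strict_mono_on {0..1} f"
    using assms unfolding homeo_plus_def by auto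
  obtain g where hm: "homeomorphism {0..1} {0..1} f g"
    using assms unfolding homeo_plus_def by auto
  show "continuous_on {0..1} f" using hm by (simp add: homeomorphism_def)
  have im: "f ` {0..1} = {0..1}" using hm by (simp add: homeomorphism_def)
  have "inj_on f {0..1}" using sm by (rule strict_mono_on_imp_inj_on)
  then show "bij_betw f {0..1} {0..1}" using im by (simp add: bij_betw_def)
  show I: "f x \<in> {0..1}" if "x \<in> {0..1}" for x using im that by blast
  show less: "f x < f y \<longleftrightarrow> x < y" if "x \<in> {0..1}" "y \<in> {0..1}" for x y
    using sm that by (metis linorder_neqE_linordered_idom order.asym strict_mono_onD)
  show le: "f x \<le> f y \<longleftrightarrow> x \<le> y" if "x \<in> {0..1}" "y \<in> {0..1}" for x y
    using less[OF that(2,1)] by (simp add: not_less[symmetric])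
  show "f x = f y \<longleftrightarrow> x = y" if "x \<in> {0..1}" "y \<in> {0..1}" for x y
    using le[OF that] le[OF that(2,1)] by auto
  obtain u where u: "u \<in> {0..1}" "f u = 0" using im by (metis atLeastAtMost_iff image_iff order.refl zero_le_one)
  have "f 0 \<le> f u" using le[of 0 u] u by auto
  then show "f 0 = 0" using I[of 0] u by auto
  obtain v where v: "v \<in> {0..1}" "f v = 1" using im by (metis atLeastAtMost_iff image_iff order.refl zero_le_one)
  have "f v \<le> f 1" using le[of v 1] v by auto
  then show "f 1 = 1" using I[of 1] v by auto
qed

lemma homeo_plusI:
  assumes "f \<in> extensional {0..1}" "strict_mono_on {0..1} f" "continuous_on {0..1} f"
    "f 0 = 0" "f 1 = 1"
  shows "f \<in> homeo_plus {0..1}"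
proof -
  have "f ` {0..1} = {0..1}"
  proof
    show "f ` {0..1} \<subseteq> {0..1}"
    proof
      fix y assume "y \<in> f ` {0..1}"
      then obtain x where x: "x \<in> {0..1}" "y = f x" by auto
      have mo: "mono_on {0..1} f" using assms(2) by (rule strict_mono_on_imp_mono_on)
      have "f 0 \<le> f x" "f x \<le> f 1" using x by (auto intro!: mono_onD[OF mo])
      then show "y \<in> {0..1}" using assms x by auto
    qed
    show "{0..1} \<subseteq> f ` {0..1}"
    proof
      fix y :: real assume "y \<in> {0..1}"
      then have "\<exists>x\<ge>0. x \<le> 1 \<and> f x = y"
        using assms by (intro IVT') auto
      then show "y \<in> f ` {0..1}" by auto
    qed
  qed
  then obtain g where "homeomorphism {0..1} {0..1} f g"
    using homeomorphism_compact[OF compact_Icc assms(3)]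
      strict_mono_on_imp_inj_on[OF assms(2)] by blast
  then show ?thesis using assms unfolding homeo_plus_def by blast
qed

section \<open>The groups as groups of locally affine maps\<close>

text \<open>Membership in \<open>F_set n\<close> is a local condition, which makes closure under composition,
  inversion and gluing immediate. Requiring the constant terms to be \<open>n\<close>-adic records that the
  map preserves the set of \<open>n\<close>-adic rationals.\<close>

definition locally_adic :: "nat \<Rightarrow> (real \<Rightarrow> real) \<Rightarrow> real \<Rightarrow> bool" where
  "locally_adic n f t \<longleftrightarrow>
     (\<exists>e>0. \<exists>s s'. \<exists>c\<in>adic_rationals n. \<exists>c'\<in>adic_rationals n.
        (\<forall>x\<in>{0..1}. t - e \<le> x \<and> x \<le> t \<longrightarrow> f x = real n powi s * x + c) \<and>
        (\<forall>x\<in>{0..1}. t \<le> x \<and> x \<le> t + e \<longrightarrow> f x = real n powi s' * x + c') \<and>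
        (t \<in> adic_rationals n \<or> s = s' \<and> c = c'))"

lemma locally_adicI:
  assumes "e > 0" "c \<in> adic_rationals n" "c' \<in> adic_rationals n"
    and "\<And>x. x \<in> {0..1} \<Longrightarrow> t - e \<le> x \<Longrightarrow> x \<le> t \<Longrightarrow> f x = real n powi s * x + c"
    and "\<And>x. x \<in> {0..1} \<Longrightarrow> t \<le> x \<Longrightarrow> x \<le> t + e \<Longrightarrow> f x = real n powi s' * x + c'"
    and "t \<notin> adic_rationals n \<Longrightarrow> s = s' \<and> c = c'"
  shows "locally_adic n f t"
  unfolding locally_adic_def using assms by blast

lemma locally_adicE:
  assumes "locally_adic n f t"
  obtains e s s' c c' where "e > 0" "c \<in> adic_rationals n" "c' \<in> adic_rationals n"
    "\<And>x. x \<in> {0..1} \<Longrightarrow> t - e \<le> x \<Longrightarrow> x \<le> t \<Longrightarrow> f x = real n powi s * x + c"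
    "\<And>x. x \<in> {0..1} \<Longrightarrow> t \<le> x \<Longrightarrow> x \<le> t + e \<Longrightarrow> f x = real n powi s' * x + c'"
    "t \<notin> adic_rationals n \<Longrightarrow> s = s' \<and> c = c'"
  using assms unfolding locally_adic_def by blast

lemma subdivision_interval:
  fixes a :: "nat \<Rightarrow> real"
  assumes "\<And>j. j < k \<Longrightarrow> a j < a (Suc j)"
  shows "a 0 \<le> t \<Longrightarrow> t < a k \<Longrightarrow> \<exists>j<k. a j \<le> t \<and> t < a (Suc j)"
    and "a 0 < t \<Longrightarrow> t \<le> a k \<Longrightarrow> \<exists>j<k. a j < t \<and> t \<le> a (Suc j)"
proof -
  show "\<exists>j<k. a j \<le> t \<and> t < a (Suc j)" if "a 0 \<le> t" "t < a k"
    using that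
  proof (induction k)
    case (Suc k)
    then show ?case by (cases "t < a k") (auto intro: less_SucI)
  qed simp
  show "\<exists>j<k. a j < t \<and> t \<le> a (Suc j)" if "a 0 < t" "t \<le> a k"
    using that
  proof (induction k)
    case (Suc k)
    then show ?case by (cases "t \<le> a k") (auto intro: less_SucI)
  qed simp
qed

lemma F_set_pieces:
  assumes n: "n \<ge> 2" and f: "f \<in> F_set n"
  obtains k a s c where "subdivision k a" "\<And>j. j \<le> k \<Longrightarrow> a j \<in> adic_rationals n"
    "\<And>j. j < k \<Longrightarrow> c j \<in> adic_rationals n"
    "\<And>j x. j < k \<Longrightarrow> x \<in> {a j..a (Suc j)} \<Longrightarrow> f x = real n powi s j * x + c j"
proof -
  have n1: "n \<ge> 1" using n by simp
  have hp: "f \<in> homeo_plus {0..1}" using f unfolding F_set_def by simp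
  obtain k a where sub: "subdivision k a" and ad: "\<forall>j\<le>k. a j \<in> adic_rationals n"
    and pc: "\<forall>j<k. \<exists>s::int. \<forall>x\<in>{a j..a (Suc j)}. f x = f (a j) + real n powi s * (x - a j)"
    using f unfolding F_set_def by blast
  obtain s where s: "\<And>j x. j < k \<Longrightarrow> x \<in> {a j..a (Suc j)} \<Longrightarrow>
      f x = f (a j) + real n powi s j * (x - a j)" using pc by metis
  \<comment> \<open>That the values at the subdivision points are adic is not part of
    \<open>F_set_def\<close>; it propagates from \<open>f 0 = 0\<close> along the pieces and makes
    the constants adic.\<close>
  have fa: "f (a j) \<in> adic_rationals n" if "j \<le> k" for j
    using that
  proof (induction j)
    case 0
    then show ?case using sub homeo_plusD(5)[OF hp] by (simp add: subdivision_def)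
  next
    case (Suc j)
    have lt: "a j < a (Suc j)" using sub Suc.prems by (simp add: subdivision_def)
    have "f (a (Suc j)) = f (a j) + real n powi s j * (a (Suc j) - a j)"
      using s[of j "a (Suc j)"] Suc.prems lt by auto
    also have "\<dots> \<in> adic_rationals n"
      using Suc ad n1
      by (intro adic_rationals_add adic_rationals_mult adic_rationals_diff adic_rationals_powi) auto
    finally show ?case .
  qed
  define c where "c j = f (a j) - real n powi s j * a j" for j
  show thesis
  proof (rule that[of k a c s])
    show "subdivision k a" by fact
    show "a j \<in> adic_rationals n" if "j \<le> k" for j using ad that by blast
    show "c j \<in> adic_rationals n" if "j < k" for j
      unfolding c_def using that fa ad n1
      by (intro adic_rationals_diff adic_rationals_mult adic_rationals_powi) auto
    show "f x = real n powi s j * x + c j" if "j < k" "x \<in> {a j..a (Suc j)}" for j x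
      using s[OF that] by (simp add: c_def algebra_simps)
  qed
qed

lemma F_set_locally_adic:
  assumes n: "n \<ge> 2" and f: "f \<in> F_set n" and t: "t \<in> {0..1}"
  shows "locally_adic n f t"
proof -
  obtain k a s c where sub: "subdivision k a" and ad: "\<And>j. j \<le> k \<Longrightarrow> a j \<in> adic_rationals n"
    and c: "\<And>j. j < k \<Longrightarrow> c j \<in> adic_rationals n"
    and pc: "\<And>j x. j < k \<Longrightarrow> x \<in> {a j..a (Suc j)} \<Longrightarrow> f x = real n powi s j * x + c j"
    using F_set_pieces[OF n f] by metis
  have hp: "f \<in> homeo_plus {0..1}" using f unfolding F_set_def by simp
  have a: "a 0 = 0" "a k = 1" "\<And>j. j < k \<Longrightarrow> a j < a (Suc j)"
    using sub by (auto simp: subdivision_def)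
  have R: "\<exists>j<k. \<exists>e>0. a j \<le> t \<and> (\<forall>x\<in>{0..1}. t \<le> x \<and> x \<le> t + e \<longrightarrow> f x = real n powi s j * x + c j)"
    if t1: "t < 1"
  proof -
    obtain j where j: "j < k" "a j \<le> t" "t < a (Suc j)"
      using subdivision_interval(1)[of k a t] a t t1 by auto
    show ?thesis
      using j pc[OF j(1)] by (intro exI[of _ j] conjI exI[of _ "a (Suc j) - t"]) auto
  qed
  have L: "\<exists>j<k. \<exists>e>0. (\<forall>x\<in>{0..1}. t - e \<le> x \<and> x \<le> t \<longrightarrow> f x = real n powi s j * x + c j)"
    if t0: "t > 0"
  proof -
    obtain j where j: "j < k" "a j < t" "t \<le> a (Suc j)"
      using subdivision_interval(2)[of k a t] a t t0 by auto
    show ?thesis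
      using j pc[OF j(1)] by (intro exI[of _ j] conjI exI[of _ "t - a j"]) auto
  qed
  show ?thesis
  proof (cases "t \<in> adic_rationals n")
    case True
    \<comment> \<open>At \<open>t = 0\<close> the left condition concerns the point 0 alone, so
      slope 1 and constant 0 serve; likewise on the right at \<open>t = 1\<close>.\<close>
    have L': "\<exists>s. \<exists>c\<in>adic_rationals n. \<exists>e>0. \<forall>x\<in>{0..1}. t - e \<le> x \<and> x \<le> t \<longrightarrow> f x = real n powi s * x + c"
    proof (cases "t = 0")
      case True
      then show ?thesis using homeo_plusD(5)[OF hp]
        by (intro exI[of _ 0] bexI[of _ 0] exI[of _ 1]) auto
    next
      case False
      then show ?thesis using L c t by (smt (verit) atLeastAtMost_iff)
    qed
    have R': "\<exists>s. \<exists>c\<in>adic_rationals n. \<exists>e>0. \<forall>x\<in>{0..1}. t \<le> x \<and> x \<le> t + e \<longrightarrow> f x = real n powi s * x + c"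
    proof (cases "t = 1")
      case True
      then show ?thesis using homeo_plusD(6)[OF hp]
        by (intro exI[of _ 0] bexI[of _ 0] exI[of _ 1]) auto
    next
      case False
      then show ?thesis using R c t by (smt (verit) atLeastAtMost_iff)
    qed
    obtain s1 c1 e1 where 1: "c1 \<in> adic_rationals n" "e1 > 0"
      "\<forall>x\<in>{0..1}. t - e1 \<le> x \<and> x \<le> t \<longrightarrow> f x = real n powi s1 * x + c1" using L' by blast
    obtain s2 c2 e2 where 2: "c2 \<in> adic_rationals n" "e2 > 0"
      "\<forall>x\<in>{0..1}. t \<le> x \<and> x \<le> t + e2 \<longrightarrow> f x = real n powi s2 * x + c2" using R' by blast
    show ?thesis
      by (rule locally_adicI[of "min e1 e2" c1 n c2]) (use 1 2 True in auto)
  next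
    case False
    then have t1: "t < 1" "t \<noteq> 0" using t by (metis adic_rationals_1 adic_rationals_0 atLeastAtMost_iff order.order_iff_strict)+
    obtain j where j: "j < k" "a j \<le> t" "t < a (Suc j)"
      using subdivision_interval(1)[of k a t] a t t1 by auto
    have "a j \<noteq> t" using False ad[of j] j(1) by auto
    then have "a j < t" using j by simp
    then show ?thesis
      using j pc[OF j(1)] c[OF j(1)]
      by (intro locally_adicI[of "min (t - a j) (a (Suc j) - t)" "c j" n "c j" _ _ "s j" "s j"]) auto
  qed
qed

text \<open>Compactness of the unit interval through \<open>Bolzano\<close>: close to a point only
  that point can break the map, and the break sets of adjacent intervals are united. Their junction
  is added only if it is adic; at a non-adic junction the local condition makes the two adjacent
  pieces one.\<close>

lemma locally_adic_finite_breaks: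
  assumes n: "n \<ge> 2" and loc: "\<And>t. t \<in> {0..1} \<Longrightarrow> locally_adic n f t"
  shows "\<exists>B. finite B \<and> B \<subseteq> adic_rationals n \<and>
    (\<forall>x y. 0 \<le> x \<and> x < y \<and> y \<le> 1 \<and> {x<..<y} \<inter> B = {} \<longrightarrow>
      (\<exists>s. \<exists>c\<in>adic_rationals n. \<forall>z\<in>{x..y}. f z = real n powi s * z + c))"
proof -
  define A where "A x y \<longleftrightarrow> (\<exists>s. \<exists>c\<in>adic_rationals n. \<forall>z\<in>{x..y}. f z = real n powi s * z + c)" for x y
  \<comment> \<open>The guard makes \<open>P u v\<close> vacuous when the interval leaves
    \<open>[0,1]\<close>, as small neighbourhoods of the end points do.\<close>
  define P where "P u v \<longleftrightarrow> (0 \<le> u \<and> v \<le> 1 \<longrightarrow> (\<exists>B. finite B \<and> B \<subseteq> adic_rationals n \<and>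
    (\<forall>x y. u \<le> x \<and> x < y \<and> y \<le> v \<and> {x<..<y} \<inter> B = {} \<longrightarrow> A x y)))" for u v
  have "P 0 1"
  proof (rule Bolzano)
    show "(0::real) \<le> 1" by simp
  next
    fix u v w assume uv: "P u v" and vw: "P v w" and le: "u \<le> v" "v \<le> w"
    show "P u w" unfolding P_def
    proof
      assume I: "0 \<le> u \<and> w \<le> 1"
      obtain B1 where B1: "finite B1" "B1 \<subseteq> adic_rationals n"
        "\<And>x y. u \<le> x \<Longrightarrow> x < y \<Longrightarrow> y \<le> v \<Longrightarrow> {x<..<y} \<inter> B1 = {} \<Longrightarrow> A x y"
        using uv I le unfolding P_def by (smt (verit))
      obtain B2 where B2: "finite B2" "B2 \<subseteq> adic_rationals n"
        "\<And>x y. v \<le> x \<Longrightarrow> x < y \<Longrightarrow> y \<le> w \<Longrightarrow> {x<..<y} \<inter> B2 = {} \<Longrightarrow> A x y"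
        using vw I le unfolding P_def by (smt (verit))
      have "A x y" if xy: "u \<le> x" "x < y" "y \<le> w"
        and dj: "{x<..<y} \<inter> (B1 \<union> B2 \<union> ({v} \<inter> adic_rationals n)) = {}" for x y
      proof -
        consider "y \<le> v" | "v \<le> x" | "x < v" "v < y" by linarith
        then show ?thesis
        proof cases
          case 1
          then show ?thesis using B1(3)[of x y] xy dj by blast
        next
          case 2
          then show ?thesis using B2(3)[of x y] xy dj by blast
        next
          case 3
          then have vD: "v \<notin> adic_rationals n" using dj by auto
          have "{x<..<v} \<subseteq> {x<..<y}" "{v<..<y} \<subseteq> {x<..<y}" using 3 by auto
          then have "{x<..<v} \<inter> B1 = {}" "{v<..<y} \<inter> B2 = {}" using dj by blast+
          then have "A x v" "A v y" using B1(3)[of x v] B2(3)[of v y] xy 3 by auto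
          then obtain s1 c1 s2 c2 where 1: "c1 \<in> adic_rationals n" "\<forall>z\<in>{x..v}. f z = real n powi s1 * z + c1"
            and 2: "c2 \<in> adic_rationals n" "\<forall>z\<in>{v..y}. f z = real n powi s2 * z + c2"
            unfolding A_def by blast
          have "v \<in> {0..1}" using I le by auto
          from locally_adicE[OF loc[OF this]] obtain e s c where e: "e > 0"
            and l: "\<And>x. x \<in> {0..1} \<Longrightarrow> v - e \<le> x \<Longrightarrow> x \<le> v \<Longrightarrow> f x = real n powi s * x + c"
            and r: "\<And>x. x \<in> {0..1} \<Longrightarrow> v \<le> x \<Longrightarrow> x \<le> v + e \<Longrightarrow> f x = real n powi s * x + c"
            using vD by metis
          define p where "p = max x (v - e)"
          define q where "q = min y (v + e)"
          have p: "p < v" "x \<le> p" "v - e \<le> p" and q: "v < q" "q \<le> y" "q \<le> v + e"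
            unfolding p_def q_def using e 3 by auto
          have "s1 = s" "c1 = c"
            using powi_affine_unique[OF n, of p v s1 c1 s c] 1(2) l[of p] l[of v] p e I xy 3 by auto
          moreover have "s2 = s" "c2 = c"
            using powi_affine_unique[OF n, of v q s2 c2 s c] 2(2) r[of q] r[of v] q e I xy 3 by auto
          ultimately show ?thesis unfolding A_def using 1 2 by (metis atLeastAtMost_iff linear)
        qed
      qed
      then show "\<exists>B. finite B \<and> B \<subseteq> adic_rationals n \<and>
        (\<forall>x y. u \<le> x \<and> x < y \<and> y \<le> w \<and> {x<..<y} \<inter> B = {} \<longrightarrow> A x y)"
        using B1(1,2) B2(1,2)
        by (intro exI[of _ "B1 \<union> B2 \<union> ({v} \<inter> adic_rationals n)"]) auto
    qed
  next
    fix t :: real assume "0 \<le> t" "t \<le> 1"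
    then have tI: "t \<in> {0..1}" by simp
    from locally_adicE[OF loc[OF tI]] obtain e s c s' c' where e: "e > 0"
      and c: "c \<in> adic_rationals n" "c' \<in> adic_rationals n"
      and l: "\<And>x. x \<in> {0..1} \<Longrightarrow> t - e \<le> x \<Longrightarrow> x \<le> t \<Longrightarrow> f x = real n powi s * x + c"
      and r: "\<And>x. x \<in> {0..1} \<Longrightarrow> t \<le> x \<Longrightarrow> x \<le> t + e \<Longrightarrow> f x = real n powi s' * x + c'"
      and D: "t \<notin> adic_rationals n \<Longrightarrow> s = s' \<and> c = c'" by metis
    have "P u v" if uv: "u \<le> t" "t \<le> v" "v - u < e" for u v
      unfolding P_def
    proof
      assume I: "0 \<le> u \<and> v \<le> 1"
      have "A x y" if xy: "u \<le> x" "x < y" "y \<le> v" "{x<..<y} \<inter> ({t} \<inter> adic_rationals n) = {}" for x y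
      proof -
        consider "y \<le> t" | "t \<le> x" | "x < t" "t < y" by linarith
        then show ?thesis
        proof cases
          case 1
          then show ?thesis unfolding A_def using xy uv I l c
            by (intro exI[of _ s] bexI[of _ c]) auto
        next
          case 2
          then show ?thesis unfolding A_def using xy uv I r c
            by (intro exI[of _ s'] bexI[of _ c']) auto
        next
          case 3
          then have "t \<notin> adic_rationals n" using xy by auto
          then have "s' = s" "c' = c" using D by auto
          then have "f z = real n powi s * z + c" if "z \<in> {x..y}" for z
            using l[of z] r[of z] that xy uv I by (cases "z \<le> t") auto
          then show ?thesis unfolding A_def using c by blast
        qed
      qed
      then show "\<exists>B. finite B \<and> B \<subseteq> adic_rationals n \<and>
        (\<forall>x y. u \<le> x \<and> x < y \<and> y \<le> v \<and> {x<..<y} \<inter> B = {} \<longrightarrow> A x y)"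
        by (intro exI[of _ "{t} \<inter> adic_rationals n"]) auto
    qed
    then show "\<exists>d>0. \<forall>u v. u \<le> t \<and> t \<le> v \<and> v - u < d \<longrightarrow> P u v" using e by blast
  qed
  then show ?thesis unfolding P_def A_def by simp
qed

text \<open>For the nontrivial direction the finite break set is cut down to the unit interval,
  enlarged by 0 and 1 and sorted; consecutive elements then enclose no break.\<close>

lemma F_set_iff:
  assumes n: "n \<ge> 2"
  shows "f \<in> F_set n \<longleftrightarrow> f \<in> homeo_plus {0..1} \<and> (\<forall>t\<in>{0..1}. locally_adic n f t)"
proof (intro iffI conjI ballI)
  assume "f \<in> F_set n"
  then show "f \<in> homeo_plus {0..1}" unfolding F_set_def by simp
next
  fix t :: real assume "f \<in> F_set n" "t \<in> {0..1}"
  then show "locally_adic n f t" using F_set_locally_adic[OF n] by blast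
next
  assume R: "f \<in> homeo_plus {0..1} \<and> (\<forall>t\<in>{0..1}. locally_adic n f t)"
  obtain B where B: "finite B" "B \<subseteq> adic_rationals n"
    "\<And>x y. 0 \<le> x \<Longrightarrow> x < y \<Longrightarrow> y \<le> 1 \<Longrightarrow> {x<..<y} \<inter> B = {} \<Longrightarrow>
      \<exists>s. \<exists>c\<in>adic_rationals n. \<forall>z\<in>{x..y}. f z = real n powi s * z + c"
    using locally_adic_finite_breaks[OF n] R by (smt (verit))
  define C where "C = B \<inter> {0..1} \<union> {0,1}"
  define xs where "xs = sorted_list_of_set C"
  have fin: "finite C" using B(1) unfolding C_def by simp
  have set: "set xs = C" and srt: "sorted_wrt (<) xs"
    unfolding xs_def using fin by auto
  have ne: "xs \<noteq> []" using set unfolding C_def by auto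
  define k where "k = length xs - 1"
  have len: "length xs = Suc k" using ne unfolding k_def by (cases xs) auto
  have lt: "xs ! i < xs ! j" if "i < j" "j \<le> k" for i j
    using srt that len by (simp add: sorted_wrt_nth_less)
  have le: "xs ! i \<le> xs ! j" if "i \<le> j" "j \<le> k" for i j
    using lt[of i j] that by (cases "i = j") auto
  have mem: "xs ! j \<in> C" if "j \<le> k" for j using that len set nth_mem by fastforce
  have idx: "\<exists>j\<le>k. xs ! j = x" if "x \<in> C" for x
    using that set len by (metis in_set_conv_nth less_Suc_eq_le)
  have C01: "C \<subseteq> {0..1}" unfolding C_def by auto
  have sub: "subdivision k (\<lambda>j. xs ! j)"
    unfolding subdivision_def
  proof (intro conjI allI impI)
    obtain j where "j \<le> k" "xs ! j = 0" using idx[of 0] unfolding C_def by auto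
    then have "xs ! 0 \<le> 0" using le[of 0 j] by simp
    then show "xs ! 0 = 0" using mem[of 0] C01 by force
    obtain j where "j \<le> k" "xs ! j = 1" using idx[of 1] unfolding C_def by auto
    then have "1 \<le> xs ! k" using le[of j k] by simp
    then show "xs ! k = 1" using mem[of k] C01 by force
    show "xs ! j < xs ! Suc j" if "j < k" for j using lt that by simp
  qed
  show "f \<in> F_set n" unfolding F_set_def
  proof (intro CollectI conjI exI)
    show "f \<in> homeo_plus {0..1}" using R by simp
    show "subdivision k (\<lambda>j. xs ! j)" by fact
    show "\<forall>j\<le>k. xs ! j \<in> adic_rationals n"
    proof (intro allI impI)
      fix j assume "j \<le> k"
      from mem[OF this] show "xs ! j \<in> adic_rationals n" using B(2) unfolding C_def by auto
    qed
    show "\<forall>j<k. \<exists>s. \<forall>x\<in>{xs ! j..xs ! Suc j}. f x = f (xs ! j) + real n powi s * (x - xs ! j)"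
    proof (intro allI impI)
      fix j assume j: "j < k"
      have "{xs ! j<..<xs ! Suc j} \<inter> C = {}"
      proof (rule ccontr)
        assume "\<not> ?thesis"
        then obtain x where x: "x \<in> C" "xs ! j < x" "x < xs ! Suc j" by auto
        obtain i where i: "i \<le> k" "xs ! i = x" using idx[OF x(1)] by blast
        show False
        proof (cases "i \<le> j")
          case True
          then show False using le[of i j] i j x by simp
        next
          case False
          then show False using le[of "Suc j" i] i j x by simp
        qed
      qed
      moreover have "0 \<le> xs ! j" "xs ! Suc j \<le> 1" using mem[of j] mem[of "Suc j"] j C01 by force+
      ultimately have "{xs ! j<..<xs ! Suc j} \<inter> B = {}" unfolding C_def by force
      then obtain s c where sc: "\<forall>z\<in>{xs ! j..xs ! Suc j}. f z = real n powi s * z + c"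
        using B(3)[of "xs ! j" "xs ! Suc j"] lt[of j "Suc j"] j \<open>0 \<le> xs ! j\<close> \<open>xs ! Suc j \<le> 1\<close> by auto
      then have "f (xs ! j) = real n powi s * (xs ! j) + c" using lt[of j "Suc j"] j by auto
      then show "\<exists>s. \<forall>x\<in>{xs ! j..xs ! Suc j}. f x = f (xs ! j) + real n powi s * (x - xs ! j)"
        using sc by (intro exI[of _ s]) (auto simp: algebra_simps)
    qed
  qed
qed

lemma locally_adic_continuous_on:
  assumes n: "n \<ge> 2" and loc: "\<And>t. t \<in> {0..1} \<Longrightarrow> locally_adic n f t"
  shows "continuous_on {0..1} f"
  unfolding continuous_on_iff
proof (intro ballI allI impI)
  fix t \<epsilon> :: real assume t: "t \<in> {0..1}" and ep: "0 < \<epsilon>"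
  from locally_adicE[OF loc[OF t]] obtain e s s' c c' where e: "e > 0"
    and l: "\<And>x. x \<in> {0..1} \<Longrightarrow> t - e \<le> x \<Longrightarrow> x \<le> t \<Longrightarrow> f x = real n powi s * x + c"
    and r: "\<And>x. x \<in> {0..1} \<Longrightarrow> t \<le> x \<Longrightarrow> x \<le> t + e \<Longrightarrow> f x = real n powi s' * x + c'" by metis
  define M where "M = real n powi s + real n powi s'"
  have pos: "real n powi s > 0" "real n powi s' > 0" using powi_pos[OF n] by auto
  then have M: "M > 0" unfolding M_def by simp
  define d where "d = min e (\<epsilon> / M)"
  have "dist (f x) (f t) < \<epsilon>" if x: "x \<in> {0..1}" "dist x t < d" for x
  proof -
    have xd: "\<bar>x - t\<bar> < e" "\<bar>x - t\<bar> < \<epsilon> / M" using x unfolding d_def dist_real_def by auto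
    have "\<bar>f x - f t\<bar> \<le> M * \<bar>x - t\<bar>"
    proof (cases "x \<le> t")
      case True
      then have "f x - f t = real n powi s * (x - t)"
        using l[of x] l[of t] x t xd e by (auto simp: algebra_simps)
      then show ?thesis using pos unfolding M_def by (simp add: abs_mult mult_right_mono)
    next
      case False
      then have "f x - f t = real n powi s' * (x - t)"
        using r[of x] r[of t] x t xd e by (auto simp: algebra_simps)
      then show ?thesis using pos unfolding M_def by (simp add: abs_mult mult_right_mono)
    qed
    also have "\<dots> < \<epsilon>" using xd(2) M by (simp add: field_simps)
    finally show ?thesis by (simp add: dist_real_def)
  qed
  moreover have "d > 0" unfolding d_def using e ep M by simp
  ultimately show "\<exists>d>0. \<forall>x\<in>{0..1}. dist x t < d \<longrightarrow> dist (f x) (f t) < \<epsilon>" by blast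
qed

lemma F_setI:
  assumes n: "n \<ge> 2" and "f \<in> extensional {0..1}" "strict_mono_on {0..1} f" "f 0 = 0" "f 1 = 1"
    and "\<And>t. t \<in> {0..1} \<Longrightarrow> locally_adic n f t"
  shows "f \<in> F_set n"
  using assms locally_adic_continuous_on[OF n, of f]
  by (auto simp: F_set_iff[OF n] intro!: homeo_plusI)

lemma F_set_homeo: "f \<in> F_set n \<Longrightarrow> f \<in> homeo_plus {0..1}"
  unfolding F_set_def by simp

lemmas F_setD = homeo_plusD[OF F_set_homeo]

lemma F_set_eqI:
  assumes "f \<in> F_set n" "g \<in> F_set m" "\<And>x. x \<in> {0..1} \<Longrightarrow> f x = g x"
  shows "f = g"
  using assms(3) F_setD(1)[OF assms(1)] F_setD(1)[OF assms(2)] by (intro extensionalityI) auto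

lemma locally_adic_cong:
  assumes "\<And>x. x \<in> {0..1} \<Longrightarrow> f x = g x"
  shows "locally_adic n f t = locally_adic n g t"
  unfolding locally_adic_def using assms by simp

section \<open>Closure under composition, inversion and gluing\<close>

lemma locally_adic_compose:
  assumes n: "n \<ge> 2" and f: "f \<in> F_set n" and g: "g \<in> F_set n" and t: "t \<in> {0..1}"
  shows "locally_adic n (\<lambda>x. g (f x)) t"
proof -
  have n1: "n \<ge> 1" using n by simp
  from locally_adicE[OF F_set_locally_adic[OF n f t]] obtain e s s' c c' where e: "e > 0"
    and c: "c \<in> adic_rationals n" "c' \<in> adic_rationals n"
    and l: "\<And>x. x \<in> {0..1} \<Longrightarrow> t - e \<le> x \<Longrightarrow> x \<le> t \<Longrightarrow> f x = real n powi s * x + c"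
    and r: "\<And>x. x \<in> {0..1} \<Longrightarrow> t \<le> x \<Longrightarrow> x \<le> t + e \<Longrightarrow> f x = real n powi s' * x + c'"
    and D: "t \<notin> adic_rationals n \<Longrightarrow> s = s' \<and> c = c'" by metis
  have ft: "f t \<in> {0..1}" using F_setD(7)[OF f t] .
  from locally_adicE[OF F_set_locally_adic[OF n g ft]] obtain e2 z z' d d' where e2: "e2 > 0"
    and d: "d \<in> adic_rationals n" "d' \<in> adic_rationals n"
    and l2: "\<And>x. x \<in> {0..1} \<Longrightarrow> f t - e2 \<le> x \<Longrightarrow> x \<le> f t \<Longrightarrow> g x = real n powi z * x + d"
    and r2: "\<And>x. x \<in> {0..1} \<Longrightarrow> f t \<le> x \<Longrightarrow> x \<le> f t + e2 \<Longrightarrow> g x = real n powi z' * x + d'"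
    and D2: "f t \<notin> adic_rationals n \<Longrightarrow> z = z' \<and> d = d'" by metis
  have pos: "real n powi s > 0" "real n powi s' > 0" using powi_pos[OF n] by auto
  have add: "real n powi (z + s) = real n powi z * real n powi s" for z s :: int
    using n by (intro power_int_add) auto
  \<comment> \<open>Distances to \<open>t\<close> are stretched by the one-sided slopes of
    \<open>f\<close>, so \<open>e2\<close> is divided by both of them to keep \<open>f x\<close>
    where the pieces of \<open>g\<close> are known.\<close>
  define e3 where "e3 = min e (min (e2 / real n powi s) (e2 / real n powi s'))"
  show ?thesis
  proof (rule locally_adicI[of e3 "real n powi z * c + d" n "real n powi z' * c' + d'" _ _ "z + s" "z' + s'"])
    show "e3 > 0" unfolding e3_def using e e2 pos by simp
    show "real n powi z * c + d \<in> adic_rationals n" "real n powi z' * c' + d' \<in> adic_rationals n"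
      using n1 c d by (auto simp: adic_rationals_powi_affine_iff)
    show "g (f x) = real n powi (z + s) * x + (real n powi z * c + d)"
      if x: "x \<in> {0..1}" "t - e3 \<le> x" "x \<le> t" for x
    proof -
      have xt: "t - x \<le> e" "t - x \<le> e2 / real n powi s" using x unfolding e3_def by auto
      have fx: "f x = real n powi s * x + c" using l[of x] x xt by auto
      have "f t - f x = real n powi s * (t - x)" using fx l[of t] t e by (simp add: algebra_simps)
      also have "\<dots> \<le> e2" using xt(2) pos by (simp add: pos_le_divide_eq mult.commute)
      finally have "f t - e2 \<le> f x" by simp
      moreover have "f x \<le> f t" using F_setD(9)[OF f x(1) t] x by simp
      ultimately have "g (f x) = real n powi z * f x + d"
        using l2 F_setD(7)[OF f x(1)] by blast
      then show ?thesis unfolding fx add by (simp add: algebra_simps)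
    qed
    show "g (f x) = real n powi (z' + s') * x + (real n powi z' * c' + d')"
      if x: "x \<in> {0..1}" "t \<le> x" "x \<le> t + e3" for x
    proof -
      have xt: "x - t \<le> e" "x - t \<le> e2 / real n powi s'" using x unfolding e3_def by auto
      have fx: "f x = real n powi s' * x + c'" using r[of x] x xt by auto
      have "f x - f t = real n powi s' * (x - t)" using fx r[of t] t e by (simp add: algebra_simps)
      also have "\<dots> \<le> e2" using xt(2) pos by (simp add: pos_le_divide_eq mult.commute)
      finally have "f x \<le> f t + e2" by simp
      moreover have "f t \<le> f x" using F_setD(9)[OF f t x(1)] x by simp
      ultimately have "g (f x) = real n powi z' * f x + d'"
        using r2 F_setD(7)[OF f x(1)] by blast
      then show ?thesis unfolding fx add by (simp add: algebra_simps)
    qed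
    show "z + s = z' + s' \<and> real n powi z * c + d = real n powi z' * c' + d'"
      if "t \<notin> adic_rationals n"
    proof -
      have "f t \<notin> adic_rationals n"
        using that l[of t] t e n1 c by (simp add: adic_rationals_powi_affine_iff)
      then show ?thesis using D[OF that] D2 by simp
    qed
  qed
qed

definition inverse_map :: "(real \<Rightarrow> real) \<Rightarrow> real \<Rightarrow> real" where
  "inverse_map f = (\<lambda>x\<in>{0..1}. inv_into {0..1} f x)"

lemma inverse_map:
  assumes "f \<in> homeo_plus {0..1}" "x \<in> {0..1}"
  shows "inverse_map f (f x) = x" "f (inverse_map f x) = x" "inverse_map f x \<in> {0..1}"
proof -
  have b: "inj_on f {0..1}" "f ` {0..1} = {0..1}"
    using homeo_plusD(4)[OF assms(1)] by (auto simp: bij_betw_def)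
  show "inverse_map f (f x) = x"
    using assms homeo_plusD(7)[OF assms] b by (simp add: inverse_map_def inv_into_f_f)
  show "f (inverse_map f x) = x" "inverse_map f x \<in> {0..1}"
    using assms b f_inv_into_f[of x f "{0..1}"] inv_into_into[of x f "{0..1}"] by (simp_all add: inverse_map_def)
qed

lemma inverse_map_homeo:
  assumes f: "f \<in> homeo_plus {0..1}"
  shows "inverse_map f \<in> homeo_plus {0..1}"
proof -
  obtain g where hm: "homeomorphism {0..1} {0..1} f g"
    using f unfolding homeo_plus_def by auto
  have eq: "g x = inverse_map f x" if "x \<in> {0..1}" for x
  proof -
    have "f (g x) = x" "g x \<in> {0..1}" using hm that by (auto simp: homeomorphism_def)
    then show ?thesis using inverse_map(1)[OF f, of "g x"] by simp
  qed
  have "homeomorphism {0..1} {0..1} (inverse_map f) f"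
    by (rule homeomorphism_cong[OF homeomorphism_symD[OF hm]]) (auto simp: eq)
  moreover have "strict_mono_on {0..1} (inverse_map f)"
  proof (rule strict_mono_onI)
    fix x y :: real assume xy: "x \<in> {0..1}" "y \<in> {0..1}" "x < y"
    then show "inverse_map f x < inverse_map f y"
      using homeo_plusD(8)[OF f, of "inverse_map f x" "inverse_map f y"] inverse_map[OF f] by simp
  qed
  moreover have "inverse_map f \<in> extensional {0..1}" unfolding inverse_map_def by simp
  ultimately show ?thesis unfolding homeo_plus_def by blast
qed

lemma F_set_inverse:
  assumes n: "n \<ge> 2" and f: "f \<in> F_set n"
  shows "inverse_map f \<in> F_set n"
  unfolding F_set_iff[OF n]
proof (intro conjI ballI)
  have n1: "n \<ge> 1" using n by simp
  have hf: "f \<in> homeo_plus {0..1}" by (rule F_set_homeo[OF f])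
  show "inverse_map f \<in> homeo_plus {0..1}" by (rule inverse_map_homeo[OF hf])
  fix u :: real assume u: "u \<in> {0..1}"
  define t where "t = inverse_map f u"
  have t: "t \<in> {0..1}" and ft: "f t = u" unfolding t_def using inverse_map[OF hf u] by auto
  from locally_adicE[OF F_set_locally_adic[OF n f t]] obtain e s s' c c' where e: "e > 0"
    and c: "c \<in> adic_rationals n" "c' \<in> adic_rationals n"
    and l: "\<And>x. x \<in> {0..1} \<Longrightarrow> t - e \<le> x \<Longrightarrow> x \<le> t \<Longrightarrow> f x = real n powi s * x + c"
    and r: "\<And>x. x \<in> {0..1} \<Longrightarrow> t \<le> x \<Longrightarrow> x \<le> t + e \<Longrightarrow> f x = real n powi s' * x + c'"
    and D: "t \<notin> adic_rationals n \<Longrightarrow> s = s' \<and> c = c'" by metis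
  have pos: "real n powi s > 0" "real n powi s' > 0" using powi_pos[OF n] by auto
  have inv: "real n powi (- z) * real n powi z = 1" for z :: int
    using n power_int_add[of "real n" "- z" z] by simp
  show "locally_adic n (inverse_map f) u"
  proof (rule locally_adicI[of "min (real n powi s * e) (real n powi s' * e)"
        "real n powi (- s) * (- c) + 0" n "real n powi (- s') * (- c') + 0" _ _ "- s" "- s'"])
    show "min (real n powi s * e) (real n powi s' * e) > 0" using e pos by simp
    show "real n powi (- s) * (- c) + 0 \<in> adic_rationals n" "real n powi (- s') * (- c') + 0 \<in> adic_rationals n"
      using c by (simp_all only: adic_rationals_powi_affine_iff[OF n1 adic_rationals_0] adic_rationals_uminus)
    show "inverse_map f w = real n powi (- s) * w + (real n powi (- s) * (- c) + 0)"
      if w: "w \<in> {0..1}" "u - min (real n powi s * e) (real n powi s' * e) \<le> w" "w \<le> u" for w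
    proof -
      define x where "x = inverse_map f w"
      have x: "x \<in> {0..1}" and fx: "f x = w" unfolding x_def using inverse_map[OF hf w(1)] by auto
      have xt: "x \<le> t" using homeo_plusD(9)[OF hf x t] fx ft w by simp
      have "t - e \<le> x"
      proof (rule ccontr)
        assume "\<not> ?thesis"
        then have lt: "x < t - e" by simp
        then have tI: "t - e \<in> {0..1}" using x t e by auto
        have "f x < f (t - e)" using homeo_plusD(8)[OF hf x tI] lt by simp
        also have "f (t - e) = u - real n powi s * e"
          using l[OF tI] l[OF t] e ft by (simp add: algebra_simps)
        finally show False using fx w by simp
      qed
      then have "w = real n powi s * x + c" using l[OF x] xt fx by simp
      then have "real n powi (- s) * w + (real n powi (- s) * (- c) + 0) = (real n powi (- s) * real n powi s) * x"
        by (simp add: algebra_simps)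
      then show ?thesis using inv x_def by simp
    qed
    show "inverse_map f w = real n powi (- s') * w + (real n powi (- s') * (- c') + 0)"
      if w: "w \<in> {0..1}" "u \<le> w" "w \<le> u + min (real n powi s * e) (real n powi s' * e)" for w
    proof -
      define x where "x = inverse_map f w"
      have x: "x \<in> {0..1}" and fx: "f x = w" unfolding x_def using inverse_map[OF hf w(1)] by auto
      have xt: "t \<le> x" using homeo_plusD(9)[OF hf t x] fx ft w by simp
      have "x \<le> t + e"
      proof (rule ccontr)
        assume "\<not> ?thesis"
        then have lt: "t + e < x" by simp
        then have tI: "t + e \<in> {0..1}" using x t e by auto
        have "f (t + e) < f x" using homeo_plusD(8)[OF hf tI x] lt by simp
        moreover have "f (t + e) = u + real n powi s' * e"
          using r[OF tI] r[OF t] e ft by (simp add: algebra_simps)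
        ultimately show False using fx w by simp
      qed
      then have "w = real n powi s' * x + c'" using r[OF x] xt fx by simp
      then have "real n powi (- s') * w + (real n powi (- s') * (- c') + 0) = (real n powi (- s') * real n powi s') * x"
        by (simp add: algebra_simps)
      then show ?thesis using inv x_def by simp
    qed
    show "- s = - s' \<and> real n powi (- s) * (- c) + 0 = real n powi (- s') * (- c') + 0"
      if "u \<notin> adic_rationals n"
    proof -
      have "t \<notin> adic_rationals n"
        using that l[OF t] ft e n1 c by (simp add: adic_rationals_powi_affine_iff)
      then show ?thesis using D by simp
    qed
  qed
qed

abbreviation cmp :: "(real \<Rightarrow> real) \<Rightarrow> (real \<Rightarrow> real) \<Rightarrow> real \<Rightarrow> real" (infixr "\<circ>\<^sub>I" 70) where
  "f \<circ>\<^sub>I g \<equiv> compose {0..1} f g"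

lemma F_set_compose:
  assumes n: "n \<ge> 2" and f: "f \<in> F_set n" and g: "g \<in> F_set n"
  shows "f \<circ>\<^sub>I g \<in> F_set n"
proof (rule F_setI[OF n])
  show "f \<circ>\<^sub>I g \<in> extensional {0..1}" by (simp add: compose_def)
  show "strict_mono_on {0..1} (f \<circ>\<^sub>I g)"
    by (rule strict_mono_onI) (use F_setD(7,8)[OF f] F_setD(7,8)[OF g] in \<open>auto simp: compose_def\<close>)
  show "(f \<circ>\<^sub>I g) 0 = 0" "(f \<circ>\<^sub>I g) 1 = 1"
    using F_setD(5,6)[OF f] F_setD(5,6)[OF g] by (auto simp: compose_def)
  fix t :: real assume t: "t \<in> {0..1}"
  have "locally_adic n (f \<circ>\<^sub>I g) t = locally_adic n (\<lambda>x. f (g x)) t"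
    by (rule locally_adic_cong) (simp add: compose_def)
  then show "locally_adic n (f \<circ>\<^sub>I g) t" using locally_adic_compose[OF n g f t] by simp
qed

lemma locally_adic_affine:
  assumes "c \<in> adic_rationals n" "\<And>x. x \<in> {0..1} \<Longrightarrow> f x = real n powi s * x + c"
  shows "locally_adic n f t"
  by (rule locally_adicI[of 1 c n c _ _ s s]) (use assms in auto)

lemma locally_adic_glue:
  assumes "r \<in> adic_rationals n"
    and "\<And>x. x \<in> {0..1} \<Longrightarrow> x \<le> r \<Longrightarrow> f x = f1 x"
    and "\<And>x. x \<in> {0..1} \<Longrightarrow> r \<le> x \<Longrightarrow> f x = f2 x"
    and "locally_adic n f1 t" "locally_adic n f2 t"
  shows "locally_adic n f t"
proof -
  from locally_adicE[OF assms(4)] obtain e s s' c c' where 1: "e > 0"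
     "c \<in> adic_rationals n" "c' \<in> adic_rationals n"
     "\<And>x. x \<in> {0..1} \<Longrightarrow> t - e \<le> x \<Longrightarrow> x \<le> t \<Longrightarrow> f1 x = real n powi s * x + c"
     "\<And>x. x \<in> {0..1} \<Longrightarrow> t \<le> x \<Longrightarrow> x \<le> t + e \<Longrightarrow> f1 x = real n powi s' * x + c'"
     "t \<notin> adic_rationals n \<Longrightarrow> s = s' \<and> c = c'" by metis
  from locally_adicE[OF assms(5)] obtain e2 z z' d d' where 2: "e2 > 0"
     "d \<in> adic_rationals n" "d' \<in> adic_rationals n"
     "\<And>x. x \<in> {0..1} \<Longrightarrow> t - e2 \<le> x \<Longrightarrow> x \<le> t \<Longrightarrow> f2 x = real n powi z * x + d"
     "\<And>x. x \<in> {0..1} \<Longrightarrow> t \<le> x \<Longrightarrow> x \<le> t + e2 \<Longrightarrow> f2 x = real n powi z' * x + d'"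
     "t \<notin> adic_rationals n \<Longrightarrow> z = z' \<and> d = d'" by metis
  consider "t < r" | "t = r" | "r < t" by linarith
  then show ?thesis
  proof cases
    case a: 1
    show ?thesis
      by (rule locally_adicI[of "min e (r - t)" c n c' _ _ s s']) (use a 1 assms(2) in auto)
  next
    case a: 2
    show ?thesis
      by (rule locally_adicI[of "min e e2" c n d' _ _ s z']) (use a 1 2 assms in auto)
  next
    case a: 3
    show ?thesis
      by (rule locally_adicI[of "min e2 (t - r)" d n d' _ _ z z']) (use a 2 assms(3) in auto)
  qed
qed

text \<open>A change of slope is admissible at \<open>y\<close> because \<open>y\<close> is
  \<open>n\<close>-adic. Together with closedness this later produces elements of \<open>H\<close>
  with a prescribed break.\<close>

lemma F_set_glue:
  assumes n: "n \<ge> 2" and f: "f \<in> F_set n" and g: "g \<in> F_set n"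
    and y: "y \<in> {0..1}" "y \<in> adic_rationals n" "f y = g y"
  shows "(\<lambda>x\<in>{0..1}. if x \<le> y then f x else g x) \<in> F_set n" (is "?h \<in> _")
proof (rule F_setI[OF n])
  show "strict_mono_on {0..1} ?h"
  proof (rule strict_mono_onI)
    fix u v :: real assume uv: "u \<in> {0..1}" "v \<in> {0..1}" "u < v"
    consider "v \<le> y" | "y < u" | "u \<le> y" "y < v" by linarith
    then show "?h u < ?h v"
    proof cases
      case 3
      then have "f u \<le> f y" "g y < g v" using F_setD(9)[OF f uv(1) y(1)] F_setD(8)[OF g y(1) uv(2)] by auto
      then show ?thesis using 3 uv y by simp
    qed (use uv F_setD(8)[OF f] F_setD(8)[OF g] in auto)
  qed
  show "?h 0 = 0" "?h 1 = 1" using F_setD(5,6)[OF f] F_setD(5,6)[OF g] y by auto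
  fix t :: real assume t: "t \<in> {0..1}"
  show "locally_adic n ?h t"
    by (rule locally_adic_glue[OF y(2) _ _ F_set_locally_adic[OF n f t] F_set_locally_adic[OF n g t]])
      (use y in \<open>auto split: if_splits\<close>)
qed simp

lemma F_set_id: 
  assumes n: "n \<ge> 2"
  shows "(\<lambda>x\<in>{0..1}. x) \<in> F_set n"
proof (rule F_setI[OF n])
  show "locally_adic n (\<lambda>x\<in>{0..1}. x) t" for t
    by (rule locally_adic_affine[of 0 _ _ 0]) auto
qed (auto intro: strict_mono_onI)

lemma F_set_funpow:
  assumes n: "n \<ge> 2" and f: "f \<in> F_set n"
  obtains g where "g \<in> F_set n" "\<And>x. x \<in> {0..1} \<Longrightarrow> g x = (f ^^ k) x"
proof -
  have "\<exists>g\<in>F_set n. \<forall>x\<in>{0..1}. g x = (f ^^ k) x"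
  proof (induction k)
    case 0
    show ?case by (rule bexI[OF _ F_set_id[OF n]]) simp
  next
    case (Suc k)
    then obtain g where "g \<in> F_set n" "\<forall>x\<in>{0..1}. g x = (f ^^ k) x" by blast
    then show ?case by (intro bexI[OF _ F_set_compose[OF n f]]) (auto simp: compose_def)
  qed
  then show thesis using that by blast
qed

section \<open>Bump functions\<close>

text \<open>Slopes \<open>1/n\<close>, \<open>1\<close>, \<open>n\<close> on intervals of relative lengths \<open>1 - 1/n\<close>, \<open>1/n\<^sup>2\<close> and
  \<open>(n - 1)/n\<^sup>2\<close>.\<close>

definition bump :: "nat \<Rightarrow> real \<Rightarrow> real \<Rightarrow> real \<Rightarrow> real" where
  "bump n p q = (\<lambda>x\<in>{0..1}.
     if x \<le> p then x
     else if x \<le> p + (q - p) * (1 - 1 / real n) then p + (x - p) / real n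
     else if x \<le> q - (q - p) * (1 - 1 / real n) / real n then x - (q - p) * (1 - 1 / real n)\<^sup>2
     else if x \<le> q then q - real n * (q - x)
     else x)"

lemma strict_mono_glue:
  fixes f g :: "real \<Rightarrow> real"
  assumes "strict_mono f" "strict_mono g" "f r = g r"
  shows "strict_mono (\<lambda>x. if x \<le> r then f x else g x)"
proof (rule strict_monoI)
  fix x y :: real assume xy: "x < y"
  consider "y \<le> r" | "r < x" | "x \<le> r" "r < y" by linarith
  then show "(if x \<le> r then f x else g x) < (if y \<le> r then f y else g y)"
  proof cases
    case 3
    then have "f x \<le> f r" "g r < g y"
      using assms(2) strict_mono_mono[OF assms(1)] by (auto simp: strict_mono_less monoD)
    then show ?thesis using 3 assms(3) by simp
  qed (use xy assms in \<open>auto simp: strict_mono_less\<close>)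
qed

lemma bump_in_F_set:
  assumes n: "n \<ge> 2" and p: "p \<in> adic_rationals n" and q: "q \<in> adic_rationals n"
    and pq: "0 \<le> p" "p < q" "q \<le> 1"
  shows "bump n p q \<in> F_set n"
proof -
  have n1: "n \<ge> 1" using n by simp
  define N where "N = real n"
  have N: "N \<ge> 2" unfolding N_def using n by simp
  define r1 where "r1 = p + (q - p) * (1 - 1 / N)"
  define r2 where "r2 = q - (q - p) * (1 - 1 / N) / N"
  \<comment> \<open>The displacement forced by continuity at \<open>r1\<close>: that point lies at
    distance \<open>(q - p) * (1 - 1 / N)\<close> from \<open>p\<close>, and a contraction by
    \<open>N\<close> towards \<open>p\<close> moves it by \<open>1 - 1 / N\<close> times this
    distance.\<close>
  define \<kappa> where "\<kappa> = (q - p) * (1 - 1 / N)\<^sup>2"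
  define A1 where "A1 x = p + (x - p) / N" for x
  define A2 where "A2 x = x - \<kappa>" for x
  define A3 where "A3 x = q - N * (q - x)" for x
  \<comment> \<open>The branches are extended to the whole line and nested from the right, so that
    monotonicity and local affinity both follow from one gluing per breakpoint.\<close>
  define g4 where "g4 x = (if x \<le> q then A3 x else x)" for x
  define g3 where "g3 x = (if x \<le> r2 then A2 x else g4 x)" for x
  define g2 where "g2 x = (if x \<le> r1 then A1 x else g3 x)" for x
  define g1 where "g1 x = (if x \<le> p then x else g2 x)" for x
  have beq: "bump n p q = (\<lambda>x\<in>{0..1}. g1 x)"
    unfolding bump_def g1_def g2_def g3_def g4_def A1_def A2_def A3_def r1_def r2_def \<kappa>_def N_def
    by (rule refl)
  have Nf: "0 < 1 - 1 / N" "1 - 1 / N < 1" using N by (simp_all add: field_simps)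
  have pr1: "p < r1" unfolding r1_def using pq Nf by simp
  have "r2 - r1 = (q - p) * (1 - 1 / N - (1 - 1 / N)) + (q - p) * (1 / N - (1 - 1 / N) / N)"
    unfolding r1_def r2_def by (simp add: algebra_simps)
  also have "\<dots> = (q - p) / N\<^sup>2" using N by (simp add: field_simps power2_eq_square)
  finally have r12': "r2 - r1 = (q - p) / N\<^sup>2" .
  moreover have "(q - p) / N\<^sup>2 > 0" using pq N by simp
  ultimately have r12: "r1 < r2" by linarith
  have r2q: "r2 < q" unfolding r2_def using pq Nf N by simp
  have m1: "A1 r1 = A2 r1" unfolding A1_def A2_def r1_def \<kappa>_def using N
    by (simp add: field_simps power2_eq_square)
  have m2: "A2 r2 = A3 r2" unfolding A2_def A3_def r2_def \<kappa>_def using N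
    by (simp add: field_simps power2_eq_square)
  have e4: "A3 q = q" unfolding A3_def by simp
  have e3: "A2 r2 = g4 r2" unfolding g4_def using r2q m2 by simp
  have e2: "A1 r1 = g3 r1" unfolding g3_def using r12 m1 by simp
  have e1: "p = g2 p" unfolding g2_def A1_def using pr1 by simp
  have "strict_mono A1" "strict_mono A2" "strict_mono A3" "strict_mono (\<lambda>x::real. x)"
    using N by (auto simp: strict_mono_def A1_def A2_def A3_def divide_strict_right_mono)
  then have "strict_mono g1"
    unfolding g1_def[abs_def] using e1 e2 e3 e4
    by (auto simp: g2_def[abs_def] g3_def[abs_def] g4_def[abs_def] intro!: strict_mono_glue)
  have iN: "1 / N \<in> adic_rationals n" unfolding N_def by (rule adic_rationals_inverse[OF n1])
  have f: "1 - 1 / N \<in> adic_rationals n" "q - p \<in> adic_rationals n"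
    using iN p q n1 by (auto intro!: adic_rationals_diff)
  have fN: "(1 - 1 / N) / N \<in> adic_rationals n"
    using adic_rationals_mult[OF f(1) iN] by simp
  have rD: "r1 \<in> adic_rationals n" "r2 \<in> adic_rationals n" "\<kappa> \<in> adic_rationals n"
    unfolding r1_def r2_def \<kappa>_def power2_eq_square using p q f fN n1
    by (auto intro!: adic_rationals_add adic_rationals_diff adic_rationals_mult
        simp flip: times_divide_eq_right)
  have ND: "N \<in> adic_rationals n" unfolding N_def by (rule adic_rationals_of_nat)
  have "real n powi (- 1) = 1 / N" by (simp add: N_def power_int_minus divide_inverse)
  then have "A1 x = real n powi (- 1) * x + (p - p * (1 / N))" for x
    unfolding A1_def by (simp add: diff_divide_distrib)
  moreover have "p - p * (1 / N) \<in> adic_rationals n"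
    using p iN n1 by (intro adic_rationals_diff adic_rationals_mult)
  ultimately have l1: "locally_adic n A1 t" for t by (intro locally_adic_affine)
  have l2: "locally_adic n A2 t" for t
    by (rule locally_adic_affine[of "- \<kappa>" _ _ "0"])
      (use rD in \<open>auto intro!: adic_rationals_uminus simp: A2_def\<close>)
  have l3: "locally_adic n A3 t" for t
    by (rule locally_adic_affine[of "q - N * q" _ _ "1"])
      (use q ND n1 in \<open>auto intro!: adic_rationals_diff adic_rationals_mult simp: A3_def N_def algebra_simps\<close>)
  have l0: "locally_adic n (\<lambda>x. x) t" for t
    by (rule locally_adic_affine[of 0 _ _ 0]) auto
  have l4: "locally_adic n g4 t" for t
    by (rule locally_adic_glue[OF q _ _ l3 l0]) (use e4 in \<open>auto simp: g4_def\<close>)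
  have l5: "locally_adic n g3 t" for t
    by (rule locally_adic_glue[OF rD(2) _ _ l2 l4]) (use e3 in \<open>auto simp: g3_def\<close>)
  have l6: "locally_adic n g2 t" for t
    by (rule locally_adic_glue[OF rD(1) _ _ l1 l5]) (use e2 in \<open>auto simp: g2_def\<close>)
  have l: "locally_adic n g1 t" for t
    by (rule locally_adic_glue[OF p _ _ l0 l6]) (use e1 in \<open>auto simp: g1_def\<close>)
  show ?thesis unfolding beq
  proof (rule F_setI[OF n])
    show "strict_mono_on {0..1} (\<lambda>x\<in>{0..1}. g1 x)"
      using \<open>strict_mono g1\<close> by (auto intro!: strict_mono_onI simp: strict_mono_def)
    show "(\<lambda>x\<in>{0..1}. g1 x) 0 = 0" using pq by (simp add: g1_def)
    show "(\<lambda>x\<in>{0..1}. g1 x) 1 = 1" using pq pr1 r12 r2q e4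
      by (auto simp: g1_def g2_def g3_def g4_def)
    show "locally_adic n (\<lambda>x\<in>{0..1}. g1 x) t" for t
      using l[of t] locally_adic_cong[of "\<lambda>x\<in>{0..1}. g1 x" g1 n t] by simp
  qed simp
qed

lemma bump_outside:
  assumes "n \<ge> 2" "p < q" "x \<in> {0..1}" "x \<le> p \<or> q \<le> x"
  shows "bump n p q x = x"
proof -
  define N where "N = real n"
  have N: "N \<ge> 2" unfolding N_def using assms by simp
  have f: "0 < 1 - 1 / N" "1 - 1 / N < 1" using N by (simp_all add: field_simps)
  have "p + (q - p) * (1 - 1 / N) < p + (q - p) * 1"
    using f assms by (intro add_strict_left_mono mult_strict_left_mono) auto
  moreover have "(q - p) * (1 - 1 / N) / N > 0" using f assms N by simp
  ultimately show ?thesis using assms unfolding bump_def N_def[symmetric] by auto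
qed

lemma bump_less:
  assumes n: "n \<ge> 2" and x: "x \<in> {0..1}" "p < x" "x < q"
  shows "bump n p q x < x"
proof -
  define N where "N = real n"
  have N: "N \<ge> 2" unfolding N_def using assms by simp
  have f: "0 < 1 - 1 / N" using N by (simp add: field_simps)
  have "1 * (x - p) < N * (x - p)" using x N by (intro mult_strict_right_mono) auto
  then have "(x - p) / N < x - p" using N by (simp add: field_simps)
  moreover have "(q - p) * (1 - 1 / N)\<^sup>2 > 0" using x f by (intro mult_pos_pos) auto
  moreover have "1 * (q - x) < N * (q - x)" using x N by (intro mult_strict_right_mono) auto
  then have "q - N * (q - x) < x" by (simp add: algebra_simps)
  ultimately show ?thesis using x unfolding bump_def N_def[symmetric] by auto
qed

text \<open>The explicit length \<open>(q - p) * (1 - 1 / n) / n\<close> of the expanding piece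
  later decides how fine the grid of bumps must be.\<close>

lemma bump_expand:
  assumes n: "n \<ge> 2" and "x \<in> {0..1}" "p < q" "q - (q - p) * (1 - 1 / real n) / real n \<le> x" "x \<le> q"
  shows "bump n p q x = q - real n * (q - x)"
proof -
  define N where "N = real n"
  have N: "N \<ge> 2" unfolding N_def using assms by simp
  have f: "0 < 1 - 1 / N" using N by (simp add: field_simps)
  define r2 where "r2 = q - (q - p) * (1 - 1 / N) / N"
  have "r2 - (p + (q - p) * (1 - 1 / N)) = (q - p) / N\<^sup>2" unfolding r2_def using N
    by (simp add: field_simps power2_eq_square)
  moreover have "(q - p) / N\<^sup>2 > 0" using assms N by simp
  ultimately have 1: "p + (q - p) * (1 - 1 / N) < r2" by linarith
  have 2: "p < p + (q - p) * (1 - 1 / N)" using f assms by simp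
  \<comment> \<open>The left end of the expanding piece belongs to the middle branch of
    \<open>bump_def\<close>, so the two formulas have to be matched there.\<close>
  have 3: "x - (q - p) * (1 - 1 / N)\<^sup>2 = q - N * (q - x)" if "x = r2"
    unfolding that r2_def using N by (simp add: field_simps power2_eq_square)
  show ?thesis
    using assms 1 2 3 unfolding bump_def N_def[symmetric] r2_def[symmetric] by auto
qed

lemma bump_contract:
  assumes n: "n \<ge> 2" and "x \<in> {0..1}" "p \<le> x" "x \<le> p + (q - p) * (1 - 1 / real n)"
  shows "bump n p q x = p + (x - p) / real n"
  using assms unfolding bump_def by auto

section \<open>Iteration towards a fixed point and compression of intervals\<close>

lemma homeo_plus_eq_inverse_map_iff:
  assumes "f \<in> homeo_plus {0..1}" "x \<in> {0..1}" "y \<in> {0..1}"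
  shows "f x = y \<longleftrightarrow> x = inverse_map f y"
  using assms inverse_map by metis

lemma funpow_mem_unit_interval:
  assumes "f \<in> homeo_plus {0..1}" "x \<in> {0..1}"
  shows "(f ^^ k) x \<in> {0..1}"
  by (induction k) (use assms(2) homeo_plusD(7)[OF assms(1)] in auto)

text \<open>The orbit decreases and stays above \<open>p\<close>. By continuity its limit is a fixed
  point in \<open>[p,x]\<close>, and \<open>p\<close> is the only one.\<close>

lemma funpow_converges_left:
  assumes f: "f \<in> homeo_plus {0..1}" and p: "p \<in> {0..1}" "f p = p"
    and dec: "\<And>y. p < y \<Longrightarrow> y \<le> x \<Longrightarrow> f y < y" and x: "p < x" "x \<in> {0..1}" and d: "p < d"
  shows "\<exists>k. p < (f ^^ k) x \<and> (f ^^ k) x < d"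
proof -
  define X where "X k = (f ^^ k) x" for k
  have XI: "X k \<in> {0..1}" for k unfolding X_def by (rule funpow_mem_unit_interval[OF f x(2)])
  have S: "X (Suc k) = f (X k)" for k unfolding X_def by simp
  have X: "p < X k \<and> X k \<le> x" for k
  proof (induction k)
    case 0
    then show ?case using x by (simp add: X_def)
  next
    case (Suc k)
    then have "f p < f (X k)" using homeo_plusD(8)[OF f p(1) XI] by simp
    moreover have "f (X k) < X k" using dec Suc by simp
    ultimately show ?case using Suc p by (simp add: S)
  qed
  have "decseq X"
    by (rule decseq_SucI) (use X dec S in \<open>simp add: less_imp_le\<close>)
  then obtain L where L: "X \<longlonglongrightarrow> L" "\<And>k. L \<le> X k"
    using decseq_convergent[of X p] X less_imp_le by metis
  have pL: "p \<le> L" using LIMSEQ_le_const[OF L(1), of p] X less_imp_le by blast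
  have Lx: "L \<le> x" using L(2)[of 0] X[of 0] by simp
  have LI: "L \<in> {0..1}" using pL Lx p x by auto
  have "(\<lambda>k. f (X k)) \<longlonglongrightarrow> f L"
    using homeo_plusD(3)[OF f] L(1) LI XI
    by (auto simp: continuous_on_sequentially comp_def)
  moreover have "(\<lambda>k. f (X k)) \<longlonglongrightarrow> L" using LIMSEQ_Suc[OF L(1)] S by simp
  ultimately have "f L = L" using LIMSEQ_unique by blast
  then have "L = p" using dec[of L] pL Lx by fastforce
  then have "eventually (\<lambda>k. X k < d) sequentially" using L(1) d order_tendstoD(2) by blast
  then show ?thesis using X unfolding X_def eventually_sequentially by blast
qed

lemma funpow_converges_right:
  assumes f: "f \<in> homeo_plus {0..1}" and p: "p \<in> {0..1}" "f p = p"
    and inc: "\<And>y. x \<le> y \<Longrightarrow> y < p \<Longrightarrow> y < f y" and x: "x < p" "x \<in> {0..1}" and d: "d < p"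
  shows "\<exists>k. d < (f ^^ k) x \<and> (f ^^ k) x < p"
proof -
  define X where "X k = (f ^^ k) x" for k
  have XI: "X k \<in> {0..1}" for k unfolding X_def by (rule funpow_mem_unit_interval[OF f x(2)])
  have S: "X (Suc k) = f (X k)" for k unfolding X_def by simp
  have X: "X k < p \<and> x \<le> X k" for k
  proof (induction k)
    case 0
    then show ?case using x by (simp add: X_def)
  next
    case (Suc k)
    then have "f (X k) < f p" using homeo_plusD(8)[OF f XI p(1)] by simp
    moreover have "X k < f (X k)" using inc Suc by simp
    ultimately show ?case using Suc p by (simp add: S)
  qed
  have "incseq X"
    by (rule incseq_SucI) (use X inc S in \<open>simp add: less_imp_le\<close>)
  then obtain L where L: "X \<longlonglongrightarrow> L" "\<And>k. X k \<le> L"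
    using incseq_convergent[of X p] X less_imp_le by metis
  have pL: "L \<le> p" using LIMSEQ_le_const2[OF L(1), of p] X less_imp_le by blast
  have Lx: "x \<le> L" using L(2)[of 0] X[of 0] by simp
  have LI: "L \<in> {0..1}" using pL Lx p x by auto
  have "(\<lambda>k. f (X k)) \<longlonglongrightarrow> f L"
    using homeo_plusD(3)[OF f] L(1) LI XI
    by (auto simp: continuous_on_sequentially comp_def)
  moreover have "(\<lambda>k. f (X k)) \<longlonglongrightarrow> L" using LIMSEQ_Suc[OF L(1)] S by simp
  ultimately have "f L = L" using LIMSEQ_unique by blast
  then have "L = p" using inc[of L] pL Lx by fastforce
  then have "eventually (\<lambda>k. d < X k) sequentially" using L(1) d order_tendstoD(1) by blast
  then show ?thesis using X unfolding X_def eventually_sequentially by blast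
qed

lemma inverse_map_greater:
  assumes "f \<in> homeo_plus {0..1}" "x \<in> {0..1}"
  shows "x < inverse_map f x \<longleftrightarrow> f x < x" "inverse_map f x < x \<longleftrightarrow> x < f x"
    "inverse_map f x = x \<longleftrightarrow> f x = x"
  using homeo_plusD(8)[OF assms(1,2) inverse_map(3)[OF assms]]
    homeo_plusD(8)[OF assms(1) inverse_map(3)[OF assms] assms(2)]
    inverse_map[OF assms] by auto

text \<open>Iterates of the inverse of the bump on \<open>[0,1]\<close> push \<open>[a,b]\<close>
  beyond an adic \<open>p\<close> in \<open>(c,d)\<close>; iterates of a bump on
  \<open>[p,1]\<close>, which fixes \<open>p\<close>, then contract it towards \<open>p\<close> from
  the right.\<close>

lemma F_set_compress:
  assumes n: "n \<ge> 2" and "0 < a" "b < 1" "0 \<le> c" "c < d" "d \<le> 1"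
    and ab: "a \<le> b"
  obtains g where "g \<in> F_set n" "c < g a" "g b < d"
proof -
  obtain p where p: "p \<in> adic_rationals n" "c < p" "p < d"
    using adic_rationals_dense[OF n \<open>c < d\<close>] .
  define f where "f = inverse_map (bump n 0 1)"
  have b01: "bump n 0 1 \<in> F_set n" by (rule bump_in_F_set[OF n]) auto
  have f: "f \<in> F_set n" unfolding f_def by (rule F_set_inverse[OF n b01])
  have inc: "y < f y" if "0 < y" "y < 1" for y
    unfolding f_def using that bump_less[OF n, of y 0 1] inverse_map_greater(1)[OF F_set_homeo[OF b01], of y]
    by auto
  have "\<exists>k. p < (f ^^ k) a \<and> (f ^^ k) a < 1"
    by (rule funpow_converges_right[OF F_set_homeo[OF f]]) (use assms ab inc p F_setD(6)[OF f] in auto)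
  then obtain k where k: "p < (f ^^ k) a" by blast
  obtain f1 where f1: "f1 \<in> F_set n" "\<And>x. x \<in> {0..1} \<Longrightarrow> f1 x = (f ^^ k) x"
    using F_set_funpow[OF n f, of k] by auto
  have f1a: "p < f1 a" using k f1 ab assms by auto
  have f1b: "f1 a \<le> f1 b" "f1 b < 1"
    using F_setD(9)[OF f1(1), of a b] F_setD(8)[OF f1(1), of b 1] F_setD(6)[OF f1(1)] ab assms by auto
  define g where "g = bump n p 1"
  have g: "g \<in> F_set n" unfolding g_def by (rule bump_in_F_set[OF n p(1)]) (use p assms in auto)
  have "\<exists>k. p < (g ^^ k) (f1 b) \<and> (g ^^ k) (f1 b) < d"
  proof (rule funpow_converges_left[OF F_set_homeo[OF g]])
    show "g y < y" if "p < y" "y \<le> f1 b" for y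
      unfolding g_def using that f1b p assms by (intro bump_less[OF n]) auto
    show "g p = p" unfolding g_def using p assms by (intro bump_outside[OF n]) auto
  qed (use p assms f1a f1b in auto)
  then obtain l where l: "(g ^^ l) (f1 b) < d" by blast
  obtain g1 where g1: "g1 \<in> F_set n" "\<And>x. x \<in> {0..1} \<Longrightarrow> g1 x = (g ^^ l) x"
    using F_set_funpow[OF n g, of l] by auto
  have gp: "g p = p" unfolding g_def using p assms by (intro bump_outside[OF n]) auto
  have "(g ^^ l) p = p" by (induction l) (auto simp: gp)
  then have "g1 p = p" using g1 p assms by auto
  then have "p < g1 (f1 a)" using F_setD(8)[OF g1(1), of p "f1 a"] f1a f1b p assms by auto
  then have "c < (g1 \<circ>\<^sub>I f1) a" using p ab assms by (simp add: compose_def)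
  moreover have "(g1 \<circ>\<^sub>I f1) b < d"
    using l g1(2)[of "f1 b"] F_setD(7)[OF f1(1), of b] ab assms by (simp add: compose_def)
  ultimately show thesis using that[OF F_set_compose[OF n g1(1) f1(1)]] by blast
qed

section \<open>Commuting maps\<close>

text \<open>An automorphism commuting with \<open>b\<close> permutes the left end points of the bumps of \<open>b\<close>; were
  such a point moved, its orbit would accumulate where \<open>b\<close> is affine.\<close>

lemma commuting_fixes_bump_end_aux:
  assumes n: "n \<ge> 2" and a: "a \<in> F_set n" and b: "b \<in> F_set n"
    and com: "\<And>x. x \<in> {0..1} \<Longrightarrow> a (b x) = b (a x)"
    and p: "p \<in> {0..1}" "b p = p" and E: "\<And>d. p < d \<Longrightarrow> \<exists>y\<in>{0..1}. p < y \<and> y < d \<and> b y \<noteq> y"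
  shows "a p \<le> p"
proof (rule ccontr)
  assume "\<not> a p \<le> p"
  then have ap: "p < a p" by simp
  define X where "X k = (a ^^ k) p" for k
  have S: "X (Suc k) = a (X k)" for k unfolding X_def by simp
  have XI: "X k \<in> {0..1}" for k
    unfolding X_def by (rule funpow_mem_unit_interval[OF F_set_homeo[OF a] p(1)])
  have lt: "X k < X (Suc k)" for k
  proof (induction k)
    case 0
    then show ?case using ap by (simp add: X_def)
  next
    case (Suc k)
    then show ?case using F_setD(8)[OF a XI[of k] XI[of "Suc k"]] S by metis
  qed
  have bX: "b (X k) = X k" for k
  proof (induction k)
    case 0
    then show ?case using p by (simp add: X_def)
  next
    case (Suc k)
    then show ?case using com[OF XI, of k] S by simp
  qed
  \<comment> \<open>Being a limit from the right of points moved by \<open>b\<close> is preserved by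
    every map commuting with \<open>b\<close>, so the whole orbit of \<open>p\<close> inherits
    it.\<close>
  have EX: "\<forall>d>X k. \<exists>y\<in>{0..1}. X k < y \<and> y < d \<and> b y \<noteq> y" for k
  proof (induction k)
    case 0
    then show ?case using E by (simp add: X_def)
  next
    case (Suc k)
    show ?case
    proof (intro allI impI)
      fix d assume d: "X (Suc k) < d"
      define d' where "d' = min d 1"
      have "X (Suc k) < 1" using lt[of "Suc k"] XI[of "Suc (Suc k)"] by auto
      then have d': "X (Suc k) < d'" "d' \<in> {0..1}" unfolding d'_def using d XI[of "Suc k"] by auto
      define u where "u = inverse_map a d'"
      have u: "u \<in> {0..1}" "a u = d'" unfolding u_def using inverse_map[OF F_set_homeo[OF a] d'(2)] by auto
      have "X k < u" using F_setD(8)[OF a XI u(1)] u d' S by auto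
      then obtain y where y: "y \<in> {0..1}" "X k < y" "y < u" "b y \<noteq> y" using Suc by blast
      have "X (Suc k) < a y" "a y < d'" using y u XI S F_setD(8)[OF a] by auto
      moreover have "b (a y) \<noteq> a y"
        using com[OF y(1)] F_setD(10)[OF a F_setD(7)[OF b y(1)] y(1)] y(4) by auto
      ultimately show "\<exists>y\<in>{0..1}. X (Suc k) < y \<and> y < d \<and> b y \<noteq> y"
        using F_setD(7)[OF a y(1)] unfolding d'_def by (intro bexI[of _ "a y"]) auto
    qed
  qed
  have inc: "incseq X" by (rule incseq_SucI) (simp add: lt less_imp_le)
  then obtain z where z: "X \<longlonglongrightarrow> z" "\<And>k. X k \<le> z"
    using incseq_convergent[of X 1] XI by (metis atLeastAtMost_iff)
  have Xz: "X k < z" for k using z(2)[of "Suc k"] lt[of k] by simp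
  have "z \<le> 1" using LIMSEQ_le_const2[OF z(1), of 1] XI by auto
  moreover have "0 \<le> X 0" using XI[of 0] by simp
  then have "0 \<le> z" using z(2)[of 0] by linarith
  ultimately have zI: "z \<in> {0..1}" by simp
  from locally_adicE[OF F_set_locally_adic[OF n b zI]] obtain e s c where e: "e > 0"
    and l: "\<And>x. x \<in> {0..1} \<Longrightarrow> z - e \<le> x \<Longrightarrow> x \<le> z \<Longrightarrow> b x = real n powi s * x + c" by metis
  have "eventually (\<lambda>k. z - e < X k) sequentially" using z(1) e by (intro order_tendstoD(1)) auto
  then obtain k where k: "z - e < X k" unfolding eventually_sequentially by blast
  have k1: "X k < X (Suc k)" by (rule lt)
  \<comment> \<open>The affine germ of \<open>b\<close> to the left of \<open>z\<close> fixes both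
    \<open>X k\<close> and \<open>X (Suc k)\<close>, hence is the identity, although
    \<open>b\<close> moves points between them.\<close>
  have "real n powi s * X k + c = real n powi 0 * X k + 0"
    using l[OF XI, of k] bX[of k] k Xz[of k] by simp
  moreover have "real n powi s * X (Suc k) + c = real n powi 0 * X (Suc k) + 0"
    using l[OF XI, of "Suc k"] bX[of "Suc k"] k k1 Xz[of "Suc k"] by simp
  ultimately have sc: "s = 0" "c = 0" using powi_affine_unique[OF n, of "X k" "X (Suc k)" s c 0 0] k1 by auto
  obtain y where y: "y \<in> {0..1}" "X k < y" "y < X (Suc k)" "b y \<noteq> y" using EX[of k] k1 by blast
  then show False using l[OF y(1)] sc k Xz[of "Suc k"] by simp
qed

lemma commute_inverse_map:
  assumes a: "a \<in> homeo_plus {0..1}" and b: "b \<in> homeo_plus {0..1}"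
    and com: "\<And>x. x \<in> {0..1} \<Longrightarrow> a (b x) = b (a x)" and x: "x \<in> {0..1}"
  shows "inverse_map a (b x) = b (inverse_map a x)"
proof -
  have "a (b (inverse_map a x)) = b x" using com[of "inverse_map a x"] inverse_map[OF a x] by simp
  then show ?thesis
    using homeo_plus_eq_inverse_map_iff[OF a homeo_plusD(7)[OF b inverse_map(3)[OF a x]] homeo_plusD(7)[OF b x]]
    by simp
qed

lemma commuting_fixes_bump_end:
  assumes n: "n \<ge> 2" and a: "a \<in> F_set n" and b: "b \<in> F_set n"
    and com: "\<And>x. x \<in> {0..1} \<Longrightarrow> a (b x) = b (a x)"
    and p: "p \<in> {0..1}" "b p = p" and E: "\<And>d. p < d \<Longrightarrow> \<exists>y\<in>{0..1}. p < y \<and> y < d \<and> b y \<noteq> y"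
  shows "a p = p"
proof -
  have "inverse_map a p \<le> p"
    using commuting_fixes_bump_end_aux[OF n F_set_inverse[OF n a] b
        commute_inverse_map[OF F_set_homeo[OF a] F_set_homeo[OF b] com] p E] by simp
  moreover have "a p \<le> p" using commuting_fixes_bump_end_aux[OF n a b com p E] .
  ultimately show ?thesis
    using inverse_map_greater[OF F_set_homeo[OF a] p(1)] by auto
qed

text \<open>Let \<open>p\<close> be the last fixed point of \<open>b\<close> before
  \<open>y\<close>. Both maps fix \<open>p\<close> and are linear about the centre \<open>p\<close>
  on its right, so they commute there. Iterates of \<open>b\<close> bring \<open>y\<close> into that
  range, and their injectivity carries the relation back to \<open>y\<close>.\<close>

lemma commute_on_support_aux:
  assumes n: "n \<ge> 2" and a: "a \<in> F_set n" and a': "a' \<in> F_set n" and b: "b \<in> F_set n"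
    and com: "\<And>x. x \<in> {0..1} \<Longrightarrow> a (b x) = b (a x)" "\<And>x. x \<in> {0..1} \<Longrightarrow> a' (b x) = b (a' x)"
    and y: "y \<in> {0..1}" "b y < y"
  shows "a (a' y) = a' (a y)"
proof -
  have hb: "b \<in> homeo_plus {0..1}" by (rule F_set_homeo[OF b])
  define Z where "Z = {t \<in> {0..y}. b t = t}"
  have "continuous_on {0..y} b" using homeo_plusD(3)[OF hb] by (rule continuous_on_subset) (use y in auto)
  then have "continuous_on {0..y} (\<lambda>t. b t - t)" by (intro continuous_intros)
  then have "closed {t \<in> {0..y}. b t - t = 0}"
    by (intro continuous_closed_preimage_constant) auto
  then have "closed Z" unfolding Z_def by simp
  moreover have Z: "0 \<in> Z" "bdd_above Z" unfolding Z_def using homeo_plusD(5)[OF hb] y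
    by (auto intro!: bdd_aboveI[of _ y])
  ultimately have pZ: "Sup Z \<in> Z" by (intro closed_contains_Sup) auto
  define p where "p = Sup Z"
  have p: "0 \<le> p" "p \<le> y" "b p = p" using pZ unfolding p_def Z_def by auto
  have py: "p < y" using p y by (metis less_le)
  have pI: "p \<in> {0..1}" using p y by auto
  have nf: "b t \<noteq> t" if "p < t" "t \<le> y" for t
  proof
    assume "b t = t"
    then have "t \<in> Z" unfolding Z_def using that p by auto
    then show False using cSup_upper[OF _ Z(2)] that unfolding p_def by fastforce
  qed
  have dec: "b t < t" if t: "p < t" "t \<le> y" for t
  proof (rule ccontr)
    assume "\<not> b t < t"
    then have "b t - t \<ge> 0" by simp
    moreover have "continuous_on {t..y} (\<lambda>t. b t - t)"
      using \<open>continuous_on {0..y} (\<lambda>t. b t - t)\<close> by (rule continuous_on_subset) (use p t in auto)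
    ultimately obtain w where "t \<le> w" "w \<le> y" "b w - w = 0"
      using IVT2'[of "\<lambda>t. b t - t" y 0 t] y t by auto
    then show False using nf[of w] t by simp
  qed
  have E: "\<exists>w\<in>{0..1}. p < w \<and> w < d \<and> b w \<noteq> w" if "p < d" for d
    by (rule bexI[of _ "(p + min d y) / 2"]) (use that py nf[of "(p + min d y) / 2"] pI y in auto)
  have ap: "a p = p" "a' p = p"
    using commuting_fixes_bump_end[OF n _ b _ pI p(3) E] a a' com by auto
  from locally_adicE[OF F_set_locally_adic[OF n a pI]] obtain e s c where e: "e > 0"
    and r: "\<And>x. x \<in> {0..1} \<Longrightarrow> p \<le> x \<Longrightarrow> x \<le> p + e \<Longrightarrow> a x = real n powi s * x + c" by metis
  from locally_adicE[OF F_set_locally_adic[OF n a' pI]] obtain e' s' c' where e': "e' > 0"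
    and r': "\<And>x. x \<in> {0..1} \<Longrightarrow> p \<le> x \<Longrightarrow> x \<le> p + e' \<Longrightarrow> a' x = real n powi s' * x + c'" by metis
  define S where "S = real n powi s"
  define S' where "S' = real n powi s'"
  have pos: "S > 0" "S' > 0" unfolding S_def S'_def using powi_pos[OF n] by auto
  have ra: "a x = p + S * (x - p)" if "x \<in> {0..1}" "p \<le> x" "x \<le> p + e" for x
    using r[OF that] r[OF pI] ap e unfolding S_def by (simp add: algebra_simps)
  have ra': "a' x = p + S' * (x - p)" if "x \<in> {0..1}" "p \<le> x" "x \<le> p + e'" for x
    using r'[OF that] r'[OF pI] ap e' unfolding S'_def by (simp add: algebra_simps)
  \<comment> \<open>The four bounds keep \<open>w\<close>, \<open>a w\<close> and
    \<open>a' w\<close> within the ranges where \<open>a\<close> and \<open>a'\<close> are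
    linear.\<close>
  define d where "d = p + Min {e, e', e' / S, e / S'}"
  have "p < d" unfolding d_def using e e' pos by simp
  then obtain k where k: "p < (b ^^ k) y" "(b ^^ k) y < d"
    using funpow_converges_left[OF hb pI p(3) dec py y(1), of d] by auto
  define w where "w = (b ^^ k) y"
  have wI: "w \<in> {0..1}" unfolding w_def by (rule funpow_mem_unit_interval[OF hb y(1)])
  have w: "p \<le> w" "w - p \<le> e" "w - p \<le> e'" "w - p \<le> e' / S" "w - p \<le> e / S'"
    using k unfolding w_def[symmetric] d_def by auto
  have aw: "a w = p + S * (w - p)" "a' w = p + S' * (w - p)" using ra ra' wI w by auto
  have "S * (w - p) \<le> e'" "S' * (w - p) \<le> e" using w pos by (simp_all add: pos_le_divide_eq mult.commute)
  moreover have "a w \<in> {0..1}" "a' w \<in> {0..1}" using F_setD(7)[OF a wI] F_setD(7)[OF a' wI] .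
  ultimately have "a' (a w) = p + S' * (S * (w - p))" "a (a' w) = p + S * (S' * (w - p))"
    using ra[of "a' w"] ra'[of "a w"] aw w pos by auto
  then have eq: "a (a' w) = a' (a w)" by simp
  have it: "f ((b ^^ k) x) = (b ^^ k) (f x)"
    if "\<And>x. x \<in> {0..1} \<Longrightarrow> f (b x) = b (f x)" "x \<in> {0..1}" for f x k
    using that(2) by (induction k) (auto simp: that(1)[OF funpow_mem_unit_interval[OF hb that(2)]])
  have inj: "u = v" if "(b ^^ k) u = (b ^^ k) v" "u \<in> {0..1}" "v \<in> {0..1}" for u v k
    using that
  proof (induction k)
    case (Suc k)
    then show ?case
      using homeo_plusD(10)[OF hb funpow_mem_unit_interval[OF hb] funpow_mem_unit_interval[OF hb], of u v k k] by simp
  qed simp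
  have I: "a y \<in> {0..1}" "a' y \<in> {0..1}" "a (a' y) \<in> {0..1}" "a' (a y) \<in> {0..1}"
    using F_setD(7)[OF a] F_setD(7)[OF a'] y by blast+
  have "(b ^^ k) (a (a' y)) = (b ^^ k) (a' (a y))"
    using eq it[of a, OF com(1)] it[of a', OF com(2)] I y(1) unfolding w_def by simp
  then show ?thesis using inj I by blast
qed

lemma commute_on_support:
  assumes n: "n \<ge> 2" and a: "a \<in> F_set n" and a': "a' \<in> F_set n" and b: "b \<in> F_set n"
    and com: "\<And>x. x \<in> {0..1} \<Longrightarrow> a (b x) = b (a x)" "\<And>x. x \<in> {0..1} \<Longrightarrow> a' (b x) = b (a' x)"
    and y: "y \<in> {0..1}" "b y \<noteq> y"
  shows "a (a' y) = a' (a y)"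
proof (cases "b y < y")
  case True
  then show ?thesis using commute_on_support_aux[OF n a a' b com y(1)] by simp
next
  case False
  then have "inverse_map b y < y" using inverse_map_greater[OF F_set_homeo[OF b] y(1)] y by auto
  moreover have "c (inverse_map b x) = inverse_map b (c x)"
    if "c \<in> F_set n" "\<And>x. x \<in> {0..1} \<Longrightarrow> c (b x) = b (c x)" "x \<in> {0..1}" for c x
    using commute_inverse_map[OF F_set_homeo[OF b] F_set_homeo[OF that(1)] _ that(3)] that(2) by simp
  ultimately show ?thesis
    using commute_on_support_aux[OF n a a' F_set_inverse[OF n b] _ _ y(1)] a a' com by simp
qed

section \<open>Noncommutation sets and maps with prescribed support\<close>

text \<open>Three properties make this set usable in place of a support: it is open, conjugation
  carries it along, and every map commuting with all of \<open>A\<close> fixes it pointwise.\<close>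

definition noncommuting :: "(real \<Rightarrow> real) set \<Rightarrow> real set" where
  "noncommuting A = {y \<in> {0..1}. \<exists>a\<in>A. \<exists>a'\<in>A. a (a' y) \<noteq> a' (a y)}"

text \<open>If \<open>b\<close> moved \<open>y\<close>, all pairs from \<open>A\<close> would
  commute at \<open>y\<close> by \<open>commute_on_support\<close>.\<close>

lemma noncommuting_fixed:
  assumes n: "n \<ge> 2" and A: "A \<subseteq> F_set n" and b: "b \<in> F_set n"
    and com: "\<And>a x. a \<in> A \<Longrightarrow> x \<in> {0..1} \<Longrightarrow> a (b x) = b (a x)"
    and y: "y \<in> noncommuting A"
  shows "b y = y"
proof (rule ccontr)
  assume ne: "b y \<noteq> y"
  obtain a a' where a: "a \<in> A" "a' \<in> A" "a (a' y) \<noteq> a' (a y)" and yI: "y \<in> {0..1}"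
    using y unfolding noncommuting_def by auto
  then show False
    using commute_on_support[of n a a' b y] com[OF a(1)] com[OF a(2)] n b yI ne A by blast
qed

lemma noncommuting_mono: "A \<subseteq> B \<Longrightarrow> noncommuting A \<subseteq> noncommuting B"
  unfolding noncommuting_def by blast

lemma noncommuting_interior:
  assumes A: "A \<subseteq> F_set n" and y: "y \<in> noncommuting A"
  shows "0 < y" "y < 1" "\<exists>e>0. 0 < y - e \<and> y + e < 1 \<and> {y - e..y + e} \<subseteq> noncommuting A"
proof -
  obtain a a' where a: "a \<in> A" "a' \<in> A" "a (a' y) \<noteq> a' (a y)" and yI: "y \<in> {0..1}"
    using y unfolding noncommuting_def by auto
  have F: "a \<in> F_set n" "a' \<in> F_set n" using a A by auto
  have "y \<noteq> 0" "y \<noteq> 1" using a(3) F_setD(5,6)[OF F(1)] F_setD(5,6)[OF F(2)] by auto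
  then show y01: "0 < y" "y < 1" using yI by auto
  have im: "a ` {0..1} \<subseteq> {0..1}" "a' ` {0..1} \<subseteq> {0..1}" using F_setD(7)[OF F(1)] F_setD(7)[OF F(2)] by blast+
  have "continuous_on {0..1} (\<lambda>x. a (a' x) - a' (a x))"
    using continuous_on_compose2[OF F_setD(3)[OF F(1)] F_setD(3)[OF F(2)] im(2)]
      continuous_on_compose2[OF F_setD(3)[OF F(2)] F_setD(3)[OF F(1)] im(1)]
    by (intro continuous_on_diff)
  then obtain d where d: "d > 0" "\<And>x. x \<in> {0..1} \<Longrightarrow> dist x y < d \<Longrightarrow>
      dist (a (a' x) - a' (a x)) (a (a' y) - a' (a y)) < \<bar>a (a' y) - a' (a y)\<bar>"
    using yI a(3) unfolding continuous_on_iff by (metis right_minus_eq zero_less_abs_iff)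
  define e where "e = Min {d, y, 1 - y} / 2"
  have e: "e > 0" "e < d" "e < y" "e < 1 - y" unfolding e_def using d(1) y01 by auto
  show "\<exists>e>0. 0 < y - e \<and> y + e < 1 \<and> {y - e..y + e} \<subseteq> noncommuting A"
  proof (intro exI conjI subsetI)
    fix x assume x: "x \<in> {y - e..y + e}"
    then have xI: "x \<in> {0..1}" "dist x y < d" using e by (auto simp: dist_real_def)
    then have "a (a' x) - a' (a x) \<noteq> 0" using d(2)[OF xI] by (auto simp: dist_real_def)
    then show "x \<in> noncommuting A" unfolding noncommuting_def using xI a by auto
  qed (use e in auto)
qed

text \<open>The bounds are arbitrary reals, since gaps of orbits and their images serve as bounds
  later.\<close>

definition supported :: "nat \<Rightarrow> real \<Rightarrow> real \<Rightarrow> (real \<Rightarrow> real) set" where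
  "supported n u v = {f \<in> F_set n. \<forall>x\<in>{0..1}. x \<le> u \<or> v \<le> x \<longrightarrow> f x = x}"

lemma supported_mono: "u' \<le> u \<Longrightarrow> v \<le> v' \<Longrightarrow> supported n u v \<subseteq> supported n u' v'"
  unfolding supported_def by fastforce

lemma supported_inside:
  assumes f: "f \<in> supported n u v" and x: "x \<in> {0..1}" "u < x" "x < v" and uv: "0 \<le> u" "v \<le> 1"
  shows "u < f x" "f x < v"
proof -
  have F: "f \<in> F_set n" and uv': "f u = u" "f v = v" using assms unfolding supported_def by auto
  show "u < f x" "f x < v"
    using F_setD(8)[OF F, of u x] F_setD(8)[OF F, of x v] uv' x uv by auto
qed

lemma supported_commute:
  assumes f: "f \<in> supported n u v" and g: "g \<in> supported n u' v'" and "v \<le> u'"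
    and x: "x \<in> {0..1}"
  shows "f (g x) = g (f x)"
proof (cases "x \<le> u'")
  case True
  have F: "f \<in> F_set n" and G: "g \<in> F_set n" using f g unfolding supported_def by auto
  have "f x \<le> u'"
  proof (cases "x \<le> v")
    case True
    show ?thesis
    proof (cases "v \<le> 1")
      case v1: True
      then have "v \<in> {0..1}" using True x by auto
      then have "f x \<le> f v" "f v = v" using F_setD(9)[OF F x, of v] True f unfolding supported_def by auto
      then show ?thesis using assms(3) by simp
    next
      case False
      then show ?thesis using F_setD(7)[OF F x] assms(3) by auto
    qed
  next
    case False
    then have "f x = x" using f x unfolding supported_def by auto
    then show ?thesis using True by simp
  qed
  moreover have "g x = x" using g True x unfolding supported_def by auto
  moreover have "f x \<in> {0..1}" by (rule F_setD(7)[OF F x])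
  ultimately show ?thesis using g unfolding supported_def by auto
next
  case False
  have F: "f \<in> F_set n" and G: "g \<in> F_set n" using f g unfolding supported_def by auto
  have gI: "g x \<in> {0..1}" by (rule F_setD(7)[OF G x])
  have "v \<le> g x"
  proof (cases "u' \<ge> 0")
    case True
    then have "u' \<in> {0..1}" using False x by auto
    then have "g u' \<le> g x" "g u' = u'" using F_setD(9)[OF G _ x, of u'] False g unfolding supported_def by auto
    then show ?thesis using assms(3) by simp
  next
    case f: False
    then show ?thesis using gI assms(3) by auto
  qed
  then have "f (g x) = g x" using f gI unfolding supported_def by auto
  moreover have "f x = x" using f False assms(3) x unfolding supported_def by auto
  ultimately show ?thesis by simp
qed

lemma bump_supported:
  assumes "n \<ge> 2" "p \<in> adic_rationals n" "q \<in> adic_rationals n" "0 \<le> p" "p < q" "q \<le> 1"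
  shows "bump n p q \<in> supported n p q" "inverse_map (bump n p q) \<in> supported n p q"
proof -
  have B: "bump n p q \<in> F_set n" by (rule bump_in_F_set[OF assms])
  then show "bump n p q \<in> supported n p q"
    unfolding supported_def using bump_outside[OF assms(1,5)] by auto
  show "inverse_map (bump n p q) \<in> supported n p q"
    unfolding supported_def using bump_outside[OF assms(1,5)] F_set_inverse[OF assms(1) B]
      inverse_map_greater(3)[OF F_set_homeo[OF B]] by auto
qed

text \<open>Two overlapping bumps, on \<open>[p,q]\<close> and \<open>[p',q']\<close> with
  \<open>p < p' < q < q'\<close>, fail to commute at \<open>q\<close>: the first fixes
  \<open>q\<close>, while the second moves \<open>q\<close> to a point that the first moves.\<close>

lemma supported_nonabelian:
  assumes n: "n \<ge> 2" and uv: "0 \<le> u" "u < v" "v \<le> 1"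
  obtains f g x where "f \<in> supported n u v" "g \<in> supported n u v" "x \<in> {0..1}" "f (g x) \<noteq> g (f x)"
proof -
  obtain q where q: "q \<in> adic_rationals n" "u < q" "q < v" using adic_rationals_dense[OF n uv(2)] .
  obtain p' where p': "p' \<in> adic_rationals n" "u < p'" "p' < q" using adic_rationals_dense[OF n q(2)] .
  obtain p where p: "p \<in> adic_rationals n" "u < p" "p < p'" using adic_rationals_dense[OF n p'(2)] .
  obtain q' where q': "q' \<in> adic_rationals n" "q < q'" "q' < v" using adic_rationals_dense[OF n q(3)] .
  define f where "f = bump n p q"
  define g where "g = bump n p' q'"
  have f: "f \<in> supported n p q" unfolding f_def using p p' q uv by (intro bump_supported[OF n]) auto
  have g: "g \<in> supported n p' q'" unfolding g_def using p p' q q' uv by (intro bump_supported[OF n]) auto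
  have qI: "q \<in> {0..1}" using q uv by auto
  have gq: "g q < q" unfolding g_def using q qI p' q' by (intro bump_less[OF n]) auto
  have gq': "p' < g q" using supported_inside(1)[OF g qI] p' q' uv by auto
  have gqI: "g q \<in> {0..1}" using gq gq' p' uv qI by auto
  have "f (g q) < g q" unfolding f_def using gq gq' p gqI by (intro bump_less[OF n]) auto
  moreover have "f q = q" using f qI unfolding supported_def by auto
  ultimately have "f (g q) \<noteq> g (f q)" by simp
  moreover have "f \<in> supported n u v" "g \<in> supported n u v"
    using f g supported_mono[of u p q v n] supported_mono[of u p' q' v n] p p' q q' by auto
  ultimately show thesis using that qI by blast
qed

definition conj_map :: "(real \<Rightarrow> real) \<Rightarrow> (real \<Rightarrow> real) \<Rightarrow> real \<Rightarrow> real" where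
  "conj_map g a = g \<circ>\<^sub>I (a \<circ>\<^sub>I inverse_map g)"

lemma conj_map_apply:
  assumes "g \<in> homeo_plus {0..1}" "x \<in> {0..1}"
  shows "conj_map g a x = g (a (inverse_map g x))" "conj_map g a (g x) = g (a x)"
  using assms inverse_map[OF assms] homeo_plusD(7)[OF assms] by (auto simp: conj_map_def compose_def)

lemma conj_map_F_set:
  assumes "n \<ge> 2" "g \<in> F_set n" "a \<in> F_set n"
  shows "conj_map g a \<in> F_set n"
  unfolding conj_map_def using assms by (intro F_set_compose F_set_inverse) auto

lemma conj_map_supported:
  assumes n: "n \<ge> 2" and g: "g \<in> F_set n" and a: "a \<in> supported n u v"
    and uv: "u \<in> {0..1}" "v \<in> {0..1}"
  shows "conj_map g a \<in> supported n (g u) (g v)"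
proof -
  have h: "g \<in> homeo_plus {0..1}" by (rule F_set_homeo[OF g])
  have "conj_map g a x = x" if x: "x \<in> {0..1}" "x \<le> g u \<or> g v \<le> x" for x
  proof -
    have "inverse_map g x \<le> u \<or> v \<le> inverse_map g x"
      using x homeo_plusD(9)[OF h inverse_map(3)[OF h x(1)] uv(1)]
        homeo_plusD(9)[OF h uv(2) inverse_map(3)[OF h x(1)]] inverse_map(2)[OF h x(1)] by auto
    then have "a (inverse_map g x) = inverse_map g x"
      using a inverse_map(3)[OF h x(1)] unfolding supported_def by auto
    then show ?thesis using conj_map_apply[OF h x(1)] inverse_map(2)[OF h x(1)] by simp
  qed
  then show ?thesis using conj_map_F_set[OF n g] a unfolding supported_def by auto
qed

lemma noncommuting_conj:
  assumes g: "g \<in> homeo_plus {0..1}" and A: "A \<subseteq> F_set n" and y: "y \<in> noncommuting A"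
  shows "g y \<in> noncommuting (conj_map g ` A)"
proof -
  obtain a a' where a: "a \<in> A" "a' \<in> A" "a (a' y) \<noteq> a' (a y)" and yI: "y \<in> {0..1}"
    using y unfolding noncommuting_def by auto
  have aF: "a \<in> F_set n" "a' \<in> F_set n" using a A by auto
  have I: "a y \<in> {0..1}" "a' y \<in> {0..1}" "a (a' y) \<in> {0..1}" "a' (a y) \<in> {0..1}"
    using F_setD(7)[OF aF(1)] F_setD(7)[OF aF(2)] yI by blast+
  have "conj_map g a (conj_map g a' (g y)) \<noteq> conj_map g a' (conj_map g a (g y))"
    unfolding conj_map_apply(2)[OF g yI] conj_map_apply(2)[OF g I(1)] conj_map_apply(2)[OF g I(2)]
    using a(3) homeo_plusD(10)[OF g I(3,4)] by simp
  then show ?thesis using a homeo_plusD(7)[OF g yI] unfolding noncommuting_def by blast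
qed

section \<open>Minimality of the image\<close>

text \<open>The group hypotheses appear as closure conditions on sets of maps, so that the geometric
  argument can work pointwise. The isomorphism is directed from \<open>F_set n\<close> to
  \<open>H\<close>; closedness is added in \<open>F_conjugacy\<close>.\<close>

locale F_embedding =
  fixes n m :: nat and H :: "(real \<Rightarrow> real) set" and \<theta> :: "(real \<Rightarrow> real) \<Rightarrow> real \<Rightarrow> real"
  assumes n: "n \<ge> 2" and m: "m \<ge> 2"
    and H_subset: "H \<subseteq> F_set m"
    and H_id: "(\<lambda>x\<in>{0..1}. x) \<in> H"
    and H_compose: "\<And>f g. f \<in> H \<Longrightarrow> g \<in> H \<Longrightarrow> f \<circ>\<^sub>I g \<in> H"
    and H_inverse: "\<And>f. f \<in> H \<Longrightarrow> inverse_map f \<in> H"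
    and H_maximal: "\<And>K. K \<subseteq> F_set m \<Longrightarrow> (\<lambda>x\<in>{0..1}. x) \<in> K \<Longrightarrow>
        (\<And>f g. f \<in> K \<Longrightarrow> g \<in> K \<Longrightarrow> f \<circ>\<^sub>I g \<in> K) \<Longrightarrow>
        (\<And>f. f \<in> K \<Longrightarrow> inverse_map f \<in> K) \<Longrightarrow> H \<subseteq> K \<Longrightarrow> K = H \<or> K = F_set m"
    and \<theta>_bij: "bij_betw \<theta> (F_set n) H"
    and \<theta>_compose: "\<And>f g. f \<in> F_set n \<Longrightarrow> g \<in> F_set n \<Longrightarrow> \<theta> (f \<circ>\<^sub>I g) = \<theta> f \<circ>\<^sub>I \<theta> g"
begin

lemma H_F_set: "h \<in> H \<Longrightarrow> h \<in> F_set m"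
  using H_subset by blast

lemmas H_homeo = F_set_homeo[OF H_F_set]

lemma \<theta>_H: "f \<in> F_set n \<Longrightarrow> \<theta> f \<in> H"
  using \<theta>_bij by (auto simp: bij_betw_def)

lemma \<theta>_F_set: "f \<in> F_set n \<Longrightarrow> \<theta> f \<in> F_set m"
  using \<theta>_H H_F_set by blast

lemmas \<theta>_homeo = F_set_homeo[OF \<theta>_F_set]

lemma \<theta>_inj: "f \<in> F_set n \<Longrightarrow> g \<in> F_set n \<Longrightarrow> \<theta> f = \<theta> g \<longleftrightarrow> f = g"
  using \<theta>_bij by (auto simp: bij_betw_def inj_on_def)

lemma \<theta>_surj:
  assumes "h \<in> H" obtains f where "f \<in> F_set n" "\<theta> f = h"
  using \<theta>_bij assms by (auto simp: bij_betw_def)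

lemma \<theta>_compose_apply:
  assumes "f \<in> F_set n" "g \<in> F_set n" "x \<in> {0..1}"
  shows "\<theta> (f \<circ>\<^sub>I g) x = \<theta> f (\<theta> g x)"
  using \<theta>_compose[OF assms(1,2)] assms(3) by (simp add: compose_def)

lemma \<theta>_id:
  assumes "x \<in> {0..1}"
  shows "\<theta> (\<lambda>x\<in>{0..1}. x) x = x"
proof -
  let ?i = "\<lambda>x\<in>{0..1::real}. x"
  have i: "?i \<in> F_set n" by (rule F_set_id[OF n])
  have "?i \<circ>\<^sub>I ?i = ?i" by (rule ext) (simp add: compose_def)
  then have "\<theta> ?i (\<theta> ?i x) = \<theta> ?i x" using \<theta>_compose_apply[OF i i assms] by simp
  then show ?thesis
    using F_setD(10)[OF \<theta>_F_set[OF i]] F_setD(7)[OF \<theta>_F_set[OF i] assms] assms by simp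
qed

lemma \<theta>_eq_on:
  assumes "f \<in> F_set n" "g \<in> F_set n" "\<And>x. x \<in> {0..1} \<Longrightarrow> f x = g x"
  shows "\<theta> f = \<theta> g"
  using F_set_eqI[OF assms] by simp

lemma \<theta>_inverse:
  assumes f: "f \<in> F_set n"
  shows "\<theta> (inverse_map f) = inverse_map (\<theta> f)"
proof (rule F_set_eqI)
  have i: "inverse_map f \<in> F_set n" by (rule F_set_inverse[OF n f])
  show "\<theta> (inverse_map f) \<in> F_set m" by (rule \<theta>_F_set[OF i])
  show "inverse_map (\<theta> f) \<in> F_set m" by (rule F_set_inverse[OF m \<theta>_F_set[OF f]])
  fix x :: real assume x: "x \<in> {0..1}"
  have "\<theta> (f \<circ>\<^sub>I inverse_map f) = \<theta> (\<lambda>x\<in>{0..1}. x)"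
    using F_set_compose[OF n f i] F_set_id[OF n] inverse_map[OF F_set_homeo[OF f]]
    by (intro \<theta>_eq_on) (auto simp: compose_def)
  then have "\<theta> f (\<theta> (inverse_map f) x) = x" using \<theta>_compose_apply[OF f i x] \<theta>_id[OF x] by simp
  then show "\<theta> (inverse_map f) x = inverse_map (\<theta> f) x"
    using homeo_plus_eq_inverse_map_iff[OF \<theta>_homeo[OF f] F_setD(7)[OF \<theta>_F_set[OF i] x] x] by simp
qed

lemma \<theta>_conj_map:
  assumes "g \<in> F_set n" "a \<in> F_set n"
  shows "\<theta> (conj_map g a) = conj_map (\<theta> g) (\<theta> a)"
  unfolding conj_map_def
  using assms by (simp add: \<theta>_compose \<theta>_inverse F_set_compose[OF n] F_set_inverse[OF n])

lemma \<theta>_commute_iff: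
  assumes "f \<in> F_set n" "g \<in> F_set n"
  shows "(\<forall>x\<in>{0..1}. \<theta> f (\<theta> g x) = \<theta> g (\<theta> f x)) \<longleftrightarrow> (\<forall>x\<in>{0..1}. f (g x) = g (f x))"
proof -
  have c: "f \<circ>\<^sub>I g \<in> F_set n" "g \<circ>\<^sub>I f \<in> F_set n" using assms by (auto intro: F_set_compose[OF n])
  have "(\<forall>x\<in>{0..1}. f (g x) = g (f x)) \<longleftrightarrow> f \<circ>\<^sub>I g = g \<circ>\<^sub>I f"
    using F_set_eqI[OF c] by (auto simp: compose_def dest: fun_cong)
      (metis (full_types) atLeastAtMost_iff restrict_apply')
  also have "\<dots> \<longleftrightarrow> \<theta> (f \<circ>\<^sub>I g) = \<theta> (g \<circ>\<^sub>I f)" using \<theta>_inj[OF c] by simp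
  also have "\<dots> \<longleftrightarrow> (\<forall>x\<in>{0..1}. \<theta> (f \<circ>\<^sub>I g) x = \<theta> (g \<circ>\<^sub>I f) x)"
    using F_set_eqI[OF \<theta>_F_set[OF c(1)] \<theta>_F_set[OF c(2)]] by auto
  finally show ?thesis using \<theta>_compose_apply[OF assms] \<theta>_compose_apply[OF assms(2,1)] by auto
qed

text \<open>The preimages fail to commute somewhere, but nothing relates that place to
  \<open>x\<close>; hence only nonemptiness is claimed.\<close>

lemma noncommuting_preimage_nonempty:
  assumes S: "S \<subseteq> H" and fg: "f \<in> S" "g \<in> S" "x \<in> {0..1}" "f (g x) \<noteq> g (f x)"
  shows "noncommuting {a \<in> F_set n. \<theta> a \<in> S} \<noteq> {}"
proof -
  obtain a b where a: "a \<in> F_set n" "\<theta> a = f" and b: "b \<in> F_set n" "\<theta> b = g"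
    using \<theta>_surj fg S by (metis subsetD)
  then have "\<exists>z\<in>{0..1}. a (b z) \<noteq> b (a z)" using \<theta>_commute_iff[OF a(1) b(1)] fg by auto
  then show ?thesis unfolding noncommuting_def using a b fg by blast
qed

text \<open>The set on which the preimage of \<open>supported m u v\<close> fails to commute is open and is
  preserved by every map fixing one of its points; bumps ending at such a point spread it over
  the whole interval, leaving no room for the preimage of \<open>supported m u' v'\<close>.\<close>

lemma disjoint_rigid_intervals_False:
  assumes uv: "0 \<le> u" "u < v" "v \<le> 1" and uv': "0 \<le> u'" "u' < v'" "v' \<le> 1"
    and dj: "v \<le> u' \<or> v' \<le> u"
    and S: "supported m u v \<subseteq> H" and S': "supported m u' v' \<subseteq> H"
    and tri: "\<And>h. h \<in> H \<Longrightarrow> (h u = u \<and> h v = v) \<or> h v \<le> u \<or> v \<le> h u"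
  shows False
proof -
  define A where "A = {a \<in> F_set n. \<theta> a \<in> supported m u v}"
  define B where "B = {a \<in> F_set n. \<theta> a \<in> supported m u' v'}"
  define U where "U = noncommuting A"
  define V where "V = noncommuting B"
  have AF: "A \<subseteq> F_set n" and BF: "B \<subseteq> F_set n" unfolding A_def B_def by auto
  have "U \<noteq> {}"
  proof -
    obtain f g x where "f \<in> supported m u v" "g \<in> supported m u v" "x \<in> {0..1}" "f (g x) \<noteq> g (f x)"
      using supported_nonabelian[OF m uv] .
    then show ?thesis unfolding U_def A_def by (rule noncommuting_preimage_nonempty[OF S])
  qed
  moreover have "V \<noteq> {}"
  proof -
    obtain f g x where "f \<in> supported m u' v'" "g \<in> supported m u' v'" "x \<in> {0..1}" "f (g x) \<noteq> g (f x)"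
      using supported_nonabelian[OF m uv'] .
    then show ?thesis unfolding V_def B_def by (rule noncommuting_preimage_nonempty[OF S'])
  qed
  ultimately obtain y z where y: "y \<in> U" and z: "z \<in> V" by blast
  have "a (b x) = b (a x)" if "a \<in> A" "b \<in> B" "x \<in> {0..1}" for a b x
  proof -
    have ab: "a \<in> F_set n" "b \<in> F_set n" "\<theta> a \<in> supported m u v" "\<theta> b \<in> supported m u' v'"
      using that unfolding A_def B_def by auto
    then have "\<forall>x\<in>{0..1}. \<theta> a (\<theta> b x) = \<theta> b (\<theta> a x)"
      using dj supported_commute[OF ab(3,4)] supported_commute[OF ab(4,3)] by metis
    then show ?thesis using \<theta>_commute_iff[OF ab(1,2)] that(3) by blast
  qed
  \<comment> \<open>Elements of \<open>B\<close> commute with all of \<open>A\<close>, so they fix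
    \<open>U\<close> pointwise. They then commute with each other on \<open>U\<close>, which makes
    \<open>U\<close> and \<open>V\<close> disjoint.\<close>
  then have Bfix: "b t = t" if "b \<in> B" "t \<in> U" for b t
    using noncommuting_fixed[OF n AF, of b t] that BF unfolding U_def by blast
  have UV: "t \<notin> V" if "t \<in> U" for t
  proof
    assume "t \<in> V"
    then obtain b b' where b: "b \<in> B" "b' \<in> B" "b (b' t) \<noteq> b' (b t)"
      unfolding V_def noncommuting_def by blast
    show False using b(3) Bfix[OF b(1) that] Bfix[OF b(2) that] by simp
  qed
  obtain e where e: "e > 0" "0 < y - e" "y + e < 1" "{y - e..y + e} \<subseteq> U"
    using noncommuting_interior(3)[OF AF, of y] y unfolding U_def by blast
  obtain p where p: "p \<in> adic_rationals n" "y - e < p" "p < y"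
    using adic_rationals_dense[OF n, of "y - e" y] e by auto
  have pU: "p \<in> U" using p e by auto
  have p01: "0 < p" "p < 1" using p e by auto
  have z01: "0 < z" "z < 1" using noncommuting_interior[OF BF] z unfolding V_def by auto
  \<comment> \<open>By \<open>tri\<close>, either \<open>\<theta> g\<close> fixes \<open>u\<close>
    and \<open>v\<close>, and conjugation by \<open>g\<close> preserves \<open>A\<close>; or it
    moves the interval off itself, and the conjugate of \<open>A\<close> commutes with
    \<open>A\<close>, hence fixes \<open>p\<close>. The second case is impossible: \<open>g\<close>
    fixes \<open>p\<close>, so \<open>p\<close> is a noncommutation point of the conjugate as
    well.\<close>
  have inv: "g t \<in> U" if g: "g \<in> F_set n" "g p = p" and t: "t \<in> U" for g t
  proof -
    have hg: "g \<in> homeo_plus {0..1}" by (rule F_set_homeo[OF g(1)])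
    have c: "conj_map g a \<in> F_set n \<and> \<theta> (conj_map g a) \<in> supported m (\<theta> g u) (\<theta> g v)" if "a \<in> A" for a
      using that \<theta>_conj_map[OF g(1)] conj_map_supported[OF m \<theta>_F_set[OF g(1)], of "\<theta> a" u v] uv
        conj_map_F_set[OF n g(1)] unfolding A_def by auto
    consider "\<theta> g u = u" "\<theta> g v = v" | "\<theta> g v \<le> u \<or> v \<le> \<theta> g u" using tri[OF \<theta>_H[OF g(1)]] by blast
    then show ?thesis
    proof cases
      case 1
      then have "conj_map g ` A \<subseteq> A" using c unfolding A_def by auto
      then show ?thesis using noncommuting_conj[OF hg AF] t noncommuting_mono unfolding U_def by blast
    next
      case 2
      have pn: "p \<in> noncommuting (conj_map g ` A)"
        using noncommuting_conj[OF hg AF, of p] pU g(2) unfolding U_def by simp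
      have cfix: "c p = p" if "c \<in> conj_map g ` A" for c
      proof (rule noncommuting_fixed[OF n AF])
        show cF: "c \<in> F_set n" using that c by auto
        show "p \<in> noncommuting A" using pU unfolding U_def .
        fix a x assume a: "a \<in> A" and x: "x \<in> {0..1::real}"
        have aF: "a \<in> F_set n" "\<theta> a \<in> supported m u v" using a unfolding A_def by auto
        have cs: "\<theta> c \<in> supported m (\<theta> g u) (\<theta> g v)" using that c by auto
        have "\<forall>x\<in>{0..1}. \<theta> a (\<theta> c x) = \<theta> c (\<theta> a x)"
          using 2 supported_commute[OF aF(2) cs] supported_commute[OF cs aF(2)] by metis
        then show "a (c x) = c (a x)" using \<theta>_commute_iff[OF aF(1) cF] x by blast
      qed
      obtain c c' where "c \<in> conj_map g ` A" "c' \<in> conj_map g ` A" "c (c' p) \<noteq> c' (c p)"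
        using pn unfolding noncommuting_def by blast
      then show ?thesis using cfix[of c] cfix[of c'] by simp
    qed
  qed
  have pull: "z \<in> U" if g: "g \<in> F_set n" "g p = p" "g z \<in> U" for g
  proof -
    have hg: "g \<in> homeo_plus {0..1}" by (rule F_set_homeo[OF g(1)])
    have "inverse_map g p = p" using inverse_map(1)[OF hg, of p] g(2) p01 by simp
    then have "inverse_map g (g z) \<in> U" using inv[OF F_set_inverse[OF n g(1)] _ g(3)] by simp
    then show ?thesis using inverse_map(1)[OF hg, of z] z01 by simp
  qed
  \<comment> \<open>Iterates of a bump ending at \<open>p\<close>, or of its inverse, bring
    \<open>z\<close> into the neighbourhood of \<open>y\<close> inside \<open>U\<close> while fixing
    \<open>p\<close>; then \<open>pull\<close> places \<open>z\<close> itself in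
    \<open>U\<close>.\<close>
  consider "z < p" | "z = p" | "p < z" by linarith
  then have "z \<in> U"
  proof cases
    case 1
    define b where "b = bump n 0 p"
    have b: "b \<in> F_set n" unfolding b_def by (rule bump_in_F_set[OF n _ p(1)]) (use p01 in auto)
    define f where "f = inverse_map b"
    have f: "f \<in> F_set n" unfolding f_def by (rule F_set_inverse[OF n b])
    have "b p = p" unfolding b_def by (rule bump_outside[OF n]) (use p01 in auto)
    then have fp: "f p = p" unfolding f_def using inverse_map(1)[OF F_set_homeo[OF b], of p] p01 by simp
    have "t < f t" if "z \<le> t" "t < p" for t
      using bump_less[OF n, of t 0 p] inverse_map_greater(1)[OF F_set_homeo[OF b], of t] that p01 z01
      unfolding f_def b_def by auto
    then obtain k where k: "y - e < (f ^^ k) z" "(f ^^ k) z < p"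
      using funpow_converges_right[OF F_set_homeo[OF f] _ fp, of z "y - e"] p01 z01 1 p by auto
    obtain g where g: "g \<in> F_set n" "\<And>x. x \<in> {0..1} \<Longrightarrow> g x = (f ^^ k) x"
      using F_set_funpow[OF n f] by blast
    have "(f ^^ k) p = p" by (induction k) (auto simp: fp)
    moreover have "(f ^^ k) z \<in> U" by (rule subsetD[OF e(4)]) (use k e p in auto)
    ultimately show ?thesis using pull[OF g(1)] g(2) p01 z01 by auto
  next
    case 2
    then show ?thesis using pU by simp
  next
    case 3
    define f where "f = bump n p 1"
    have f: "f \<in> F_set n" unfolding f_def by (rule bump_in_F_set[OF n p(1)]) (use p01 in auto)
    have fp: "f p = p" unfolding f_def by (rule bump_outside[OF n]) (use p01 in auto)
    have "f t < t" if "p < t" "t \<le> z" for t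
      using bump_less[OF n, of t p 1] that p01 z01 unfolding f_def by auto
    then obtain k where k: "p < (f ^^ k) z" "(f ^^ k) z < y"
      using funpow_converges_left[OF F_set_homeo[OF f] _ fp, of z y] p01 z01 3 p by auto
    obtain g where g: "g \<in> F_set n" "\<And>x. x \<in> {0..1} \<Longrightarrow> g x = (f ^^ k) x"
      using F_set_funpow[OF n f] by blast
    have "(f ^^ k) p = p" by (induction k) (auto simp: fp)
    moreover have "(f ^^ k) z \<in> U" by (rule subsetD[OF e(4)]) (use k e p in auto)
    ultimately show ?thesis using pull[OF g(1)] g(2) p01 z01 by auto
  qed
  then show False using z UV by blast
qed

text \<open>The stabilizer of \<open>Y\<close> is a subgroup containing \<open>H\<close>, and
  \<open>g\<close> shows that it is proper.\<close>

lemma H_eq_stabilizer: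
  assumes Y: "\<And>h x. h \<in> H \<Longrightarrow> x \<in> {0..1} \<Longrightarrow> h x \<in> Y \<longleftrightarrow> x \<in> Y"
    and g: "g \<in> F_set m" "x \<in> {0..1}" "(g x \<in> Y) \<noteq> (x \<in> Y)"
  shows "{f \<in> F_set m. \<forall>x\<in>{0..1}. f x \<in> Y \<longleftrightarrow> x \<in> Y} = H" (is "?K = H")
proof -
  have "?K = H \<or> ?K = F_set m"
  proof (rule H_maximal)
    show "(\<lambda>x\<in>{0..1}. x) \<in> ?K" using F_set_id[OF m] by simp
    show "f \<circ>\<^sub>I g \<in> ?K" if "f \<in> ?K" "g \<in> ?K" for f g
      using that F_set_compose[OF m] F_setD(7)[of g m] by (auto simp: compose_def)
    show "inverse_map f \<in> ?K" if "f \<in> ?K" for f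
    proof -
      have f: "f \<in> F_set m" using that by simp
      have "inverse_map f x \<in> Y \<longleftrightarrow> x \<in> Y" if x: "x \<in> {0..1}" for x
      proof -
        have "f (inverse_map f x) \<in> Y \<longleftrightarrow> inverse_map f x \<in> Y"
          using \<open>f \<in> ?K\<close> inverse_map(3)[OF F_set_homeo[OF f] x] by blast
        then show ?thesis using inverse_map(2)[OF F_set_homeo[OF f] x] by simp
      qed
      then show ?thesis using F_set_inverse[OF m f] by simp
    qed
    show "H \<subseteq> ?K" using H_F_set Y by blast
  qed simp
  then show ?thesis using g by blast
qed

text \<open>If the orbit \<open>Y\<close> of \<open>y\<close> missed \<open>(c,d)\<close>, then
  \<open>H\<close> would be the stabilizer of \<open>Y\<close> and would contain all maps supported
  in the gap \<open>(u,v)\<close> of \<open>Y\<close> around \<open>(c,d)\<close>. Either some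
  element moves this gap off itself, or an end of the gap inside (0,1) is fixed by \<open>H\<close>,
  which is then the stabilizer of that point. Both cases yield two disjoint intervals whose
  supported maps all lie in \<open>H\<close>.\<close>

lemma minimal:
  assumes y: "0 < y" "y < 1" and cd: "0 \<le> c" "c < d" "d \<le> 1"
  shows "\<exists>h\<in>H. c < h y \<and> h y < d"
proof (rule ccontr)
  assume neg: "\<not> ?thesis"
  define Y where "Y = (\<lambda>h. h y) ` H"
  have yO: "y \<in> Y" unfolding Y_def using H_id y by (force intro: rev_image_eqI[OF H_id])
  have O01: "0 < t \<and> t < 1" if "t \<in> Y" for t
  proof -
    obtain h where h: "h \<in> H" "t = h y" using \<open>t \<in> Y\<close> unfolding Y_def by blast
    then show ?thesis
      using homeo_plusD(5,6)[OF H_homeo[OF h(1)]] homeo_plusD(8)[OF H_homeo[OF h(1)], of 0 y]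
        homeo_plusD(8)[OF H_homeo[OF h(1)], of y 1] y by auto
  qed
  have Ocd: "t \<le> c \<or> d \<le> t" if "t \<in> Y" for t using neg that unfolding Y_def by force
  have Oh: "h t \<in> Y" if "h \<in> H" "t \<in> Y" for h t
  proof -
    obtain h' where h': "h' \<in> H" "t = h' y" using \<open>t \<in> Y\<close> unfolding Y_def by blast
    then have "h t = (h \<circ>\<^sub>I h') y" using y by (simp add: compose_def)
    then show ?thesis unfolding Y_def using H_compose[OF that(1) h'(1)] by blast
  qed
  have Oinv: "h x \<in> Y \<longleftrightarrow> x \<in> Y" if "h \<in> H" "x \<in> {0..1}" for h x
    using Oh[OF that(1)] Oh[OF H_inverse[OF that(1)], of "h x"] inverse_map(1)[OF H_homeo[OF that(1)] that(2)]
    by auto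
  obtain g where g: "g \<in> F_set m" "c < g y" "g y < d" using F_set_compress[OF m y cd] by blast
  have "(g y \<in> Y) \<noteq> (y \<in> Y)" using yO Ocd[of "g y"] g by auto
  then have K: "{f \<in> F_set m. \<forall>x\<in>{0..1}. f x \<in> Y \<longleftrightarrow> x \<in> Y} = H"
    using H_eq_stabilizer[of Y g y] Oinv g(1) y by auto
  \<comment> \<open>Inserting 0 here and 1 in \<open>R\<close> keeps supremum and infimum meaningful
    when no orbit point lies on that side of \<open>(c,d)\<close>.\<close>
  define L where "L = insert 0 {t \<in> Y. t \<le> c}"
  define R where "R = insert 1 {t \<in> Y. d \<le> t}"
  define u where "u = Sup L"
  define v where "v = Inf R"
  have Lb: "bdd_above L" "L \<noteq> {}" unfolding L_def using cd by (auto intro!: bdd_aboveI[of _ c])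
  have Rb: "bdd_below R" "R \<noteq> {}" unfolding R_def using cd by (auto intro!: bdd_belowI[of _ d])
  have "u \<le> c" unfolding u_def by (rule cSup_least[OF Lb(2)]) (use cd in \<open>auto simp: L_def\<close>)
  moreover have "0 \<le> u" unfolding u_def by (rule cSup_upper[OF _ Lb(1)]) (simp add: L_def)
  ultimately have u: "0 \<le> u" "u \<le> c" by auto
  have "d \<le> v" unfolding v_def by (rule cInf_greatest[OF Rb(2)]) (use cd in \<open>auto simp: R_def\<close>)
  moreover have "v \<le> 1" unfolding v_def by (rule cInf_lower[OF _ Rb(1)]) (simp add: R_def)
  ultimately have v: "v \<le> 1" "d \<le> v" by auto
  have uv: "u < v" using u v cd by linarith
  have uI: "u \<in> {0..1}" and vI: "v \<in> {0..1}" using u v cd by auto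
  have gap: "t \<le> u \<or> v \<le> t" if "t \<in> Y" for t
    using Ocd[OF that] cSup_upper[OF _ Lb(1), of t] cInf_lower[OF _ Rb(1), of t] that
    unfolding u_def v_def L_def R_def by auto
  have S: "supported m u v \<subseteq> H"
  proof
    fix f assume f: "f \<in> supported m u v"
    have fF: "f \<in> F_set m" using f unfolding supported_def by simp
    have "f x \<in> Y \<longleftrightarrow> x \<in> Y" if x: "x \<in> {0..1}" for x
    proof (cases "x \<le> u \<or> v \<le> x")
      case True
      then show ?thesis using f x unfolding supported_def by auto
    next
      case False
      then have "u < f x" "f x < v" using supported_inside[OF f x] u v by auto
      then show ?thesis using False gap[of x] gap[of "f x"] by auto
    qed
    then show "f \<in> H" using fF K by auto
  qed
  \<comment> \<open>If \<open>h u\<close> fell inside the gap, some element of \<open>L\<close>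
    close enough to \<open>u\<close> would also be sent into the gap. It cannot be 0, which
    \<open>h\<close> fixes, so it is an orbit point with an image in the gap.\<close>
  have hu: "h u \<le> u \<or> v \<le> h u" if h: "h \<in> H" for h
  proof (rule ccontr)
    assume "\<not> ?thesis"
    then have a: "u < h u" "h u < v" by auto
    have "inverse_map h u < u" using inverse_map_greater(2)[OF H_homeo[OF h] uI] a by simp
    then obtain t where t: "t \<in> L" "inverse_map h u < t" unfolding u_def using less_cSupD[OF Lb(2)] by blast
    have tu: "t \<le> u" unfolding u_def by (rule cSup_upper[OF t(1) Lb(1)])
    have tI: "t \<in> {0..1}" using t(1) O01[of t] unfolding L_def by auto
    have "u < h t"
      using homeo_plusD(8)[OF H_homeo[OF h] inverse_map(3)[OF H_homeo[OF h] uI] tI] t(2)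
        inverse_map(2)[OF H_homeo[OF h] uI] by simp
    moreover have "h t \<le> h u" using homeo_plusD(9)[OF H_homeo[OF h] tI uI] tu by simp
    moreover have "t \<in> Y" using t(1) \<open>u < h t\<close> homeo_plusD(5)[OF H_homeo[OF h]] u unfolding L_def by auto
    ultimately show False using gap[of "h t"] Oh[OF h, of t] a by auto
  qed
  have hv: "h v \<le> u \<or> v \<le> h v" if h: "h \<in> H" for h
  proof (rule ccontr)
    assume "\<not> ?thesis"
    then have a: "u < h v" "h v < v" by auto
    have "v < inverse_map h v" using inverse_map_greater(1)[OF H_homeo[OF h] vI] a by simp
    then obtain t where t: "t \<in> R" "t < inverse_map h v" unfolding v_def using cInf_lessD[OF Rb(2)] by blast
    have tv: "v \<le> t" unfolding v_def by (rule cInf_lower[OF t(1) Rb(1)])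
    have tI: "t \<in> {0..1}" using t(1) O01 unfolding R_def by force
    have "h t < v"
      using homeo_plusD(8)[OF H_homeo[OF h] tI inverse_map(3)[OF H_homeo[OF h] vI]] t(2)
        inverse_map(2)[OF H_homeo[OF h] vI] by simp
    moreover have "h v \<le> h t" using homeo_plusD(9)[OF H_homeo[OF h] vI tI] tv by simp
    moreover have "t \<in> Y" using t(1) \<open>h t < v\<close> homeo_plusD(6)[OF H_homeo[OF h]] v unfolding R_def by auto
    ultimately show False using gap[of "h t"] Oh[OF h, of t] a by auto
  qed
  \<comment> \<open>Applied to \<open>h\<close> and to its inverse, \<open>hu\<close> and
    \<open>hv\<close> say that the gap and its image cannot overlap unless they are equal.\<close>
  have tri: "(h u = u \<and> h v = v) \<or> h v \<le> u \<or> v \<le> h u" if h: "h \<in> H" for h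
  proof -
    have hi: "inverse_map h \<in> H" by (rule H_inverse[OF h])
    have hh: "h \<in> homeo_plus {0..1}" by (rule H_homeo[OF h])
    have lt: "inverse_map h s < t \<longleftrightarrow> s < h t" "t < inverse_map h s \<longleftrightarrow> h t < s"
      if "s \<in> {0..1}" "t \<in> {0..1}" for s t
      using homeo_plusD(8)[OF hh inverse_map(3)[OF hh that(1)] that(2)]
        homeo_plusD(8)[OF hh that(2) inverse_map(3)[OF hh that(1)]] inverse_map(2)[OF hh that(1)] by auto
    have "\<not> (h u < u \<and> u < h v)" using hu[OF hi] lt(1)[OF uI vI] lt(2)[OF uI uI] by (meson not_le)
    moreover have "\<not> (h u < v \<and> v < h v)" using hv[OF hi] lt(1)[OF vI vI] lt(2)[OF vI uI] by (meson not_le)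
    ultimately show ?thesis using hu[OF h] hv[OF h] uv by argo
  qed
  show False
  proof (cases "\<forall>h\<in>H. h u = u \<and> h v = v")
    case False
    then obtain h where h: "h \<in> H" "\<not> (h u = u \<and> h v = v)" by blast
    have hF: "h \<in> F_set m" by (rule H_F_set[OF h(1)])
    have hh: "h \<in> homeo_plus {0..1}" by (rule H_homeo[OF h(1)])
    have hI: "h u \<in> {0..1}" "h v \<in> {0..1}" "h u < h v"
      using homeo_plusD(7)[OF hh uI] homeo_plusD(7)[OF hh vI] homeo_plusD(8)[OF hh uI vI] uv by auto
    have "supported m (h u) (h v) \<subseteq> H"
    proof
      fix f assume f: "f \<in> supported m (h u) (h v)"
      have fF: "f \<in> F_set m" using f unfolding supported_def by simp
      have "conj_map (inverse_map h) f \<in> supported m u v"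
        using conj_map_supported[OF m F_set_inverse[OF m hF] f hI(1,2)] inverse_map(1)[OF hh] uI vI by simp
      then have c: "conj_map (inverse_map h) f \<in> H" using S by blast
      have "h \<circ>\<^sub>I (conj_map (inverse_map h) f \<circ>\<^sub>I inverse_map h) = f"
      proof (rule F_set_eqI)
        show "h \<circ>\<^sub>I (conj_map (inverse_map h) f \<circ>\<^sub>I inverse_map h) \<in> F_set m"
          using c H_F_set hF F_set_inverse[OF m hF] by (intro F_set_compose[OF m]) auto
        show "f \<in> F_set m" by fact
        show "(h \<circ>\<^sub>I (conj_map (inverse_map h) f \<circ>\<^sub>I inverse_map h)) x = f x" if x: "x \<in> {0..1}" for x
          using conj_map_apply(2)[OF inverse_map_homeo[OF hh] x] x inverse_map(2)[OF hh F_setD(7)[OF fF x]]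
          by (simp add: compose_def)
      qed
      then show "f \<in> H" using H_compose[OF h(1) H_compose[OF c H_inverse[OF h(1)]]] by simp
    qed
    then show False
      using disjoint_rigid_intervals_False[of u v "h u" "h v"] u v uv hI S tri h by auto
  next
    case True
    \<comment> \<open>The gap omits \<open>y\<close>, so it is not all of (0,1) and one of its ends
      is an interior point, fixed by all of \<open>H\<close> in this case.\<close>
    have "u > 0 \<or> v < 1" using gap[OF yO] y by auto
    then obtain p where p: "0 < p" "p < 1" "\<And>h. h \<in> H \<Longrightarrow> h p = p"
      using True uv u v by (metis less_le_trans le_less_trans)
    obtain g where g: "g \<in> F_set m" "0 < g p" "g p < p"
      using F_set_compress[OF m p(1) p(2), of 0 p] p by auto
    have "{f \<in> F_set m. \<forall>x\<in>{0..1}. f x \<in> {p} \<longleftrightarrow> x \<in> {p}} = H"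
    proof (rule H_eq_stabilizer[OF _ g(1)])
      show "h x \<in> {p} \<longleftrightarrow> x \<in> {p}" if "h \<in> H" "x \<in> {0..1}" for h x
        using homeo_plusD(10)[OF H_homeo[OF that(1)] that(2), of p] p(1,2) p(3)[OF that(1)] by auto
      show "p \<in> {0..1}" "(g p \<in> {p}) \<noteq> (p \<in> {p})" using p g by auto
    qed
    moreover have "f x = p \<longleftrightarrow> x = p" if "f \<in> F_set m" "f p = p" "x \<in> {0..1}" for f x
      using F_setD(10)[OF that(1,3), of p] that(2) p by auto
    ultimately have st: "f \<in> H" if "f \<in> F_set m" "f p = p" for f using that by auto
    have "supported m 0 p \<subseteq> H" "supported m p 1 \<subseteq> H"
      using st p unfolding supported_def by auto
    then show False
      using disjoint_rigid_intervals_False[of 0 p p 1] p homeo_plusD(5)[OF H_homeo] by auto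
  qed
qed

end

section \<open>Reflection of the interval\<close>

text \<open>Conjugation by the reflection \<open>1 - x\<close>. It keeps maps increasing, so
  precomposing an embedding with it turns a reversed orientation into the right one.\<close>

definition flip :: "(real \<Rightarrow> real) \<Rightarrow> real \<Rightarrow> real" where
  "flip f = (\<lambda>x\<in>{0..1}. 1 - f (1 - x))"

lemma flip_apply: "x \<in> {0..1} \<Longrightarrow> flip f x = 1 - f (1 - x)"
  by (simp add: flip_def)

lemma flip_F_set:
  assumes n: "n \<ge> 2" and f: "f \<in> F_set n"
  shows "flip f \<in> F_set n"
proof (rule F_setI[OF n])
  have n1: "n \<ge> 1" using n by simp
  show "flip f \<in> extensional {0..1}" by (simp add: flip_def)
  show "strict_mono_on {0..1} (flip f)"
    by (rule strict_mono_onI) (use F_setD(8)[OF f] in \<open>auto simp: flip_apply\<close>)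
  show "flip f 0 = 0" "flip f 1 = 1" using F_setD(5,6)[OF f] by (auto simp: flip_apply)
  fix t :: real assume t: "t \<in> {0..1}"
  then have t': "1 - t \<in> {0..1}" by auto
  from locally_adicE[OF F_set_locally_adic[OF n f t']] obtain e s s' c c' where e: "e > 0"
    and c: "c \<in> adic_rationals n" "c' \<in> adic_rationals n"
    and l: "\<And>x. x \<in> {0..1} \<Longrightarrow> 1 - t - e \<le> x \<Longrightarrow> x \<le> 1 - t \<Longrightarrow> f x = real n powi s * x + c"
    and r: "\<And>x. x \<in> {0..1} \<Longrightarrow> 1 - t \<le> x \<Longrightarrow> x \<le> 1 - t + e \<Longrightarrow> f x = real n powi s' * x + c'"
    and D: "1 - t \<notin> adic_rationals n \<Longrightarrow> s = s' \<and> c = c'" by metis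
  show "locally_adic n (flip f) t"
  proof (rule locally_adicI[of e "1 - (real n powi s' * 1 + c')" n "1 - (real n powi s * 1 + c)" _ _ s' s])
    show "1 - (real n powi s' * 1 + c') \<in> adic_rationals n" "1 - (real n powi s * 1 + c) \<in> adic_rationals n"
      using c n1 by (auto intro!: adic_rationals_diff simp only: adic_rationals_powi_affine_iff adic_rationals_1)
    show "s' = s \<and> 1 - (real n powi s' * 1 + c') = 1 - (real n powi s * 1 + c)"
      if "t \<notin> adic_rationals n"
      using that D adic_rationals_diff[OF n1 adic_rationals_1, of "1 - t"] by auto
    show "flip f x = real n powi s' * x + (1 - (real n powi s' * 1 + c'))"
      if "x \<in> {0..1}" "t - e \<le> x" "x \<le> t" for x
      using r[of "1 - x"] that by (simp add: flip_apply algebra_simps)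
    show "flip f x = real n powi s * x + (1 - (real n powi s * 1 + c))"
      if "x \<in> {0..1}" "t \<le> x" "x \<le> t + e" for x
      using l[of "1 - x"] that by (simp add: flip_apply algebra_simps)
  qed (rule e)
qed

lemma flip_flip:
  assumes "f \<in> F_set n"
  shows "flip (flip f) = f"
  using F_setD(1)[OF assms] by (intro extensionalityI[of _ "{0..1}"]) (auto simp: flip_def)

lemma flip_compose:
  assumes g: "g \<in> F_set n"
  shows "flip (f \<circ>\<^sub>I g) = flip f \<circ>\<^sub>I flip g"
proof (rule extensionalityI[of _ "{0..1}"])
  fix x :: real assume x: "x \<in> {0..1}"
  then have "1 - x \<in> {0..1}" by auto
  then have "g (1 - x) \<in> {0..1}" by (rule F_setD(7)[OF g])
  then show "flip (f \<circ>\<^sub>I g) x = (flip f \<circ>\<^sub>I flip g) x" using x by (simp add: flip_def compose_def)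
qed (auto simp: flip_def compose_def)

lemma flip_supported:
  assumes n: "n \<ge> 2" and f: "f \<in> supported n u v"
  shows "flip f \<in> supported n (1 - v) (1 - u)"
  using flip_F_set[OF n] f unfolding supported_def by (auto simp: flip_apply)

text \<open>The germ at 1 is affine and fixes 1; one further fixed point within its range makes it
  the identity.\<close>

lemma F_set_identity_near_1:
  assumes n: "n \<ge> 2" and f: "f \<in> F_set n" and fp: "\<And>t. t < 1 \<Longrightarrow> \<exists>z. t < z \<and> z < 1 \<and> f z = z"
  obtains e where "e > 0" "\<And>x. x \<in> {0..1} \<Longrightarrow> 1 - e \<le> x \<Longrightarrow> f x = x"
proof -
  have "(1::real) \<in> {0..1}" by simp
  from locally_adicE[OF F_set_locally_adic[OF n f this]] obtain e s c where e: "e > 0"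
    and l: "\<And>x. x \<in> {0..1} \<Longrightarrow> 1 - e \<le> x \<Longrightarrow> x \<le> 1 \<Longrightarrow> f x = real n powi s * x + c" by metis
  obtain z where z: "max 0 (1 - e) < z" "z < 1" "f z = z" using fp[of "max 0 (1 - e)"] e by auto
  have "real n powi s * z + c = real n powi 0 * z + 0" using l[of z] z by auto
  moreover have "real n powi s * 1 + c = real n powi 0 * 1 + 0" using l[of 1] F_setD(6)[OF f] e by auto
  ultimately have "s = 0" "c = 0" using powi_affine_unique[OF n, of z 1 s c 0 0] z by auto
  then have "f x = x" if "x \<in> {0..1}" "1 - e \<le> x" for x using l[of x] that by auto
  then show thesis using that e by blast
qed

section \<open>The conjugating homeomorphism\<close>

lemma homeo_plus_openI:
  assumes "\<phi> \<in> extensional {0<..<1}" "strict_mono_on {0<..<1} \<phi>" "\<phi> ` {0<..<1} = {0<..<1::real}"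
  shows "\<phi> \<in> homeo_plus {0<..<1}"
proof -
  let ?\<psi> = "inv_into {0<..<1} \<phi>"
  have inj: "inj_on \<phi> {0<..<1}" using assms(2) by (rule strict_mono_on_imp_inj_on)
  have mono: "\<phi> x \<le> \<phi> y" if "x \<in> {0<..<1}" "y \<in> {0<..<1}" "x \<le> y" for x y
    using mono_onD[OF strict_mono_on_imp_mono_on[OF assms(2)]] that by blast
  have im: "?\<psi> ` {0<..<1} = {0<..<1}"
    using inj_on_imp_bij_betw[OF inj] assms(3) bij_betw_inv_into by (metis bij_betw_def)
  have \<psi>I: "?\<psi> x \<in> {0<..<1}" if "x \<in> {0<..<1}" for x
    using inv_into_into[of x \<phi> "{0<..<1}"] assms(3) that by simp
  have \<psi>mono: "?\<psi> x \<le> ?\<psi> y" if "x \<in> {0<..<1}" "y \<in> {0<..<1}" "x \<le> y" for x y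
  proof (rule ccontr)
    assume "\<not> ?thesis"
    then have "\<phi> (?\<psi> y) < \<phi> (?\<psi> x)"
      using strict_mono_onD[OF assms(2) \<psi>I \<psi>I] that by simp
    then show False using that assms(3) by (simp add: f_inv_into_f)
  qed
  have "homeomorphism {0<..<1} {0<..<1} \<phi> ?\<psi>"
    unfolding homeomorphism_def
    using assms(3) im inj mono \<psi>mono
    by (auto intro!: continuous_onI_mono simp: f_inv_into_f inv_into_f_f)
  then show ?thesis using assms unfolding homeo_plus_def by blast
qed

context F_embedding
begin

lemma \<theta>_funpow:
  assumes f: "f \<in> F_set n"
  obtains g where "g \<in> F_set n" "\<And>x. x \<in> {0..1} \<Longrightarrow> g x = (f ^^ k) x"
    "\<And>x. x \<in> {0..1} \<Longrightarrow> \<theta> g x = (\<theta> f ^^ k) x"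
proof -
  have "\<exists>g\<in>F_set n. \<forall>x\<in>{0..1}. g x = (f ^^ k) x \<and> \<theta> g x = (\<theta> f ^^ k) x"
  proof (induction k)
    case 0
    show ?case
    proof (rule bexI[OF _ F_set_id[OF n]], intro ballI conjI)
      fix x :: real assume x: "x \<in> {0..1}"
      show "(\<lambda>x\<in>{0..1}. x) x = (f ^^ 0) x" using x by simp
      show "\<theta> (\<lambda>x\<in>{0..1}. x) x = (\<theta> f ^^ 0) x" unfolding \<theta>_id[OF x] by simp
    qed
  next
    case (Suc k)
    then obtain g where g: "g \<in> F_set n" "\<forall>x\<in>{0..1}. g x = (f ^^ k) x \<and> \<theta> g x = (\<theta> f ^^ k) x" by blast
    have "\<theta> (f \<circ>\<^sub>I g) x = (\<theta> f ^^ Suc k) x" if "x \<in> {0..1}" for x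
      using \<theta>_compose_apply[OF f g(1) that] g(2) that by simp
    moreover have "(f \<circ>\<^sub>I g) x = (f ^^ Suc k) x" if "x \<in> {0..1}" for x
      using g(2) that by (simp add: compose_def)
    ultimately show ?case using F_set_compose[OF n f g(1)] by blast
  qed
  then show thesis using that by blast
qed

section \<open>Target regions attributed to intervals, and their equivariance\<close>

text \<open>The part of the target interval attributed to \<open>[u,v]\<close>; the values of
  \<open>\<phi>\<close> are read off as suprema of such sets.\<close>

definition image_support :: "real \<Rightarrow> real \<Rightarrow> real set" where
  "image_support u v = noncommuting (\<theta> ` supported n u v)"

lemma supported_F_set: "f \<in> supported n u v \<Longrightarrow> f \<in> F_set n"
  unfolding supported_def by simp

lemma image_supported_F_set: "\<theta> ` supported n u v \<subseteq> F_set m"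
  using \<theta>_F_set supported_F_set by blast

lemmas image_support_interior = noncommuting_interior[OF image_supported_F_set, folded image_support_def]

lemma image_support_mono: "u' \<le> u \<Longrightarrow> v \<le> v' \<Longrightarrow> image_support u v \<subseteq> image_support u' v'"
  unfolding image_support_def by (intro noncommuting_mono image_mono supported_mono)

lemma image_support_nonempty:
  assumes "0 \<le> u" "u < v" "v \<le> 1"
  shows "image_support u v \<noteq> {}"
proof -
  obtain f g x where fg: "f \<in> supported n u v" "g \<in> supported n u v" "x \<in> {0..1}" "f (g x) \<noteq> g (f x)"
    using supported_nonabelian[OF n assms] .
  then have "\<exists>x\<in>{0..1}. \<theta> f (\<theta> g x) \<noteq> \<theta> g (\<theta> f x)"
    using \<theta>_commute_iff[OF fg(1,2)[THEN supported_F_set]] by blast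
  then show ?thesis using fg unfolding image_support_def noncommuting_def by blast
qed

lemma image_support_fixed:
  assumes f: "f \<in> supported n u v" and z: "z \<in> image_support u' v'" and "v \<le> u' \<or> v' \<le> u"
  shows "\<theta> f z = z"
proof (rule noncommuting_fixed[OF m image_supported_F_set])
  show "\<theta> f \<in> F_set m" using \<theta>_F_set supported_F_set[OF f] by blast
  show "z \<in> noncommuting (\<theta> ` supported n u' v')" using z unfolding image_support_def .
  fix a x assume a: "a \<in> \<theta> ` supported n u' v'" and x: "x \<in> {0..1::real}"
  then obtain g where g: "g \<in> supported n u' v'" "a = \<theta> g" by blast
  have "\<forall>x\<in>{0..1}. g (f x) = f (g x)"
    using supported_commute[OF f g(1)] supported_commute[OF g(1) f] assms(3) by metis
  then show "a (\<theta> f x) = \<theta> f (a x)"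
    using \<theta>_commute_iff[OF supported_F_set[OF g(1)] supported_F_set[OF f]] x g(2) by blast
qed

lemma image_support_image:
  assumes g: "g \<in> F_set n" and z: "z \<in> image_support u v" and uv: "u \<in> {0..1}" "v \<in> {0..1}"
  shows "\<theta> g z \<in> image_support (g u) (g v)"
proof -
  have "\<theta> g z \<in> noncommuting (conj_map (\<theta> g) ` \<theta> ` supported n u v)"
    using noncommuting_conj[OF \<theta>_homeo[OF g] image_supported_F_set] z unfolding image_support_def by blast
  moreover have "conj_map (\<theta> g) ` \<theta> ` supported n u v \<subseteq> \<theta> ` supported n (g u) (g v)"
  proof (rule subsetI, elim imageE, hypsubst)
    fix a assume a: "a \<in> supported n u v"
    show "conj_map (\<theta> g) (\<theta> a) \<in> \<theta> ` supported n (g u) (g v)"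
      using \<theta>_conj_map[OF g supported_F_set[OF a]] conj_map_supported[OF n g a uv] by (metis imageI)
  qed
  ultimately show ?thesis unfolding image_support_def using noncommuting_mono by blast
qed

text \<open>By minimality \<open>y\<close> lies in some \<open>image_support c d\<close>. An iterate
  \<open>p\<close> of \<open>h\<close> pushes \<open>[c,d]\<close> off itself, so the conjugates by
  \<open>p\<close> of maps supported in \<open>[c,d]\<close> have images fixing \<open>y\<close>. A
  fixed point \<open>y\<close> of \<open>\<theta> h\<close> is also fixed by
  \<open>\<theta> p\<close>, so the images of the maps themselves fix \<open>y\<close>, and none of
  them fail to commute there.\<close>

lemma \<theta>_no_fixed_point:
  assumes h: "h \<in> F_set n" "\<And>x. 0 < x \<Longrightarrow> x < 1 \<Longrightarrow> x < h x" and y: "0 < y" "y < 1"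
  shows "\<theta> h y \<noteq> y"
proof
  assume fx: "\<theta> h y = y"
  obtain z where z: "z \<in> image_support (1/3) (2/3)" using image_support_nonempty[of "1/3" "2/3"] by auto
  obtain e where e: "e > 0" "0 < z - e" "z + e < 1" "{z - e..z + e} \<subseteq> image_support (1/3) (2/3)"
    using image_support_interior(3)[OF z] by blast
  obtain h0 where h0: "h0 \<in> H" "z - e < h0 y" "h0 y < z + e"
    using minimal[OF y, of "z - e" "z + e"] e by auto
  obtain g where g: "g \<in> F_set n" "\<theta> g = h0" using \<theta>_surj[OF h0(1)] .
  define gi where "gi = inverse_map g"
  have gi: "gi \<in> F_set n" unfolding gi_def by (rule F_set_inverse[OF n g(1)])
  define c where "c = gi (1/3)"
  define d where "d = gi (2/3)"
  have cd: "0 < c" "c < d" "d < 1"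
    unfolding c_def d_def using F_setD(8)[OF gi, of 0 "1/3"] F_setD(8)[OF gi, of "1/3" "2/3"]
      F_setD(8)[OF gi, of "2/3" 1] F_setD(5,6)[OF gi] by auto
  have "h0 y \<in> image_support (1/3) (2/3)" using h0 e by auto
  then have "\<theta> gi (h0 y) \<in> image_support c d" unfolding c_def d_def by (intro image_support_image[OF gi]) auto
  then have yI: "y \<in> image_support c d"
    unfolding gi_def \<theta>_inverse[OF g(1)] g(2) using inverse_map(1)[OF H_homeo[OF h0(1)], of y] y by simp
  obtain k where k: "d < (h ^^ k) c"
    using funpow_converges_right[OF F_set_homeo[OF h(1)], of 1 c d] h(2) F_setD(6)[OF h(1)] cd by auto
  obtain p where p: "p \<in> F_set n" "\<And>x. x \<in> {0..1} \<Longrightarrow> p x = (h ^^ k) x"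
    "\<And>x. x \<in> {0..1} \<Longrightarrow> \<theta> p x = (\<theta> h ^^ k) x" using \<theta>_funpow[OF h(1)] by metis
  have "(\<theta> h ^^ k) y = y" by (induction k) (auto simp: fx)
  then have py: "\<theta> p y = y" using p(3) y by simp
  have pc: "d \<le> p c" using p(2) k cd by simp
  have fixy: "\<theta> a y = y" if a: "a \<in> supported n c d" for a
  proof -
    have aF: "a \<in> F_set n" by (rule supported_F_set[OF a])
    have "conj_map p a \<in> supported n (p c) (p d)" using conj_map_supported[OF n p(1) a] cd by auto
    then have "\<theta> (conj_map p a) y = y" using image_support_fixed[OF _ yI] pc by blast
    then have "\<theta> p (\<theta> a y) = \<theta> p y"
      using conj_map_apply(2)[OF \<theta>_homeo[OF p(1)], of y "\<theta> a"] py y \<theta>_conj_map[OF p(1) aF] by simp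
    then show ?thesis
      using F_setD(10)[OF \<theta>_F_set[OF p(1)] F_setD(7)[OF \<theta>_F_set[OF aF]], of y y] y by simp
  qed
  then show False using yI unfolding image_support_def noncommuting_def by auto
qed

text \<open>The value \<open>\<phi> x\<close> is the supremum of \<open>image_support 0 x\<close>,
  and the decomposition of \<open>h\<close> is what keeps it below 1. As \<open>f\<close> lives away
  from 0 and \<open>f'\<close> away from 1, a supremum equal to 1 would make the images of both the
  identity near 1, and with them \<open>\<theta> h\<close>, which moves every interior
  point.\<close>

lemma conjugating_homeo_oriented:
  assumes ab: "0 < a" "a < 1" "0 < b" "b < 1"
    and f: "f \<in> supported n a 1" "f' \<in> supported n 0 b" and h: "h = f \<circ>\<^sub>I f'"
    and inc: "\<And>x. 0 < x \<Longrightarrow> x < 1 \<Longrightarrow> x < h x" and \<theta>inc: "\<And>x. 0 < x \<Longrightarrow> x < 1 \<Longrightarrow> x < \<theta> h x"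
  shows "\<exists>\<phi>\<in>homeo_plus {0<..<1}. \<forall>g\<in>F_set n. \<forall>x\<in>{0<..<1}. \<phi> (g x) = \<theta> g (\<phi> x)"
proof -
  have fF: "f \<in> F_set n" "f' \<in> F_set n" using f supported_F_set by blast+
  have hF: "h \<in> F_set n" unfolding h by (rule F_set_compose[OF n fF])
  \<comment> \<open>The set \<open>image_support x 1\<close> is nonempty and mapped into itself by
    \<open>\<theta> h\<close>, whose iterates drive each of its points towards 1.\<close>
  have right_acc: "\<exists>z\<in>image_support x 1. t < z" if x: "0 < x" "x < 1" and t: "t < 1" for x t
  proof -
    obtain k where k: "x < (h ^^ k) (1/3)"
      using funpow_converges_right[OF F_set_homeo[OF hF], of 1 "1/3" x] inc F_setD(6)[OF hF] x by auto
    obtain p where p: "p \<in> F_set n" "\<And>x. x \<in> {0..1} \<Longrightarrow> p x = (h ^^ k) x" using F_set_funpow[OF n hF] by metis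
    obtain z0 where z0: "z0 \<in> image_support (1/3) (2/3)" using image_support_nonempty[of "1/3" "2/3"] by auto
    have z1: "\<theta> p z0 \<in> image_support x 1"
      using image_support_image[OF p(1) z0] image_support_mono[of x "p (1/3)" "p (2/3)" 1] p(2)[of "1/3"] k
        F_setD(7)[OF p(1), of "2/3"] by auto
    define z1 where "z1 = \<theta> p z0"
    have R: "\<theta> h z \<in> image_support x 1" if z: "z \<in> image_support x 1" for z
      using image_support_image[OF hF z] image_support_mono[of x "h x" "h 1" 1] inc[OF x] F_setD(6)[OF hF] x by auto
    have "(\<theta> h ^^ l) z1 \<in> image_support x 1" for l
      by (induction l) (use z1 R in \<open>auto simp: z1_def\<close>)
    moreover have "\<exists>l. t < (\<theta> h ^^ l) z1 \<and> (\<theta> h ^^ l) z1 < 1"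
      by (rule funpow_converges_right[OF \<theta>_homeo[OF hF]])
        (use \<theta>inc image_support_interior[OF z1] F_setD(6)[OF \<theta>_F_set[OF hF]] t in \<open>auto simp: z1_def\<close>)
    ultimately show ?thesis by blast
  qed
  have left_bdd: "\<exists>t<1. \<forall>z\<in>image_support 0 x. z \<le> t" if x: "0 < x" "x < 1" for x
  proof (rule ccontr)
    assume "\<not> ?thesis"
    then have acc: "\<exists>z\<in>image_support 0 x. t < z" if "t < 1" for t using that by (meson not_le)
    define hi where "hi = inverse_map h"
    have hi: "hi \<in> F_set n" unfolding hi_def by (rule F_set_inverse[OF n hF])
    have dec: "hi y < y" if "0 < y" "y < 1" for y
      unfolding hi_def using inverse_map_greater(2)[OF F_set_homeo[OF hF], of y] inc that by auto
    \<comment> \<open>An iterate of the inverse moves \<open>x\<close> to the left of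
      \<open>a\<close>, so accumulation at 1 passes to \<open>image_support 0 a\<close>, which
      \<open>\<theta> f\<close> fixes pointwise.\<close>
    obtain k where k: "(hi ^^ k) x < a"
      using funpow_converges_left[OF F_set_homeo[OF hi], of 0 x a] dec F_setD(5)[OF hi] x ab by auto
    obtain p where p: "p \<in> F_set n" "\<And>x. x \<in> {0..1} \<Longrightarrow> p x = (hi ^^ k) x" using F_set_funpow[OF n hi] by metis
    have acc_a: "\<exists>z\<in>image_support 0 a. t < z" if t: "t < 1" for t
    proof -
      define t0 where "t0 = max 0 t"
      have t0: "t0 \<in> {0..1}" "t0 < 1" "t \<le> t0" unfolding t0_def using t by auto
      define s where "s = inverse_map (\<theta> p) t0"
      have hp: "\<theta> p \<in> homeo_plus {0..1}" by (rule \<theta>_homeo[OF p(1)])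
      have s: "s \<in> {0..1}" "\<theta> p s = t0" unfolding s_def using inverse_map[OF hp t0(1)] by auto
      have "s < 1" using homeo_plusD(8)[OF hp s(1), of 1] homeo_plusD(6)[OF hp] s t0 by simp
      then obtain z where z: "z \<in> image_support 0 x" "s < z" using acc by blast
      have zI: "z \<in> {0..1}" using image_support_interior[OF z(1)] by auto
      have "\<theta> p z \<in> image_support 0 a"
        using image_support_image[OF p(1) z(1)] image_support_mono[of 0 "p 0" "p x" a] p(2)[of x] k x
          F_setD(5)[OF p(1)] by auto
      moreover have "t < \<theta> p z" using homeo_plusD(8)[OF hp s(1) zI] s z t0 by simp
      ultimately show ?thesis by blast
    qed
    have fix_a: "\<exists>z. t < z \<and> z < 1 \<and> \<theta> f z = z" if "t < 1" for t
      using acc_a[OF that] image_support_fixed[OF f(1)] image_support_interior(2) by blast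
    obtain e where e: "e > 0" "\<And>x. x \<in> {0..1} \<Longrightarrow> 1 - e \<le> x \<Longrightarrow> \<theta> f x = x"
      using F_set_identity_near_1[OF m \<theta>_F_set[OF fF(1)] fix_a] by blast
    have fix_b: "\<exists>z. t < z \<and> z < 1 \<and> \<theta> f' z = z" if "t < 1" for t
      using right_acc[OF ab(3,4) that] image_support_fixed[OF f(2)] image_support_interior(2) by blast
    obtain e' where e': "e' > 0" "\<And>x. x \<in> {0..1} \<Longrightarrow> 1 - e' \<le> x \<Longrightarrow> \<theta> f' x = x"
      using F_set_identity_near_1[OF m \<theta>_F_set[OF fF(2)] fix_b] by blast
    define w where "w = 1 - Min {e, e', 1} / 2"
    have w: "0 < w" "w < 1" "1 - e \<le> w" "1 - e' \<le> w" unfolding w_def using e(1) e'(1) by (auto simp: min_def)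
    then have "\<theta> h w = w" unfolding h using \<theta>_compose_apply[OF fF, of w] e(2)[of w] e'(2)[of w] by simp
    then show False using \<theta>inc[OF w(1,2)] by simp
  qed
  define \<phi> where "\<phi> = (\<lambda>x\<in>{0<..<1}. Sup (image_support 0 x))"
  have ne: "image_support 0 x \<noteq> {}" if "0 < x" "x < 1" for x using image_support_nonempty[of 0 x] that by auto
  have bdd: "bdd_above (image_support 0 x)" for x using image_support_interior(2) by (meson bdd_aboveI less_imp_le)
  have \<phi>01: "0 < \<phi> x" "\<phi> x < 1" if x: "0 < x" "x < 1" for x
  proof -
    have e: "\<phi> x = Sup (image_support 0 x)" using x by (simp add: \<phi>_def)
    obtain z where z: "z \<in> image_support 0 x" using ne[OF x] by blast
    show "0 < \<phi> x" using cSup_upper[OF z bdd] image_support_interior(1)[OF z] unfolding e by linarith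
    obtain t where "t < 1" "\<forall>z\<in>image_support 0 x. z \<le> t" using left_bdd[OF x] by blast
    then show "\<phi> x < 1" unfolding e using cSup_least[OF ne[OF x], of t] by force
  qed
  have \<phi>mono: "\<phi> x \<le> \<phi> y" if "0 < x" "x \<le> y" "y < 1" for x y
    using that cSup_subset_mono[OF ne[of x] bdd image_support_mono[of 0 0 x y]] by (simp add: \<phi>_def)
  have g01: "0 < g x" "g x < 1" if "g \<in> F_set n" "0 < x" "x < 1" for g x
    using F_setD(8)[OF that(1), of 0 x] F_setD(8)[OF that(1), of x 1] F_setD(5,6)[OF that(1)] that by auto
  have le: "\<phi> (g x) \<le> \<theta> g (\<phi> x)" if g: "g \<in> F_set n" and x: "0 < x" "x < 1" for g x
  proof -
    define gi where "gi = inverse_map g"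
    have gi: "gi \<in> F_set n" unfolding gi_def by (rule F_set_inverse[OF n g])
    have "Sup (image_support 0 (g x)) \<le> \<theta> g (\<phi> x)"
    proof (rule cSup_least[OF ne[OF g01[OF g x]]])
      fix z assume z: "z \<in> image_support 0 (g x)"
      have zI: "z \<in> {0..1}" using image_support_interior[OF z] by auto
      have "\<theta> gi z \<in> image_support (gi 0) (gi (g x))" using image_support_image[OF gi z] g01[OF g x] by simp
      then have "\<theta> gi z \<in> image_support 0 x"
        using F_setD(5)[OF gi] inverse_map(1)[OF F_set_homeo[OF g], of x] x unfolding gi_def by simp
      then have "\<theta> gi z \<le> \<phi> x" using cSup_upper[OF _ bdd] x by (simp add: \<phi>_def)
      then have "\<theta> g (\<theta> gi z) \<le> \<theta> g (\<phi> x)"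
        using F_setD(9)[OF \<theta>_F_set[OF g] F_setD(7)[OF \<theta>_F_set[OF gi] zI], of "\<phi> x"] \<phi>01[OF x] by simp
      then show "z \<le> \<theta> g (\<phi> x)"
        using \<theta>_inverse[OF g] inverse_map(2)[OF \<theta>_homeo[OF g] zI] unfolding gi_def by simp
    qed
    then show ?thesis using g01[OF g x] by (simp add: \<phi>_def)
  qed
  have equi: "\<phi> (g x) = \<theta> g (\<phi> x)" if g: "g \<in> F_set n" and x: "0 < x" "x < 1" for g x
  proof (rule antisym[OF le[OF that]])
    define gi where "gi = inverse_map g"
    have gi: "gi \<in> F_set n" unfolding gi_def by (rule F_set_inverse[OF n g])
    have gx: "0 < g x" "g x < 1" using g01[OF g x] by auto
    have pI: "\<phi> (g x) \<in> {0..1}" using \<phi>01[OF gx] by auto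
    have "\<phi> x \<le> \<theta> gi (\<phi> (g x))"
      using le[OF gi gx] inverse_map(1)[OF F_set_homeo[OF g], of x] x unfolding gi_def by simp
    then have "\<theta> g (\<phi> x) \<le> \<theta> g (\<theta> gi (\<phi> (g x)))"
      using F_setD(9)[OF \<theta>_F_set[OF g] _ F_setD(7)[OF \<theta>_F_set[OF gi] pI], of "\<phi> x"] \<phi>01[OF x] by simp
    also have "\<dots> = \<phi> (g x)"
      using \<theta>_inverse[OF g] inverse_map(2)[OF \<theta>_homeo[OF g] pI] unfolding gi_def by simp
    finally show "\<theta> g (\<phi> x) \<le> \<phi> (g x)" .
  qed
  \<comment> \<open>By equivariance the \<open>H\<close>-orbit of one value of \<open>\<phi>\<close>
    consists of values of \<open>\<phi>\<close>, so minimality gives density.\<close>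
  have dense: "\<exists>x. 0 < x \<and> x < 1 \<and> c < \<phi> x \<and> \<phi> x < d" if cd: "0 \<le> c" "c < d" "d \<le> 1" for c d
  proof -
    obtain h0 where h0: "h0 \<in> H" "c < h0 (\<phi> (1/2))" "h0 (\<phi> (1/2)) < d"
      using minimal[OF \<phi>01[of "1/2"] cd] by auto
    obtain g where g: "g \<in> F_set n" "\<theta> g = h0" using \<theta>_surj[OF h0(1)] .
    show ?thesis using equi[OF g(1), of "1/2"] g01[OF g(1), of "1/2"] g h0 by (intro exI[of _ "g (1/2)"]) auto
  qed
  have strict: "\<phi> x < \<phi> y" if xy: "0 < x" "x < y" "y < 1" for x y
  proof (rule ccontr)
    assume "\<not> ?thesis"
    then have e: "\<phi> x = \<phi> y" using \<phi>mono[of x y] xy by simp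
    \<comment> \<open>Any \<open>[s,t]\<close> can be squeezed into \<open>(x,y)\<close>, so
      equivariance spreads constancy from one interval to all of (0,1), against density.\<close>
    have const: "\<phi> s = \<phi> t" if st: "0 < s" "s \<le> t" "t < 1" for s t
    proof -
      obtain g where g: "g \<in> F_set n" "x < g s" "g t < y"
        using F_set_compress[OF n st(1,3), of x y] xy st by auto
      have gst: "g s \<le> g t" using F_setD(9)[OF g(1), of s t] st by auto
      have "\<phi> (g s) = \<phi> (g t)"
        using \<phi>mono[of x "g s"] \<phi>mono[of "g s" "g t"] \<phi>mono[of "g t" y] xy g gst e by auto
      then have "\<theta> g (\<phi> s) = \<theta> g (\<phi> t)" using equi[OF g(1)] st by simp
      then show ?thesis
        using F_setD(10)[OF \<theta>_F_set[OF g(1)], of "\<phi> s" "\<phi> t"] \<phi>01[of s] \<phi>01[of t] st by auto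
    qed
    have c: "\<phi> s = \<phi> (1/2)" if "0 < s" "s < 1" for s
      using const[of s "1/2"] const[of "1/2" s] that by (cases "s \<le> 1/2") auto
    obtain s where "0 < s" "s < 1" "0 < \<phi> s" "\<phi> s < \<phi> (1/2)"
      using dense[of 0 "\<phi> (1/2)"] \<phi>01[of "1/2"] by auto
    then show False using c[of s] by simp
  qed
  \<comment> \<open>A value omitted by the increasing \<open>\<phi>\<close> would create a jump at
    \<open>x0\<close>, and density leaves no room for one.\<close>
  have surj: "\<exists>x. 0 < x \<and> x < 1 \<and> \<phi> x = y" if y: "0 < y" "y < 1" for y
  proof -
    define X where "X = {x. 0 < x \<and> x < 1 \<and> \<phi> x < y}"
    obtain x1 where x1: "x1 \<in> X" using dense[of 0 y] y unfolding X_def by auto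
    obtain x2 where x2: "0 < x2" "x2 < 1" "y < \<phi> x2" using dense[of y 1] y by auto
    have ub: "x \<le> x2" if "x \<in> X" for x
      using strict[of x2 x] that x2 unfolding X_def by force
    have bX: "bdd_above X" using ub by (rule bdd_aboveI)
    define x0 where "x0 = Sup X"
    have x0: "0 < x0" "x0 < 1"
      using cSup_upper[OF x1 bX] cSup_least[of X x2] ub x1 x2 unfolding x0_def X_def by force+
    have "\<not> \<phi> x0 < y"
    proof
      assume "\<phi> x0 < y"
      then obtain x where x: "0 < x" "x < 1" "\<phi> x0 < \<phi> x" "\<phi> x < y"
        using dense[of "\<phi> x0" y] \<phi>01[OF x0] y by auto
      then have "x \<le> x0" unfolding x0_def by (intro cSup_upper[OF _ bX]) (simp add: X_def)
      then show False using \<phi>mono[of x x0] x x0 by simp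
    qed
    moreover have "\<not> y < \<phi> x0"
    proof
      assume "y < \<phi> x0"
      then obtain x where x: "0 < x" "x < 1" "y < \<phi> x" "\<phi> x < \<phi> x0"
        using dense[of y "\<phi> x0"] \<phi>01[OF x0] y by auto
      then have "x < x0" using \<phi>mono[of x0 x] x0 by (meson not_le)
      then obtain x3 where "x3 \<in> X" "x < x3" unfolding x0_def using less_cSupD[of X x] x1 by blast
      then show False using strict[of x x3] x unfolding X_def by auto
    qed
    ultimately show ?thesis using x0 by (intro exI[of _ x0]) auto
  qed
  have "\<phi> \<in> homeo_plus {0<..<1}"
  proof (rule homeo_plus_openI)
    show "strict_mono_on {0<..<1} \<phi>" by (rule strict_mono_onI) (use strict in auto)
    show "\<phi> ` {0<..<1} = {0<..<1}"
    proof (intro equalityI subsetI)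
      fix y assume "y \<in> \<phi> ` {0<..<1}"
      then show "y \<in> {0<..<1}" using \<phi>01 by force
    next
      fix y :: real assume "y \<in> {0<..<1}"
      then obtain x where "0 < x" "x < 1" "\<phi> x = y" using surj by force
      then show "y \<in> \<phi> ` {0<..<1}" by force
    qed
  qed (simp add: \<phi>_def)
  then show ?thesis using equi by (metis greaterThanLessThan_iff)
qed

end

lemma F_embedding_flip:
  assumes "F_embedding n m H \<theta>"
  shows "F_embedding n m H (\<theta> \<circ> flip)"
proof -
  interpret F_embedding n m H \<theta> by fact
  have "bij_betw flip (F_set n) (F_set n)"
    by (rule bij_betw_byWitness[of _ flip]) (auto simp: flip_flip flip_F_set[OF n])
  then have "bij_betw (\<theta> \<circ> flip) (F_set n) H" using \<theta>_bij by (rule bij_betw_trans)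
  moreover have "(\<theta> \<circ> flip) (f \<circ>\<^sub>I g) = (\<theta> \<circ> flip) f \<circ>\<^sub>I (\<theta> \<circ> flip) g"
    if "f \<in> F_set n" "g \<in> F_set n" for f g
    using that by (simp add: flip_compose \<theta>_compose flip_F_set[OF n])
  ultimately show ?thesis
    by (intro F_embedding.intro n m H_subset H_id H_compose H_inverse H_maximal)
qed

text \<open>Two overlapping inverse bumps give an \<open>h\<close> that moves all of (0,1) to the
  right. Its image has no fixed point in (0,1), so by connectedness it moves all points in one
  direction; if that is to the left, \<open>\<theta>\<^sub>0\<close> is composed with
  \<open>flip\<close>.\<close>

lemma conjugating_homeo:
  assumes "F_embedding n m H \<theta>\<^sub>0"
  shows "\<exists>\<theta> \<phi>. F_embedding n m H \<theta> \<and> \<phi> \<in> homeo_plus {0<..<1} \<and>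
    (\<forall>g\<in>F_set n. \<forall>x\<in>{0<..<1}. \<phi> (g x) = \<theta> g (\<phi> x))"
proof -
  interpret F_embedding n m H \<theta>\<^sub>0 by fact
  obtain a b where ab: "a \<in> adic_rationals n" "b \<in> adic_rationals n" "0 < a" "a < b" "b < 1"
  proof -
    obtain b where b: "b \<in> adic_rationals n" "0 < b" "b < 1" using adic_rationals_dense[OF n, of 0 1] by auto
    obtain a where "a \<in> adic_rationals n" "0 < a" "a < b" using adic_rationals_dense[OF n b(2)] .
    then show thesis using that b by blast
  qed
  define c where "c = bump n a 1"
  define c' where "c' = bump n 0 b"
  have cs: "c \<in> supported n a 1" "inverse_map c \<in> supported n a 1" "c' \<in> supported n 0 b" "inverse_map c' \<in> supported n 0 b"
    unfolding c_def c'_def using ab by (simp_all add: bump_supported[OF n])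
  have cF: "c \<in> F_set n" "c' \<in> F_set n" using supported_F_set[OF cs(1)] supported_F_set[OF cs(3)] by auto
  define f where "f = inverse_map c"
  define f' where "f' = inverse_map c'"
  have fF: "f \<in> F_set n" "f' \<in> F_set n" unfolding f_def f'_def using cF by (auto intro: F_set_inverse[OF n])
  define h where "h = f \<circ>\<^sub>I f'"
  have hF: "h \<in> F_set n" unfolding h_def by (rule F_set_compose[OF n fF])
  have f1: "x < f x" if "a < x" "x < 1" for x
    using inverse_map_greater(1)[OF F_set_homeo[OF cF(1)], of x] bump_less[OF n, of x a 1] that ab(3)
    by (simp add: c_def f_def)
  have f1': "x < f' x" if "0 < x" "x < b" for x
    using inverse_map_greater(1)[OF F_set_homeo[OF cF(2)], of x] bump_less[OF n, of x 0 b] that ab(5)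
    by (simp add: c'_def f'_def)
  have f2: "x \<le> f x" if "x \<in> {0..1}" for x
  proof (cases "a < x \<and> x < 1")
    case True
    then show ?thesis using f1[of x] by simp
  next
    case False
    then have "f x = x" using cs(2) that unfolding f_def supported_def by auto
    then show ?thesis by simp
  qed
  have inc: "x < h x" if x: "0 < x" "x < 1" for x
  proof (cases "x < b")
    case True
    then have "x < f' x" using f1' x by simp
    also have "\<dots> \<le> f (f' x)" using f2 F_setD(7)[OF fF(2), of x] x by auto
    finally show ?thesis unfolding h_def using x by (simp add: compose_def)
  next
    case False
    then have "f' x = x" using cs(4) x unfolding f'_def supported_def by auto
    then show ?thesis unfolding h_def using f1[of x] False ab x by (simp add: compose_def)
  qed
  have hI: "\<theta>\<^sub>0 h \<in> F_set m" by (rule \<theta>_F_set[OF hF])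
  have nofix: "\<theta>\<^sub>0 h x \<noteq> x" if "0 < x" "x < 1" for x using \<theta>_no_fixed_point[OF hF inc that] .
  have cont: "continuous_on {0<..<1} (\<lambda>x. \<theta>\<^sub>0 h x - x)"
    by (intro continuous_on_diff continuous_on_id continuous_on_subset[OF F_setD(3)[OF hI]]) auto
  consider "\<And>x. 0 < x \<Longrightarrow> x < 1 \<Longrightarrow> x < \<theta>\<^sub>0 h x" | "\<And>x. 0 < x \<Longrightarrow> x < 1 \<Longrightarrow> \<theta>\<^sub>0 h x < x"
  proof -
    have "connected ((\<lambda>x. \<theta>\<^sub>0 h x - x) ` {0<..<1})" by (rule connected_continuous_image[OF cont]) simp
    then have "is_interval ((\<lambda>x. \<theta>\<^sub>0 h x - x) ` {0<..<1})" by (simp add: is_interval_connected_1)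
    moreover have "0 \<notin> (\<lambda>x. \<theta>\<^sub>0 h x - x) ` {0<..<1}" using nofix by auto
    ultimately have sgn: "\<not> (u \<le> 0 \<and> 0 \<le> v)"
      if "u \<in> (\<lambda>x. \<theta>\<^sub>0 h x - x) ` {0<..<1}" "v \<in> (\<lambda>x. \<theta>\<^sub>0 h x - x) ` {0<..<1}" for u v
      using that unfolding is_interval_1 by blast
    show thesis
    proof (cases "1/2 < \<theta>\<^sub>0 h (1/2)")
      case True
      have "x < \<theta>\<^sub>0 h x" if "0 < x" "x < 1" for x
        using sgn[of "\<theta>\<^sub>0 h x - x" "\<theta>\<^sub>0 h (1/2) - 1/2"] True that by force
      then show thesis using that(1) by blast
    next
      case False
      have "\<theta>\<^sub>0 h x < x" if "0 < x" "x < 1" for x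
        using sgn[of "\<theta>\<^sub>0 h (1/2) - 1/2" "\<theta>\<^sub>0 h x - x"] False that by force
      then show thesis using that(2) by blast
    qed
  qed
  then show ?thesis
  proof cases
    case 1
    obtain \<phi> where "\<phi> \<in> homeo_plus {0<..<1}" "\<forall>g\<in>F_set n. \<forall>x\<in>{0<..<1}. \<phi> (g x) = \<theta>\<^sub>0 g (\<phi> x)"
      using conjugating_homeo_oriented[of a b f f' h] ab cs inc 1 unfolding f_def f'_def h_def by auto
    then show ?thesis using assms by blast
  next
    case 2
    interpret fl: F_embedding n m H "\<theta>\<^sub>0 \<circ> flip" by (rule F_embedding_flip[OF assms])
    have s: "flip c' \<in> supported n (1 - b) 1" "flip c \<in> supported n 0 (1 - a)"
      using flip_supported[OF n cs(3)] flip_supported[OF n cs(1)] by auto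
    \<comment> \<open>Reflection exchanges the two kinds of support, so these factors fit the
      oriented case again. The product is the reflected inverse of \<open>h\<close>; the reflected
      embedding sends it to the inverse of \<open>\<theta>\<^sub>0 h\<close>, which moves points to
      the right.\<close>
    define h' where "h' = flip c' \<circ>\<^sub>I flip c"
    have h'eq: "h' = flip (inverse_map h)"
    proof -
      have "inverse_map h = c' \<circ>\<^sub>I c"
      proof (rule F_set_eqI[OF F_set_inverse[OF n hF] F_set_compose[OF n cF(2,1)]])
        fix x :: real assume x: "x \<in> {0..1}"
        have cx: "c x \<in> {0..1}" using F_setD(7)[OF cF(1) x] .
        have "h (c' (c x)) = x"
          unfolding h_def f_def f'_def
          using F_setD(7)[OF cF(2) cx] inverse_map(1)[OF F_set_homeo[OF cF(2)] cx] inverse_map(1)[OF F_set_homeo[OF cF(1)] x]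
          by (simp add: compose_def)
        then have "inverse_map h x = c' (c x)"
          using homeo_plus_eq_inverse_map_iff[OF F_set_homeo[OF hF] F_setD(7)[OF cF(2) cx] x] by simp
        then show "inverse_map h x = (c' \<circ>\<^sub>I c) x" using x by (simp add: compose_def)
      qed
      then show ?thesis unfolding h'_def using flip_compose[OF cF(1)] by simp
    qed
    have hiF: "inverse_map h \<in> F_set n" by (rule F_set_inverse[OF n hF])
    have inc': "x < h' x" if "0 < x" "x < 1" for x
      unfolding h'eq using that inc[of "1 - x"] inverse_map_greater(2)[OF F_set_homeo[OF hF], of "1 - x"]
      by (simp add: flip_apply)
    have \<theta>inc': "x < (\<theta>\<^sub>0 \<circ> flip) h' x" if "0 < x" "x < 1" for x
      using that 2[of x] inverse_map_greater(1)[OF F_set_homeo[OF hI], of x]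
      by (simp add: h'eq flip_flip[OF hiF] \<theta>_inverse[OF hF])
    obtain \<phi> where "\<phi> \<in> homeo_plus {0<..<1}" "\<forall>g\<in>F_set n. \<forall>x\<in>{0<..<1}. \<phi> (g x) = (\<theta>\<^sub>0 \<circ> flip) g (\<phi> x)"
      using fl.conjugating_homeo_oriented[of "1 - b" "1 - a" "flip c'" "flip c" h'] ab s inc' \<theta>inc'
      unfolding h'_def by auto
    then show ?thesis using fl.F_embedding_axioms by blast
  qed
qed

section \<open>Standard intervals under words in finitely many generators\<close>

definition word_map :: "(real \<Rightarrow> real) list \<Rightarrow> real \<Rightarrow> real" where
  "word_map ss = foldr (\<circ>) ss id"

lemma word_map_simps [simp]:
  "word_map [] x = x" "word_map (s # ss) x = s (word_map ss x)"
  by (simp_all add: word_map_def)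

lemma word_map_snoc: "word_map (ss @ [s]) x = word_map ss (s x)"
  by (induction ss) auto

text \<open>Each bump extends to an end point of \<open>[0,1]\<close>, so at grid points not too
  close to that end the expanding zone of the bump or of its inverse is long. The exponent 4 comes
  from the requirement \<open>2 / n ^ 4 \<le> 1 / (4 * n)\<close>, which holds for
  \<open>n \<ge> 2\<close>.\<close>

definition grid_bumps :: "nat \<Rightarrow> (real \<Rightarrow> real) set" where
  "grid_bumps n =
     (\<lambda>j. bump n 0 (real j / real n ^ 4)) ` {1..n ^ 4} \<union> (\<lambda>j. bump n (real j / real n ^ 4) 1) ` {..<n ^ 4}"

definition grid_generators :: "nat \<Rightarrow> (real \<Rightarrow> real) set" where
  "grid_generators n = grid_bumps n \<union> inverse_map ` grid_bumps n"

lemma finite_grid_generators: "finite (grid_generators n)"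
  unfolding grid_generators_def grid_bumps_def by simp

lemma grid_adic: "real j / real n ^ 4 \<in> adic_rationals n"
  unfolding adic_rationals_def by (rule CollectI, rule exI[of _ "int j"], rule exI[of _ 4]) simp

lemma grid_bumps_F_set:
  assumes n: "n \<ge> 2" shows "grid_bumps n \<subseteq> F_set n"
proof -
  have n4: "real n ^ 4 > 0" using n by simp
  have le: "real j / real n ^ 4 \<le> 1 \<longleftrightarrow> j \<le> n ^ 4" for j
  proof -
    have "real j / real n ^ 4 \<le> 1 \<longleftrightarrow> real j \<le> real (n ^ 4)" using n4 by (simp add: divide_le_eq)
    then show ?thesis by (simp only: of_nat_le_iff)
  qed
  have less: "real j / real n ^ 4 < 1 \<longleftrightarrow> j < n ^ 4" for j
  proof -
    have "real j / real n ^ 4 < 1 \<longleftrightarrow> real j < real (n ^ 4)" using n4 by (simp add: divide_less_eq)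
    then show ?thesis by (simp only: of_nat_less_iff)
  qed
  show ?thesis
    unfolding grid_bumps_def using n4
    by (auto intro!: bump_in_F_set[OF n] grid_adic simp: le less)
qed

lemma grid_generators_F_set:
  assumes n: "n \<ge> 2" shows "grid_generators n \<subseteq> F_set n"
  unfolding grid_generators_def using grid_bumps_F_set[OF n] F_set_inverse[OF n] by blast

lemma inverse_map_inverse_map:
  assumes "f \<in> homeo_plus {0..1}"
  shows "inverse_map (inverse_map f) = f"
proof (rule extensionalityI[of _ "{0..1}"])
  show "inverse_map (inverse_map f) \<in> extensional {0..1}" "f \<in> extensional {0..1}"
    using homeo_plusD(1)[OF assms] by (auto simp: inverse_map_def)
  fix x :: real assume x: "x \<in> {0..1}"
  show "inverse_map (inverse_map f) x = f x"
    using homeo_plus_eq_inverse_map_iff[OF inverse_map_homeo[OF assms] homeo_plusD(7)[OF assms x] x]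
      inverse_map(1)[OF assms x] by simp
qed

lemma grid_generators_inverse:
  assumes n: "n \<ge> 2" and s: "s \<in> grid_generators n"
  shows "inverse_map s \<in> grid_generators n"
  using s inverse_map_inverse_map[OF F_set_homeo] grid_bumps_F_set[OF n]
  unfolding grid_generators_def by force

text \<open>If \<open>y\<close> is in the right half, a bump on \<open>[0,q]\<close> expands to the
  left of a grid point \<open>q\<close> just above \<open>y\<close>; otherwise the inverse of a bump
  on \<open>[p,1]\<close> expands to the right of a grid point \<open>p\<close> just below
  \<open>x\<close>. Splitting at 1/2 makes these zones at least \<open>1 / (4 * n)\<close> long,
  while the interval and its grid point span at most \<open>2 / n ^ 4\<close>.\<close>

lemma grid_generators_expand:
  assumes n: "n \<ge> 2" and xy: "0 \<le> x" "x < y" "y \<le> 1" "y - x \<le> 1 / real n ^ 4"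
  obtains s where "s \<in> grid_generators n" "s y - s x = real n * (y - x)"
proof -
  define N where "N = real n"
  have N: "N \<ge> 2" unfolding N_def using n by simp
  have "2 ^ 3 \<le> N ^ 3" using N by (intro power_mono) auto
  then have N3: "8 \<le> N ^ 3" by simp
  have N4: "N ^ 4 > 0" "N ^ 4 = N ^ 3 * N" using N by (simp_all add: power_eq_if numeral_eq_Suc)
  have "8 * N \<le> N ^ 4" unfolding N4(2) using N3 N by (intro mult_right_mono) auto
  then have b1: "2 / N ^ 4 \<le> 1 / (4 * N)" using N N4(1) by (simp add: field_simps)
  then have b2: "N * (2 / N ^ 4) \<le> 1 / 4" using mult_left_mono[OF b1, of N] N by simp
  have hN: "1 / 2 \<le> 1 - 1 / N" "1 - 1 / N \<le> 1" using N by (simp_all add: field_simps)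
  show thesis
  proof (cases "1 / 2 \<le> y")
    case True
    define j where "j = nat \<lceil>y * N ^ 4\<rceil>"
    define q where "q = real j / N ^ 4"
    have yN: "0 < y * N ^ 4" using True N4 by simp
    have j: "real j \<ge> y * N ^ 4" "real j < y * N ^ 4 + 1"
      unfolding j_def using yN by (simp_all add: of_nat_nat ceiling_le_iff le_of_int_ceiling) linarith
    have "y * N ^ 4 \<le> 1 * N ^ 4" using xy N4(1) by (intro mult_right_mono) auto
    then have "y * N ^ 4 \<le> real (n ^ 4)" unfolding N_def by simp
    then have "\<lceil>y * N ^ 4\<rceil> \<le> int (n ^ 4)" by (simp add: ceiling_le_iff)
    then have jn: "j \<le> n ^ 4" unfolding j_def by linarith
    have j1: "1 \<le> j" using j(1) yN by linarith
    have q: "y \<le> q" "q \<le> y + 1 / N ^ 4" unfolding q_def using j N4(1) by (simp_all add: field_simps)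
    have q1: "q \<le> 1" unfolding q_def N_def using jn n by (simp add: field_simps flip: of_nat_power)
    have "1 / (4 * N) \<le> q * (1 - 1 / N) / N"
    proof -
      have "1 / 4 \<le> q * (1 - 1 / N)" using mult_mono[of "1/2" q "1/2" "1 - 1/N"] q True hN by simp
      then have "1 / 4 / N \<le> q * (1 - 1 / N) / N" using N by (intro divide_right_mono) auto
      then show ?thesis by simp
    qed
    moreover have "q - x \<le> 2 / N ^ 4" using q xy(4) unfolding N_def[symmetric] by simp
    ultimately have r: "q - (q - 0) * (1 - 1 / N) / N \<le> x" using b1 by simp
    have "bump n 0 q y - bump n 0 q x = N * (y - x)"
      using bump_expand[OF n, of x 0 q] bump_expand[OF n, of y 0 q] r xy q q1 True
      unfolding N_def[symmetric] by (simp add: algebra_simps)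
    moreover have "bump n 0 q \<in> grid_generators n"
      unfolding grid_generators_def grid_bumps_def q_def N_def using jn j1 by auto
    ultimately show thesis using that unfolding N_def by blast
  next
    case False
    define j where "j = nat \<lfloor>x * N ^ 4\<rfloor>"
    define p where "p = real j / N ^ 4"
    have xN: "0 \<le> x * N ^ 4" using xy N4 by simp
    have j: "real j \<le> x * N ^ 4" "x * N ^ 4 < real j + 1"
      unfolding j_def using xN by (simp_all add: of_nat_nat)
    have "x * N ^ 4 < 1 * N ^ 4" using False xy N4 by (intro mult_strict_right_mono) auto
    then have jn: "j < n ^ 4" using j unfolding N_def by (simp flip: of_nat_power of_nat_less_iff)
    have p: "p \<le> x" "x \<le> p + 1 / N ^ 4" "0 \<le> p" unfolding p_def using j N4(1) by (simp_all add: field_simps)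
    have p2: "p \<le> 1 / 2" using p False xy by simp
    define b where "b = bump n p 1"
    have bg: "b \<in> grid_bumps n" unfolding grid_bumps_def b_def p_def N_def using jn by auto
    then have bF: "b \<in> homeo_plus {0..1}" using grid_bumps_F_set[OF n] F_set_homeo by blast
    have inv: "inverse_map b z = p + N * (z - p)" if z: "x \<le> z" "z \<le> y" for z
    proof -
      \<comment> \<open>The expected value of the inverse at \<open>z\<close>; it is confirmed by
        applying the contracting piece of \<open>b\<close> to it.\<close>
      define w where "w = p + N * (z - p)"
      have "z - p \<le> 2 / N ^ 4" using z p xy(4) unfolding N_def[symmetric] by simp
      then have "N * (z - p) \<le> N * (2 / N ^ 4)" using N by (intro mult_left_mono) auto
      then have w4: "N * (z - p) \<le> 1 / 4" using b2 by simp
      have "1 / 4 \<le> (1 - p) * (1 - 1 / N)" using mult_mono[of "1/2" "1 - p" "1/2" "1 - 1/N"] p2 hN by simp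
      then have "N * (z - p) \<le> (1 - p) * (1 - 1 / N)" using w4 by (rule order_trans[rotated])
      moreover have "0 \<le> N * (z - p)" using z p N by (intro mult_nonneg_nonneg) auto
      ultimately have w: "p \<le> w" "w \<le> p + (1 - p) * (1 - 1 / N)" unfolding w_def by simp_all
      have wI: "w \<in> {0..1}" using w4 p p2 w(1) unfolding w_def by auto
      have "b w = p + (w - p) / N" unfolding b_def N_def using w wI unfolding N_def
        by (intro bump_contract[OF n]) auto
      also have "\<dots> = z" unfolding w_def using N by simp
      finally show ?thesis using inverse_map(1)[OF bF wI] unfolding w_def by simp
    qed
    have "inverse_map b y - inverse_map b x = N * (y - x)" using inv[of x] inv[of y] xy by (simp add: algebra_simps)
    moreover have "inverse_map b \<in> grid_generators n" using bg unfolding grid_generators_def by auto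
    ultimately show thesis using that unfolding N_def by blast
  qed
qed

text \<open>Generators expand \<open>(c,d)\<close> until it is longer than the grid step. Then some
  grid point \<open>p\<close> with \<open>c \<le> p < d\<close> exists, and a bump on
  \<open>[p,1]\<close> attracts points of \<open>Y\<close> to it from the right. Since
  \<open>Y\<close> is invariant under the generators and their inverses, such a point can be pulled
  back along the expansions.\<close>

lemma grid_generators_backward_orbit_dense:
  assumes n: "n \<ge> 2" and \<beta>: "0 < \<beta>" "\<beta> < 1" and cd: "0 \<le> c" "c < d" "d \<le> 1"
  shows "\<exists>t ss. c < t \<and> t < d \<and> set ss \<subseteq> grid_generators n \<and> word_map ss t = \<beta>"
proof -
  define Y where "Y = {t \<in> {0..1}. \<exists>ss. set ss \<subseteq> grid_generators n \<and> word_map ss t = \<beta>}"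
  have \<beta>Y: "\<beta> \<in> Y" unfolding Y_def using \<beta> by (auto intro: exI[of _ "[]"])
  have pull: "t \<in> Y" if s: "s \<in> grid_generators n" and t: "t \<in> {0..1}" "s t \<in> Y" for s t
  proof -
    obtain ss where ss: "set ss \<subseteq> grid_generators n" "word_map ss (s t) = \<beta>" using t unfolding Y_def by blast
    then have "set (ss @ [s]) \<subseteq> grid_generators n" "word_map (ss @ [s]) t = \<beta>"
      using s by (simp_all add: word_map_snoc)
    then show ?thesis unfolding Y_def using t by blast
  qed
  have YI: "t \<in> {0..1}" if "t \<in> Y" for t using that unfolding Y_def by simp
  have sH: "s \<in> homeo_plus {0..1}" if "s \<in> grid_generators n" for s
    using grid_generators_F_set[OF n] that F_set_homeo by blast
  have forw: "s t \<in> Y" if s: "s \<in> grid_generators n" and t: "t \<in> Y" for s t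
    using pull[OF grid_generators_inverse[OF n s] homeo_plusD(7)[OF sH[OF s] YI[OF t]]]
      inverse_map(1)[OF sH[OF s] YI[OF t]] t by simp
  have forwk: "(s ^^ k) t \<in> Y" if "s \<in> grid_generators n" "t \<in> Y" for s t k
    by (induction k) (use that forw in auto)
  have n4: "real n ^ 4 > 0" "n ^ 4 > 0" using n by simp_all
  have acc: "\<exists>t\<in>Y. p < t \<and> t < 1" if "p < 1" for p
  proof -
    define b where "b = bump n 0 1"
    have bg: "b \<in> grid_bumps n" unfolding grid_bumps_def b_def using n4
      by (intro UnI2 rev_image_eqI[of 0]) auto
    then have b: "inverse_map b \<in> grid_generators n" "b \<in> homeo_plus {0..1}"
      using grid_bumps_F_set[OF n] F_set_homeo unfolding grid_generators_def by blast+
    have "t < inverse_map b t" if "0 < t" "t < 1" for t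
      using inverse_map_greater(1)[OF b(2), of t] bump_less[OF n, of t 0 1] that unfolding b_def by auto
    then have "\<exists>k. p < (inverse_map b ^^ k) \<beta> \<and> (inverse_map b ^^ k) \<beta> < 1"
      using homeo_plusD(6)[OF sH[OF b(1)]] \<beta> that by (intro funpow_converges_right[OF sH[OF b(1)]]) auto
    then show ?thesis using forwk[OF b(1) \<beta>Y] by blast
  qed
  have grid: "\<exists>t\<in>Y. c < t \<and> t < d" if j: "c \<le> real j / real n ^ 4" "real j / real n ^ 4 < d" "d \<le> 1" for c d j
  proof -
    define p where "p = real j / real n ^ 4"
    have "0 \<le> p" "c \<le> p" "p < d" using j by (simp_all add: p_def)
    then have p: "0 \<le> p" "p < 1" "c \<le> p" "p < d" using j(3) by auto
    have "real j < real n ^ 4" using p(2) n4 unfolding p_def by (simp add: field_simps)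
    then have "real j < real (n ^ 4)" by simp
    then have jn: "j < n ^ 4" by (simp only: of_nat_less_iff)
    define b where "b = bump n p 1"
    have b: "b \<in> grid_generators n" unfolding grid_generators_def grid_bumps_def b_def p_def using jn by auto
    obtain t where t: "t \<in> Y" "p < t" "t < 1" using acc[OF p(2)] by blast
    have "\<exists>k. p < (b ^^ k) t \<and> (b ^^ k) t < d"
    proof (rule funpow_converges_left[OF sH[OF b]])
      show "b p = p" unfolding b_def using bump_outside[OF n, of p 1 p] p by simp
      show "b y < y" if "p < y" "y \<le> t" for y unfolding b_def using bump_less[OF n, of y p 1] that t p by simp
    qed (use p t in auto)
    then show ?thesis using forwk[OF b t(1)] p(3) by (meson le_less_trans)
  qed
  have long: "\<exists>t\<in>Y. c < t \<and> t < d" if cd: "0 \<le> c" "d \<le> 1" "1 / real n ^ 4 < d - c" for c d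
  proof -
    define j where "j = nat \<lceil>c * real n ^ 4\<rceil>"
    have cN: "0 \<le> c * real n ^ 4" using cd by simp
    have j: "real j \<ge> c * real n ^ 4" "real j < c * real n ^ 4 + 1"
      unfolding j_def using cN by (simp_all add: of_nat_nat ceiling_le_iff le_of_int_ceiling) linarith
    have "1 < (d - c) * real n ^ 4" using cd(3) n4 by (simp add: field_simps)
    then have "real j < d * real n ^ 4" using j(2) by (simp add: algebra_simps)
    then show ?thesis using j(1) n4 cd by (intro grid[of c j d]) (simp_all add: field_simps)
  qed
  have main: "\<exists>t\<in>Y. c < t \<and> t < d" if "0 \<le> c" "c < d" "d \<le> 1" "real n ^ k * (d - c) > 1 / real n ^ 4" for k c d
    using that
  proof (induction k arbitrary: c d)
    case 0
    then show ?case using long by simp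
  next
    case (Suc k)
    show ?case
    proof (cases "d - c > 1 / real n ^ 4")
      case True
      then show ?thesis using long Suc.prems by simp
    next
      case False
      then obtain s where s: "s \<in> grid_generators n" "s d - s c = real n * (d - c)"
        using grid_generators_expand[OF n, of c d] Suc.prems by auto
      have sI: "s c \<in> {0..1}" "s d \<in> {0..1}" "s c < s d"
        using homeo_plusD(7,8)[OF sH[OF s(1)]] Suc.prems by auto
      have "real n ^ k * (s d - s c) > 1 / real n ^ 4" using Suc.prems(4) unfolding s(2) by (simp add: mult_ac)
      then obtain t where t: "t \<in> Y" "s c < t" "t < s d" using Suc.IH[of "s c" "s d"] sI by auto
      define u where "u = inverse_map s t"
      have u: "u \<in> {0..1}" "s u = t" unfolding u_def using inverse_map[OF sH[OF s(1)] YI[OF t(1)]] by auto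
      have "c < u" "u < d" using homeo_plusD(8)[OF sH[OF s(1)], of c u] homeo_plusD(8)[OF sH[OF s(1)], of u d]
        u t Suc.prems by auto
      moreover have "u \<in> Y" using pull[OF s(1) u(1)] u(2) t(1) by simp
      ultimately show ?thesis by blast
    qed
  qed
  obtain k where "1 / real n ^ 4 / (d - c) < real n ^ k"
    using real_arch_pow[of "real n"] n by auto
  then have "real n ^ k * (d - c) > 1 / real n ^ 4" using cd by (subst (asm) pos_divide_less_eq) auto
  then show ?thesis using main[OF cd] unfolding Y_def by blast
qed

section \<open>Standard adic intervals and their affine images\<close>

lemma adic_rationals_common_denominator:
  assumes m: "m \<ge> 1" and X: "finite X" "X \<subseteq> adic_rationals m"
  shows "\<exists>K. \<forall>k\<ge>K. \<forall>x\<in>X. \<exists>z::int. x = of_int z / real m ^ k"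
  using X
proof (induction X rule: finite_induct)
  case (insert x X)
  then obtain K where K: "\<forall>k\<ge>K. \<forall>x\<in>X. \<exists>z::int. x = of_int z / real m ^ k" by auto
  obtain a l where x: "x = of_int a / real m ^ l" using insert.prems unfolding adic_rationals_def by auto
  have "\<exists>z::int. x = of_int z / real m ^ k" if "k \<ge> l" for k
  proof -
    have "real m ^ k = real m ^ l * real m ^ (k - l)" using that by (simp flip: power_add)
    then have "x = of_int (a * int m ^ (k - l)) / real m ^ k" using m by (simp add: x)
    then show ?thesis by blast
  qed
  then show ?case using K by (intro exI[of _ "max K l"]) auto
qed simp

text \<open>\<open>standard_linear m k a l b h\<close>: the map \<open>h\<close> sends \<open>[a/m\<^sup>k, (a+1)/m\<^sup>k]\<close> affinely onto
  \<open>[b/m\<^sup>l, (b+1)/m\<^sup>l]\<close>.\<close>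

definition standard_linear :: "nat \<Rightarrow> nat \<Rightarrow> nat \<Rightarrow> nat \<Rightarrow> nat \<Rightarrow> (real \<Rightarrow> real) \<Rightarrow> bool" where
  "standard_linear m k a l b h \<longleftrightarrow>
     (\<forall>x. real a / real m ^ k \<le> x \<and> x \<le> (real a + 1) / real m ^ k \<longrightarrow>
        h x = real b / real m ^ l + real m ^ k / real m ^ l * (x - real a / real m ^ k))"

text \<open>Beyond the depth \<open>M\<close> of all breakpoints, a standard interval lies in a
  single piece. A slope \<open>m powi s\<close> changes the depth from \<open>k\<close> to
  \<open>k - s\<close>; adding \<open>E\<close> keeps the new depth at least \<open>M\<close>, so
  that the constant of the piece is a multiple of the new step.\<close>

lemma F_set_standard_linear:
  assumes m: "m \<ge> 2" and f: "f \<in> F_set m"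
  shows "\<exists>N. \<forall>k\<ge>N. \<forall>a<m ^ k. \<exists>l b. standard_linear m k a l b f"
proof -
  obtain k0 p s c where sub: "subdivision k0 p" and pD: "\<And>j. j \<le> k0 \<Longrightarrow> p j \<in> adic_rationals m"
    and c: "\<And>j. j < k0 \<Longrightarrow> c j \<in> adic_rationals m"
    and pc: "\<And>j x. j < k0 \<Longrightarrow> x \<in> {p j..p (Suc j)} \<Longrightarrow> f x = real m powi s j * x + c j"
    using F_set_pieces[OF m f] by metis
  have p: "p 0 = 0" "p k0 = 1" "\<And>j. j < k0 \<Longrightarrow> p j < p (Suc j)" using sub by (auto simp: subdivision_def)
  have "\<exists>K. \<forall>k\<ge>K. \<forall>x\<in>p ` {..k0} \<union> c ` {..<k0}. \<exists>z::int. x = of_int z / real m ^ k"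
    by (rule adic_rationals_common_denominator) (use m pD c in auto)
  then obtain M where M: "\<And>k x. k \<ge> M \<Longrightarrow> x \<in> p ` {..k0} \<union> c ` {..<k0} \<Longrightarrow> \<exists>z::int. x = of_int z / real m ^ k"
    by blast
  define E where "E = (\<Sum>j<k0. nat \<bar>s j\<bar>)"
  have E: "nat \<bar>s j\<bar> \<le> E" if "j < k0" for j
    unfolding E_def using that by (intro member_le_sum) auto
  have m0: "real m > 0" "real m \<noteq> 0" using m by auto
  have "\<exists>l b. standard_linear m k a l b f" if k: "k \<ge> M + E" and a: "a < m ^ k" for k a
  proof -
    have mk: "real m ^ k > 0" using m0 by simp
    have "real a < real m ^ k" using a by (simp flip: of_nat_power)
    then have "real a / real m ^ k < 1" "0 \<le> real a / real m ^ k" using mk by (simp_all add: field_simps)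
    then obtain j where j: "j < k0" "p j \<le> real a / real m ^ k" "real a / real m ^ k < p (Suc j)"
      using subdivision_interval(1)[of k0 p "real a / real m ^ k"] p by auto
    obtain z :: int where z: "p (Suc j) = of_int z / real m ^ k" using M[of k "p (Suc j)"] k j by auto
    have "real a < of_int z" using j(3) mk unfolding z by (simp add: field_simps)
    then have "int a < z" by (metis of_int_less_iff of_int_of_nat_eq)
    then have "int a + 1 \<le> z" by simp
    then have "of_int (int a + 1) \<le> (of_int z :: real)" by (simp only: of_int_le_iff)
    then have "(real a + 1) / real m ^ k \<le> p (Suc j)" unfolding z using mk by (simp add: divide_right_mono)
    then have sub: "x \<in> {p j..p (Suc j)}" if "real a / real m ^ k \<le> x" "x \<le> (real a + 1) / real m ^ k" for x
      using that j by auto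
    define l where "l = nat (int k - s j)"
    have lM: "l \<ge> M" and lk: "int l = int k - s j" unfolding l_def using E[OF j(1)] k by linarith+
    obtain w :: int where w: "c j = of_int w / real m ^ l" using M[of l "c j"] lM j by auto
    have "real m powi s j = real m powi (int k - int l)" using lk by simp
    also have "\<dots> = real m ^ k / real m ^ l" using m0 by (simp add: power_int_diff)
    finally have ms: "real m powi s j = real m ^ k / real m ^ l" .
    have ml: "real m ^ l > 0" using m0 by simp
    define b where "b = int a + w"
    have fa: "f x = of_int b / real m ^ l + real m ^ k / real m ^ l * (x - real a / real m ^ k)"
      if "real a / real m ^ k \<le> x" "x \<le> (real a + 1) / real m ^ k" for x
    proof -
      have "f x = real m ^ k / real m ^ l * x + of_int w / real m ^ l" using pc[OF j(1) sub[OF that]] ms w by simp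
      moreover have "real m ^ k / real m ^ l * (x - real a / real m ^ k) = real m ^ k / real m ^ l * x - real a / real m ^ l"
        using m0 by (simp add: right_diff_distrib)
      ultimately show ?thesis unfolding b_def by (simp add: add_divide_distrib)
    qed
    have "f (real a / real m ^ k) = of_int b / real m ^ l"
      using fa[of "real a / real m ^ k"] mk by (simp add: divide_right_mono)
    moreover have "f (real a / real m ^ k) \<in> {0..1}"
      using F_setD(7)[OF f] \<open>real a / real m ^ k < 1\<close> \<open>0 \<le> real a / real m ^ k\<close> by auto
    ultimately have "0 \<le> (of_int b :: real)" using ml by (simp add: zero_le_divide_iff)
    then have "b \<ge> 0" by simp
    then have "real (nat b) = of_int b" by simp
    then show ?thesis unfolding standard_linear_def using fa by metis
  qed
  then show ?thesis by blast
qed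

lemma standard_linear_compose:
  assumes m: "m \<ge> 2" and h: "standard_linear m k a l b h" and s: "standard_linear m l b l' b' s"
  shows "standard_linear m k a l' b' (\<lambda>x. s (h x))"
  unfolding standard_linear_def
proof (intro allI impI)
  fix x assume x: "real a / real m ^ k \<le> x \<and> x \<le> (real a + 1) / real m ^ k"
  have pos: "real m ^ k > 0" "real m ^ l > 0" "real m ^ l' > 0" using m by auto
  have hx: "h x = real b / real m ^ l + real m ^ k / real m ^ l * (x - real a / real m ^ k)"
    using h x unfolding standard_linear_def by blast
  have "real m ^ k / real m ^ l * (x - real a / real m ^ k) \<le> real m ^ k / real m ^ l * (1 / real m ^ k)"
    using x pos by (intro mult_left_mono) (auto simp: add_divide_distrib)
  then have "real m ^ k / real m ^ l * (x - real a / real m ^ k) \<le> 1 / real m ^ l" using pos m by simp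
  then have "real b / real m ^ l \<le> h x" "h x \<le> (real b + 1) / real m ^ l"
    unfolding hx using x pos by (simp_all add: add_divide_distrib)
  then have "s (h x) = real b' / real m ^ l' + real m ^ l / real m ^ l' * (h x - real b / real m ^ l)"
    using s unfolding standard_linear_def by blast
  also have "real m ^ l / real m ^ l' * (h x - real b / real m ^ l) = real m ^ k / real m ^ l' * (x - real a / real m ^ k)"
    unfolding hx using pos by simp
  finally show "s (h x) = real b' / real m ^ l' + real m ^ k / real m ^ l' * (x - real a / real m ^ k)" .
qed

lemma standard_linear_bound:
  assumes m: "m \<ge> 2" and a: "a < m ^ k" and h: "standard_linear m k a l b h"
    and I: "\<And>x. x \<in> {0..1} \<Longrightarrow> h x \<in> {0..1}"
  shows "b < m ^ l"
proof -
  have pos: "real m ^ k > 0" "real m ^ l > 0" using m by auto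
  define x where "x = (real a + 1) / real m ^ k"
  have "real a / real m ^ k \<le> x" unfolding x_def using pos by (simp add: divide_right_mono)
  then have "h x = real b / real m ^ l + real m ^ k / real m ^ l * (x - real a / real m ^ k)"
    using h unfolding standard_linear_def x_def by blast
  also have "\<dots> = (real b + 1) / real m ^ l"
    unfolding x_def using pos by (simp add: add_divide_distrib)
  finally have hx: "h x = (real b + 1) / real m ^ l" .
  have "real (Suc a) \<le> real (m ^ k)" using a by (simp only: of_nat_le_iff Suc_le_eq)
  then have "x \<in> {0..1}" unfolding x_def using pos by simp
  then have "(real b + 1) / real m ^ l \<le> 1" using I hx by fastforce
  then have "real b + 1 \<le> real (m ^ l)" using pos by (simp add: field_simps)
  then show ?thesis by linarith
qed

text \<open>Extended by the identity to the whole line, the map is strictly increasing and onto,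
  hence continuous, which covers 0 and 1 at once.\<close>

lemma fix_endpoints_homeo:
  assumes \<phi>: "\<phi> \<in> homeo_plus {0<..<1}"
  shows "fix_endpoints \<phi> \<in> homeo_plus {0..1}"
proof (rule homeo_plusI)
  have sm: "strict_mono_on {0<..<1} \<phi>" using \<phi> unfolding homeo_plus_def by simp
  have im: "\<phi> ` {0<..<1} = {0<..<1}" using \<phi> unfolding homeo_plus_def homeomorphism_def by auto
  define \<Phi> where "\<Phi> x = (if x \<in> {0<..<1} then \<phi> x else x)" for x
  have I: "0 < \<phi> x" "\<phi> x < 1" if "0 < x" "x < 1" for x using im that by force+
  have "strict_mono \<Phi>"
  proof (rule strict_monoI)
    fix x y :: real assume "x < y"
    then show "\<Phi> x < \<Phi> y"
      using strict_mono_onD[OF sm, of x y] I[of x] I[of y] unfolding \<Phi>_def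
      by (cases "x \<in> {0<..<1}"; cases "y \<in> {0<..<1}") auto
  qed
  moreover have "range \<Phi> = UNIV"
  proof (intro equalityI subsetI)
    fix y :: real
    show "y \<in> range \<Phi>"
    proof (cases "y \<in> {0<..<1}")
      case True
      then obtain x where "x \<in> {0<..<1}" "y = \<phi> x" using im by blast
      then show ?thesis by (intro range_eqI[of _ _ x]) (auto simp: \<Phi>_def)
    next
      case False
      then show ?thesis by (intro range_eqI[of _ _ y]) (auto simp: \<Phi>_def)
    qed
  qed simp
  ultimately have "continuous_on UNIV \<Phi>"
    by (intro continuous_onI_mono) (auto simp: strict_mono_less_eq)
  then have cont: "continuous_on {0..1} \<Phi>" by (rule continuous_on_subset) simp
  have eq: "fix_endpoints \<phi> x = \<Phi> x" if "x \<in> {0..1}" for x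
    using that unfolding fix_endpoints_def \<Phi>_def by simp
  show "continuous_on {0..1} (fix_endpoints \<phi>)"
    using cont by (rule continuous_on_eq) (simp add: eq)
  show "strict_mono_on {0..1} (fix_endpoints \<phi>)"
    using \<open>strict_mono \<Phi>\<close> by (auto intro!: strict_mono_onI simp: eq strict_mono_less)
  show "fix_endpoints \<phi> 0 = 0" "fix_endpoints \<phi> 1 = 1" "fix_endpoints \<phi> \<in> extensional {0..1}"
    by (auto simp: fix_endpoints_def)
qed

section \<open>Adic points correspond\<close>

locale F_conjugacy = F_embedding +
  fixes \<phi> :: "real \<Rightarrow> real"
  assumes \<phi>_homeo: "\<phi> \<in> homeo_plus {0<..<1}"
    and \<phi>_equivariant: "\<And>g x. g \<in> F_set n \<Longrightarrow> x \<in> {0<..<1} \<Longrightarrow> \<phi> (g x) = \<theta> g (\<phi> x)"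
    and H_closed: "\<And>f. f \<in> F_set m \<Longrightarrow> piecewise_in H f \<Longrightarrow> f \<in> H"
begin

definition \<psi> :: "real \<Rightarrow> real" where "\<psi> = fix_endpoints \<phi>"

lemma \<psi>_homeo: "\<psi> \<in> homeo_plus {0..1}"
  unfolding \<psi>_def by (rule fix_endpoints_homeo[OF \<phi>_homeo])

lemmas \<psi>D = homeo_plusD[OF \<psi>_homeo]

lemma \<psi>_equivariant:
  assumes g: "g \<in> F_set n" and x: "x \<in> {0..1}"
  shows "\<psi> (g x) = \<theta> g (\<psi> x)"
proof (cases "x \<in> {0<..<1}")
  case True
  then have "0 < g x" "g x < 1"
    using F_setD(8)[OF g, of 0 x] F_setD(8)[OF g, of x 1] F_setD(5,6)[OF g] by auto
  then show ?thesis using \<phi>_equivariant[OF g True] True unfolding \<psi>_def fix_endpoints_def by auto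
next
  case False
  then have "x = 0 \<or> x = 1" using x by auto
  then show ?thesis using \<psi>D(5,6) F_setD(5,6)[OF g] F_setD(5,6)[OF \<theta>_F_set[OF g]] by auto
qed

lemma H_eq_F_conj: "H = F_conj n \<phi>"
proof -
  have "(\<lambda>x\<in>{0..1}. fix_endpoints \<phi> (f (inv_into {0..1} (fix_endpoints \<phi>) x))) = \<theta> f" if f: "f \<in> F_set n" for f
  proof (rule extensionalityI[of _ "{0..1}"])
    show "\<theta> f \<in> extensional {0..1}" by (rule F_setD(1)[OF \<theta>_F_set[OF f]])
    fix x :: real assume x: "x \<in> {0..1}"
    have i: "inverse_map \<psi> x = inv_into {0..1} (fix_endpoints \<phi>) x" using x by (simp add: inverse_map_def \<psi>_def)
    have "\<psi> (f (inverse_map \<psi> x)) = \<theta> f x"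
      using \<psi>_equivariant[OF f inverse_map(3)[OF \<psi>_homeo x]] inverse_map(2)[OF \<psi>_homeo x] by simp
    then show "(\<lambda>x\<in>{0..1}. fix_endpoints \<phi> (f (inv_into {0..1} (fix_endpoints \<phi>) x))) x = \<theta> f x"
      using x unfolding i by (simp add: \<psi>_def)
  qed simp
  then have "F_conj n \<phi> = \<theta> ` F_set n" unfolding F_conj_def Setcompr_eq_image by (rule image_cong[OF refl])
  then show ?thesis using \<theta>_bij by (simp add: bij_betw_def)
qed

lemma \<theta>_fixed_iff:
  assumes g: "g \<in> F_set n" and x: "x \<in> {0..1}"
  shows "\<theta> g (\<psi> x) = \<psi> x \<longleftrightarrow> g x = x"
  using \<psi>_equivariant[OF g x] \<psi>D(10)[OF F_setD(7)[OF g x] x] by simp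

text \<open>The bump on \<open>[x,1]\<close> fixes \<open>[0,x]\<close> and moves all of
  \<open>(x,1)\<close>, and conjugation preserves fixed points. So its image is the identity to the
  left of \<open>\<psi> x\<close> but not on any right neighbourhood; the germ can change in this
  way only at an \<open>m\<close>-adic point.\<close>

lemma \<psi>_adic:
  assumes x: "x \<in> adic_rationals n" "0 < x" "x < 1"
  shows "\<psi> x \<in> adic_rationals m"
proof (rule ccontr)
  assume nD: "\<psi> x \<notin> adic_rationals m"
  define b where "b = bump n x 1"
  have b: "b \<in> F_set n" unfolding b_def by (rule bump_in_F_set[OF n x(1)]) (use x in auto)
  have xI: "x \<in> {0..1}" using x by simp
  have y01: "0 < \<psi> x" "\<psi> x < 1" using \<psi>D(8)[of 0 x] \<psi>D(8)[of x 1] \<psi>D(5,6) x by auto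
  have yI: "\<psi> x \<in> {0..1}" using y01 by simp
  have left: "\<theta> b w = w" if "w \<in> {0..1}" "w \<le> \<psi> x" for w
  proof -
    define u where "u = inverse_map \<psi> w"
    have u: "u \<in> {0..1}" "\<psi> u = w" unfolding u_def using inverse_map[OF \<psi>_homeo that(1)] by auto
    have "u \<le> x" using \<psi>D(9)[OF u(1) xI] u that by simp
    then have "b u = u" unfolding b_def using x u by (intro bump_outside[OF n]) auto
    then show ?thesis using \<theta>_fixed_iff[OF b u(1)] u by simp
  qed
  have right: "\<theta> b w \<noteq> w" if "w \<in> {0..1}" "\<psi> x < w" "w < 1" for w
  proof -
    define u where "u = inverse_map \<psi> w"
    have u: "u \<in> {0..1}" "\<psi> u = w" unfolding u_def using inverse_map[OF \<psi>_homeo that(1)] by auto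
    have "x < u" "u < 1" using \<psi>D(8)[OF xI u(1)] \<psi>D(8)[OF u(1), of 1] \<psi>D(6) u that by auto
    then have "b u < u" unfolding b_def using u by (intro bump_less[OF n]) auto
    then show ?thesis using \<theta>_fixed_iff[OF b u(1)] u by simp
  qed
  from locally_adicE[OF F_set_locally_adic[OF m \<theta>_F_set[OF b] yI]] obtain e s c where e: "e > 0"
    and l: "\<And>w. w \<in> {0..1} \<Longrightarrow> \<psi> x - e \<le> w \<Longrightarrow> w \<le> \<psi> x \<Longrightarrow> \<theta> b w = real m powi s * w + c"
    and r: "\<And>w. w \<in> {0..1} \<Longrightarrow> \<psi> x \<le> w \<Longrightarrow> w \<le> \<psi> x + e \<Longrightarrow> \<theta> b w = real m powi s * w + c"
    using nD by metis
  define w where "w = max 0 (\<psi> x - e)"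
  have w: "w \<in> {0..1}" "w < \<psi> x" "\<psi> x - e \<le> w" unfolding w_def using e y01 by auto
  have "real m powi s * w + c = real m powi 0 * w + 0" using l[of w] left[of w] w by simp
  moreover have "real m powi s * \<psi> x + c = real m powi 0 * \<psi> x + 0" using l[OF yI] left[OF yI] e by simp
  ultimately have sc: "s = 0" "c = 0" using powi_affine_unique[OF m, of w "\<psi> x" s c 0 0] w by auto
  define v where "v = min (\<psi> x + e) ((\<psi> x + 1) / 2)"
  have v: "v \<in> {0..1}" "\<psi> x < v" "v \<le> \<psi> x + e" "v < 1" unfolding v_def using e y01 by (auto simp: min_def)
  then show False using right[of v] r[of v] sc by simp
qed

section \<open>Words in the image generators\<close>

definition image_generators :: "(real \<Rightarrow> real) set" where
  "image_generators = \<theta> ` grid_generators n"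

lemma image_generators_H: "image_generators \<subseteq> H"
  unfolding image_generators_def using grid_generators_F_set[OF n] \<theta>_H by blast

lemma word_map_H:
  "set ss \<subseteq> H \<Longrightarrow> \<exists>h\<in>H. \<forall>x\<in>{0..1}. h x = word_map ss x"
proof (induction ss)
  case Nil
  show ?case by (rule bexI[OF _ H_id]) simp
next
  case (Cons s ss)
  then obtain h where h: "h \<in> H" "\<forall>x\<in>{0..1}. h x = word_map ss x" by auto
  show ?case by (rule bexI[OF _ H_compose[of s h]]) (use Cons.prems h in \<open>auto simp: compose_def\<close>)
qed

lemma word_map_equivariant:
  assumes "set ss \<subseteq> F_set n" "x \<in> {0..1}"
  shows "word_map ss x \<in> {0..1} \<and> \<psi> (word_map ss x) = word_map (map \<theta> ss) (\<psi> x)"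
  using assms
proof (induction ss)
  case (Cons s ss)
  then have IH: "word_map ss x \<in> {0..1}" "\<psi> (word_map ss x) = word_map (map \<theta> ss) (\<psi> x)" and s: "s \<in> F_set n" by auto
  show ?case using \<psi>_equivariant[OF s IH(1)] F_setD(7)[OF s IH(1)] IH(2) by simp
qed simp

text \<open>If all images of a standard interval under words in the generators were short, then all
  these words would be affine on it, contradicting that some word carries a breakpoint of a
  generator into it.\<close>

lemma bounded_depth:
  obtains N where "\<And>k a. a < m ^ k \<Longrightarrow>
    \<exists>ss l b. set ss \<subseteq> image_generators \<and> l \<le> N \<and> b < m ^ l \<and> standard_linear m k a l b (word_map ss)"
proof -
  have fin: "finite image_generators" unfolding image_generators_def using finite_grid_generators by simp
  have "\<forall>s\<in>image_generators. \<exists>N. \<forall>k\<ge>N. \<forall>a<m ^ k. \<exists>l b. standard_linear m k a l b s"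
    using F_set_standard_linear[OF m] image_generators_H H_F_set by blast
  then obtain Nf where Nf: "\<And>s k a. s \<in> image_generators \<Longrightarrow> k \<ge> Nf s \<Longrightarrow> a < m ^ k \<Longrightarrow>
      \<exists>l b. standard_linear m k a l b s" by metis
  \<comment> \<open>From depth \<open>N\<close> on, every generator maps every standard interval
    affinely onto a standard interval.\<close>
  define N where "N = (\<Sum>s\<in>image_generators. Nf s)"
  have N: "\<exists>l b. standard_linear m k a l b s" if "s \<in> image_generators" "k \<ge> N" "a < m ^ k" for s k a
  proof -
    have "Nf s \<le> N" unfolding N_def by (rule member_le_sum[OF that(1) _ fin]) simp
    then show ?thesis using Nf[OF that(1)] that by simp
  qed
  have "\<exists>ss l b. set ss \<subseteq> image_generators \<and> l \<le> N \<and> b < m ^ l \<and> standard_linear m k a l b (word_map ss)"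
    if a: "a < m ^ k" for k a
  proof (rule ccontr)
    assume neg: "\<not> ?thesis"
    have wI: "word_map ss x \<in> {0..1}" if ss: "set ss \<subseteq> image_generators" and x: "x \<in> {0..1}" for ss x
    proof -
      obtain h where "h \<in> H" "\<And>x. x \<in> {0..1} \<Longrightarrow> h x = word_map ss x"
        using word_map_H[OF subset_trans[OF ss image_generators_H]] by blast
      then show ?thesis using homeo_plusD(7)[OF H_homeo, of h x] x by simp
    qed
    \<comment> \<open>By the negated claim no image reaches a depth of at most \<open>N\<close>, so
      the next generator is always affine on the current image interval.\<close>
    have all: "\<exists>l b. l > N \<and> b < m ^ l \<and> standard_linear m k a l b (word_map ss)"
      if "set ss \<subseteq> image_generators" for ss
      using that
    proof (induction ss)
      case Nil
      have st: "standard_linear m k a k a (word_map [])"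
        unfolding standard_linear_def using m by simp
      then have "\<not> k \<le> N" using neg a Nil.prems by blast
      then show ?case using st a not_le by blast
    next
      case (Cons s ss)
      then obtain l b where lb: "l > N" "b < m ^ l" "standard_linear m k a l b (word_map ss)" by auto
      obtain l' b' where s: "standard_linear m l b l' b' s" using N[of s l b] Cons.prems lb by auto
      have st: "standard_linear m k a l' b' (word_map (s # ss))"
        using standard_linear_compose[OF m lb(3) s] unfolding standard_linear_def by simp
      have "b' < m ^ l'" by (rule standard_linear_bound[OF m a st wI[OF Cons.prems]])
      moreover from this have "\<not> l' \<le> N" using neg st Cons.prems by blast
      ultimately show ?case using st not_le by blast
    qed
    have mk: "real m ^ k > 0" using m by simp
    define x0 where "x0 = real a / real m ^ k"
    define x1 where "x1 = (real a + 1) / real m ^ k"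
    have "real (Suc a) \<le> real (m ^ k)" using a by (simp only: of_nat_le_iff Suc_le_eq)
    then have x01: "0 \<le> x0" "x0 < x1" "x1 \<le> 1" unfolding x0_def x1_def using mk by (simp_all add: divide_strict_right_mono)
    have aff: "\<exists>A B. \<forall>x\<in>{x0..x1}. word_map ss x = A * x + B" if ss: "set ss \<subseteq> image_generators" for ss
    proof -
      obtain l b where "standard_linear m k a l b (word_map ss)" using all[OF ss] by blast
      then have "\<forall>x\<in>{x0..x1}. word_map ss x = real m ^ k / real m ^ l * x + (real b / real m ^ l - real m ^ k / real m ^ l * x0)"
        unfolding standard_linear_def x0_def[symmetric] x1_def[symmetric]
        by (simp add: algebra_simps diff_divide_distrib)
      then show ?thesis by blast
    qed
    \<comment> \<open>The first interior grid point, where the generator \<open>s\<close> breaks.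
      Density of backward orbits supplies a word that takes an interior point \<open>t\<close> of
      the interval to \<open>\<psi> p\<close>.\<close>
    define p where "p = 1 / real n ^ 4"
    have n4: "(1::nat) < n ^ 4" using n by (intro one_less_power) auto
    then have "(1::real) < real n ^ 4" by (metis of_nat_1 of_nat_less_iff of_nat_power)
    then have p: "0 < p" "p < 1" unfolding p_def using n by (auto simp: divide_simps)
    define s where "s = bump n p 1"
    have sg: "s \<in> grid_generators n"
      unfolding grid_generators_def grid_bumps_def s_def p_def using n4
      by (intro UnI1 UnI2 rev_image_eqI[of 1]) auto
    then have sF: "s \<in> F_set n" using grid_generators_F_set[OF n] by blast
    have sT: "\<theta> s \<in> image_generators" unfolding image_generators_def using sg by blast
    define c where "c = inverse_map \<psi> x0"
    define d where "d = inverse_map \<psi> x1"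
    have cI: "c \<in> {0..1}" "\<psi> c = x0" and dI: "d \<in> {0..1}" "\<psi> d = x1"
      unfolding c_def d_def using inverse_map[OF \<psi>_homeo] x01 by auto
    have "c < d" using \<psi>D(8)[OF cI(1) dI(1)] cI dI x01 by simp
    then obtain t' ss' where t': "c < t'" "t' < d" "set ss' \<subseteq> grid_generators n" "word_map ss' t' = p"
      using grid_generators_backward_orbit_dense[OF n p, of c d] cI dI by auto
    have t'I: "t' \<in> {0..1}" using t' cI dI by auto
    define t where "t = \<psi> t'"
    define ss where "ss = map \<theta> ss'"
    have t: "x0 < t" "t < x1" unfolding t_def using \<psi>D(8)[OF cI(1) t'I] \<psi>D(8)[OF t'I dI(1)] cI dI t' by auto
    have ssT: "set ss \<subseteq> image_generators" unfolding ss_def image_generators_def using t'(3) by auto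
    have wt: "word_map ss t = \<psi> p"
      using word_map_equivariant[of ss' t'] t' t'I grid_generators_F_set[OF n] unfolding t_def ss_def by auto
    obtain h where h: "h \<in> H" "\<And>x. x \<in> {0..1} \<Longrightarrow> h x = word_map ss x"
      using word_map_H[OF subset_trans[OF ssT image_generators_H]] by blast
    have mono: "word_map ss x < word_map ss y" if "x \<in> {0..1}" "y \<in> {0..1}" "x < y" for x y
      using homeo_plusD(8)[OF H_homeo[OF h(1)] that(1,2)] h(2) that by simp
    obtain A B where AB: "\<forall>x\<in>{x0..x1}. word_map ss x = A * x + B" using aff[OF ssT] by blast
    obtain C D where CD: "\<forall>x\<in>{x0..x1}. word_map (\<theta> s # ss) x = C * x + D" using aff[of "\<theta> s # ss"] ssT sT by auto
    have fixp: "\<theta> s w = w \<longleftrightarrow> w \<le> \<psi> p" if w: "w \<in> {0..1}" "w < 1" for w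
    proof -
      define u where "u = inverse_map \<psi> w"
      have u: "u \<in> {0..1}" "\<psi> u = w" unfolding u_def using inverse_map[OF \<psi>_homeo w(1)] by auto
      have u1: "u < 1" using \<psi>D(8)[OF u(1), of 1] \<psi>D(6) u w by simp
      have "s u = u \<longleftrightarrow> u \<le> p"
        using bump_outside[OF n p(2) u(1)] bump_less[OF n u(1), of p 1] u1 unfolding s_def by fastforce
      then show ?thesis using \<theta>_fixed_iff[OF sF u(1)] u \<psi>D(9)[OF u(1), of p] p by auto
    qed
    have I: "x0 \<in> {0..1}" "t \<in> {0..1}" "x1 \<in> {0..1}" using x01 t by auto
    define v where "v = (t + x1) / 2"
    have v: "t < v" "v < x1" "v \<in> {0..1}" unfolding v_def using t I by auto
    have w0: "word_map ss x0 < \<psi> p" using mono[OF I(1,2) t(1)] wt by simp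
    have p1: "\<psi> p < 1" using \<psi>D(8)[of p 1] \<psi>D(6) p by simp
    have wv: "\<psi> p < word_map ss v" using mono[OF I(2) v(3,1)] wt by simp
    have wv1: "word_map ss v < 1" using mono[OF v(3) I(3) v(2)] wI[OF ssT I(3)] by simp
    \<comment> \<open>The word alone and the word followed by \<open>\<theta> s\<close> agree at
      \<open>x0\<close> and at \<open>t\<close>, because \<open>\<theta> s\<close> is the identity
      up to \<open>\<psi> p\<close>. Both are affine on the interval, so they agree at
      \<open>v\<close> as well, where \<open>\<theta> s\<close> moves the value.\<close>
    have "C * x0 + D = A * x0 + B"
      using fixp[OF wI[OF ssT I(1)]] w0 p1 CD AB x01 by force
    moreover have "C * t + D = A * t + B"
    proof -
      have "\<theta> s (word_map ss t) = word_map ss t" using fixp[OF wI[OF ssT I(2)]] wt p1 by simp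
      then show ?thesis using CD AB t by simp
    qed
    ultimately have "(C - A) * (t - x0) = 0" "C * t + D = A * t + B" by (simp_all add: algebra_simps)
    then have "C = A" "D = B" using t by auto
    then have "\<theta> s (word_map ss v) = word_map ss v" using CD AB v t by simp
    then show False using fixp[OF wI[OF ssT v(3)] wv1] wv by simp
  qed
  then show thesis using that by blast
qed

text \<open>Closedness of \<open>H\<close> acts here: since \<open>y\<close> is
  \<open>m\<close>-adic, the glued map lies in \<open>F_set m\<close>, and it is piecewise in
  \<open>H\<close> by construction.\<close>

lemma glue_H:
  assumes h: "h1 \<in> H" "h2 \<in> H" and y: "y \<in> adic_rationals m" "0 < y" "y < 1" "h1 y = h2 y"
  shows "(\<lambda>x\<in>{0..1}. if x \<le> y then h1 x else h2 x) \<in> H" (is "?g \<in> H")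
proof (rule H_closed)
  show "?g \<in> F_set m" using F_set_glue[OF m H_F_set[OF h(1)] H_F_set[OF h(2)] _ y(1,4)] y by simp
  define a where "a j = (if j = 0 then 0 else if j = 1 then y else 1)" for j :: nat
  have "subdivision 2 a" unfolding subdivision_def a_def using y by (auto simp: less_2_cases_iff)
  moreover have "\<exists>h\<in>H. \<forall>x\<in>{a j..a (Suc j)}. ?g x = h x" if "j < 2" for j
  proof -
    have "j = 0 \<or> j = 1" using that by linarith
    then show ?thesis
    proof
      assume "j = 0"
      then show ?thesis using y h by (intro bexI[of _ h1]) (auto simp: a_def)
    next
      assume "j = 1"
      then show ?thesis using y h by (intro bexI[of _ h2]) (auto simp: a_def)
    qed
  qed
  ultimately show "piecewise_in H ?g" unfolding piecewise_in_def by blast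
qed

text \<open>By the pigeonhole principle two of the standard intervals with left end point \<open>\<psi> x\<close> have the
  same image under words; gluing the two words at \<open>\<psi> x\<close> produces a breakpoint at \<open>x\<close>.\<close>

lemma \<psi>_adic_converse:
  assumes x: "0 < x" "x < 1" and y: "\<psi> x \<in> adic_rationals m"
  shows "x \<in> adic_rationals n"
proof (rule ccontr)
  assume nD: "x \<notin> adic_rationals n"
  have xI: "x \<in> {0..1}" using x by simp
  have y01: "0 < \<psi> x" "\<psi> x < 1" using \<psi>D(8)[of 0 x] \<psi>D(8)[of x 1] \<psi>D(5,6) x by auto
  have yI: "\<psi> x \<in> {0..1}" using y01 by simp
  obtain z0 K where "\<psi> x = of_int z0 / real m ^ K" using y unfolding adic_rationals_def by auto
  moreover define z where "z = nat z0"
  have mK: "real m ^ k > 0" for k using m by simp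
  ultimately have "0 < z0" using y01(1) by (simp add: zero_less_divide_iff)
  then have z: "\<psi> x = real z / real m ^ K" using \<open>\<psi> x = of_int z0 / real m ^ K\<close> unfolding z_def by simp
  \<comment> \<open>For every \<open>k\<close> the point \<open>\<psi> x\<close> is the left end of
    a standard interval of depth \<open>K + k\<close>.\<close>
  have yk: "\<psi> x = real (z * m ^ k) / real m ^ (K + k)" for k
    using z mK[of k] by (simp add: power_add)
  have zk: "z * m ^ k < m ^ (K + k)" for k
  proof -
    have "real (z * m ^ k) < real (m ^ (K + k))" using yk[of k] y01(2) mK[of "K + k"] by (simp add: field_simps)
    then show ?thesis by (simp only: of_nat_less_iff)
  qed
  obtain N where N: "\<And>k a. a < m ^ k \<Longrightarrow>
    \<exists>ss l b. set ss \<subseteq> image_generators \<and> l \<le> N \<and> b < m ^ l \<and> standard_linear m k a l b (word_map ss)"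
    using bounded_depth by metis
  have "\<forall>k. \<exists>ss l b. set ss \<subseteq> image_generators \<and> l \<le> N \<and> b < m ^ l \<and>
      standard_linear m (K + k) (z * m ^ k) l b (word_map ss)"
    using N zk by blast
  then obtain S L B where SLB: "\<And>k. set (S k) \<subseteq> image_generators" "\<And>k. L k \<le> N" "\<And>k. B k < m ^ L k"
    "\<And>k. standard_linear m (K + k) (z * m ^ k) (L k) (B k) (word_map (S k))" by metis
  \<comment> \<open>Depth and position of the images range over a finite set, so two starting depths
    \<open>k < k'\<close> share an image interval. The two words agree at \<open>\<psi> x\<close>,
    but their right slopes there differ by the factor \<open>m ^ (k' - k)\<close>.\<close>
  have "(\<lambda>k. (L k, B k)) ` UNIV \<subseteq> {..N} \<times> {..m ^ N}"
  proof (clarsimp simp: SLB(2))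
    fix k
    have "m ^ L k \<le> m ^ N" using SLB(2) m by (intro power_increasing) auto
    then show "B k \<le> m ^ N" using SLB(3)[of k] by linarith
  qed
  then have "finite ((\<lambda>k. (L k, B k)) ` UNIV)" by (rule finite_subset) simp
  then obtain k where "infinite {j \<in> UNIV. (L j, B j) = (L k, B k)}"
    using pigeonhole_infinite[of "UNIV :: nat set" "\<lambda>k. (L k, B k)"] by auto
  then obtain k' where k': "k' > k" "L k' = L k" "B k' = B k"
    unfolding infinite_nat_iff_unbounded by blast
  obtain h1 where h1: "h1 \<in> H" "\<And>x. x \<in> {0..1} \<Longrightarrow> h1 x = word_map (S k) x"
    using word_map_H[OF subset_trans[OF SLB(1)[of k] image_generators_H]] by blast
  obtain h2 where h2: "h2 \<in> H" "\<And>x. x \<in> {0..1} \<Longrightarrow> h2 x = word_map (S k') x"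
    using word_map_H[OF subset_trans[OF SLB(1)[of k'] image_generators_H]] by blast
  define l where "l = L k"
  define b where "b = B k"
  have lin: "word_map (S j) w = real b / real m ^ l + real m ^ (K + j) / real m ^ l * (w - \<psi> x)"
    if "\<psi> x \<le> w" "w \<le> \<psi> x + 1 / real m ^ (K + j)" "L j = l" "B j = b" for j w
  proof -
    have "(real (z * m ^ j) + 1) / real m ^ (K + j) = \<psi> x + 1 / real m ^ (K + j)"
      unfolding yk[of j] by (simp only: add_divide_distrib)
    then show ?thesis using SLB(4)[of j] that unfolding standard_linear_def yk[of j, symmetric] by simp
  qed
  have eqy: "h1 (\<psi> x) = h2 (\<psi> x)"
    using h1(2)[OF yI] h2(2)[OF yI] lin[of "\<psi> x" k] lin[of "\<psi> x" k'] k' mK by (simp add: l_def b_def)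
  define g where "g = (\<lambda>w\<in>{0..1}. if w \<le> \<psi> x then h1 w else h2 w)"
  have g: "g \<in> H" unfolding g_def by (rule glue_H[OF h1(1) h2(1) y y01 eqy])
  obtain f where f: "f \<in> F_set n" "\<theta> f = g" using \<theta>_surj[OF g] .
  obtain f1 where f1: "f1 \<in> F_set n" "\<theta> f1 = h1" using \<theta>_surj[OF h1(1)] .
  \<comment> \<open>Slopes do not pass through \<open>\<psi>\<close>, but coincidences of maps
    do.\<close>
  have iff: "f u = f1 u \<longleftrightarrow> g (\<psi> u) = h1 (\<psi> u)" if u: "u \<in> {0..1}" for u
    using \<psi>_equivariant[OF f(1) u] \<psi>_equivariant[OF f1(1) u] f f1
      \<psi>D(10)[OF F_setD(7)[OF f(1) u] F_setD(7)[OF f1(1) u]] by auto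
  from locally_adicE[OF F_set_locally_adic[OF n f(1) xI]] obtain e s c where e: "e > 0"
    and fl: "\<And>w. w \<in> {0..1} \<Longrightarrow> x - e \<le> w \<Longrightarrow> w \<le> x \<Longrightarrow> f w = real n powi s * w + c"
    and fr: "\<And>w. w \<in> {0..1} \<Longrightarrow> x \<le> w \<Longrightarrow> w \<le> x + e \<Longrightarrow> f w = real n powi s * w + c"
    using nD by metis
  from locally_adicE[OF F_set_locally_adic[OF n f1(1) xI]] obtain e1 s1 c1 where e1: "e1 > 0"
    and f1l: "\<And>w. w \<in> {0..1} \<Longrightarrow> x - e1 \<le> w \<Longrightarrow> w \<le> x \<Longrightarrow> f1 w = real n powi s1 * w + c1"
    and f1r: "\<And>w. w \<in> {0..1} \<Longrightarrow> x \<le> w \<Longrightarrow> w \<le> x + e1 \<Longrightarrow> f1 w = real n powi s1 * w + c1"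
    using nD by metis
  \<comment> \<open>Agreement to the left of the non-adic \<open>x\<close>, where neither map
    breaks, extends a little to the right. Then \<open>h1\<close> and \<open>h2\<close> coincide
    just to the right of \<open>\<psi> x\<close>, contrary to their slopes.\<close>
  have left: "f u = f1 u" if u: "u \<in> {0..1}" "u \<le> x" for u
    using iff[OF u(1)] \<psi>D(9)[OF u(1) xI] u \<psi>D(7)[OF u(1)] unfolding g_def by simp
  define w where "w = max 0 (max (x - e) (x - e1))"
  have w: "w \<in> {0..1}" "w < x" "x - e \<le> w" "x - e1 \<le> w" unfolding w_def using x e e1 by auto
  have "real n powi s * w + c = real n powi s1 * w + c1" using left[of w] fl[of w] f1l[of w] w by simp
  moreover have "real n powi s * x + c = real n powi s1 * x + c1" using left[OF xI] fl[OF xI] f1l[OF xI] e e1 by simp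
  ultimately have sc: "s = s1" "c = c1" using powi_affine_unique[OF n, of w x s c s1 c1] w by auto
  define y' where "y' = min (\<psi> x + 1 / real m ^ (K + k')) 1"
  have y': "\<psi> x < y'" "y' \<in> {0..1}" unfolding y'_def using y01 mK[of "K + k'"] by auto
  define v' where "v' = inverse_map \<psi> y'"
  have v'I: "v' \<in> {0..1}" "\<psi> v' = y'" unfolding v'_def using inverse_map[OF \<psi>_homeo y'(2)] by auto
  have "x < v'" using \<psi>D(8)[OF xI v'I(1)] v'I y' by simp
  define v where "v = Min {v', x + e, x + e1}"
  have v: "x < v" "v \<le> v'" "v \<le> x + e" "v \<le> x + e1" unfolding v_def using \<open>x < v'\<close> e e1 by auto
  have vI: "v \<in> {0..1}" using v v'I x by auto
  have "f v = f1 v" using fr[of v] f1r[of v] v vI sc by simp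
  then have "g (\<psi> v) = h1 (\<psi> v)" using iff[OF vI] by simp
  moreover have pv: "\<psi> x < \<psi> v" "\<psi> v \<le> y'" using \<psi>D(8)[OF xI vI] \<psi>D(9)[OF vI v'I(1)] v v'I by auto
  ultimately have eq: "word_map (S k') (\<psi> v) = word_map (S k) (\<psi> v)"
    using h1(2)[OF \<psi>D(7)[OF vI]] h2(2)[OF \<psi>D(7)[OF vI]] \<psi>D(7)[OF vI] unfolding g_def by auto
  have b1: "\<psi> v \<le> \<psi> x + 1 / real m ^ (K + k')" using pv unfolding y'_def by simp
  have "real m ^ (K + k) \<le> real m ^ (K + k')" using k'(1) m by (intro power_increasing) auto
  then have "1 / real m ^ (K + k') \<le> 1 / real m ^ (K + k)" 
    by (intro frac_le[OF _ order_refl mK]) auto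
  then have b2: "\<psi> v \<le> \<psi> x + 1 / real m ^ (K + k)" using b1 by simp
  have "real m ^ (K + k') / real m ^ l * (\<psi> v - \<psi> x) = real m ^ (K + k) / real m ^ l * (\<psi> v - \<psi> x)"
    using eq lin[of "\<psi> v" k'] lin[of "\<psi> v" k] b1 b2 pv k' by (simp add: l_def b_def)
  then have "real m ^ (K + k') = real m ^ (K + k)" using pv m by simp
  then show False using k'(1) m by (simp add: power_inject_exp)
qed

lemma \<phi>_bij_adic:
  "bij_betw \<phi> (adic_rationals n \<inter> {0<..<1}) (adic_rationals m \<inter> {0<..<1})"
proof -
  have \<phi>\<psi>: "\<phi> x = \<psi> x" if "0 < x" "x < 1" for x using that unfolding \<psi>_def fix_endpoints_def by simp
  have I: "0 < \<psi> x \<and> \<psi> x < 1 \<longleftrightarrow> 0 < x \<and> x < 1" if "x \<in> {0..1}" for x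
    using \<psi>D(8)[of 0 x] \<psi>D(8)[of x 1] \<psi>D(5,6) that by auto
  show ?thesis
  proof (rule bij_betw_imageI)
    show "inj_on \<phi> (adic_rationals n \<inter> {0<..<1})"
      by (rule inj_onI) (use \<phi>\<psi> \<psi>D(10) in auto)
    show "\<phi> ` (adic_rationals n \<inter> {0<..<1}) = adic_rationals m \<inter> {0<..<1}"
    proof (intro equalityI subsetI)
      fix y assume "y \<in> \<phi> ` (adic_rationals n \<inter> {0<..<1})"
      then obtain x where "x \<in> adic_rationals n" "0 < x" "x < 1" "y = \<phi> x" by auto
      then show "y \<in> adic_rationals m \<inter> {0<..<1}" using \<phi>\<psi>[of x] \<psi>_adic[of x] I[of x] by simp
    next
      fix y assume y: "y \<in> adic_rationals m \<inter> {0<..<1}"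
      define x where "x = inverse_map \<psi> y"
      have x: "x \<in> {0..1}" "\<psi> x = y" unfolding x_def using inverse_map[OF \<psi>_homeo, of y] y by auto
      then have "0 < x" "x < 1" using I[of x] y by auto
      moreover have "x \<in> adic_rationals n" using \<psi>_adic_converse calculation x y by auto
      ultimately show "y \<in> \<phi> ` (adic_rationals n \<inter> {0<..<1})" using \<phi>\<psi>[of x] x by (intro image_eqI[of _ _ x]) auto
    qed
  qed
qed

end

section \<open>Lifting to Cantor sets\<close>

text \<open>Horner's scheme for the integer with the first \<open>k\<close> digits of
  \<open>\<omega>\<close> in base \<open>n\<close>; divided by \<open>n ^ k\<close> it is a partial
  sum of \<open>rho\<close>.\<close>

fun prefix_value :: "nat \<Rightarrow> (nat \<Rightarrow> nat) \<Rightarrow> nat \<Rightarrow> nat" where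
  "prefix_value n \<omega> 0 = 0"
| "prefix_value n \<omega> (Suc k) = n * prefix_value n \<omega> k + \<omega> k"

text \<open>A point of the Cantor set corresponds to the lower set of those \<open>n\<close>-adic rationals in
  \<open>[0,1)\<close> whose upper expansion is lexicographically at most that point; an increasing bijection
  between adic rationals acts on these lower sets.\<close>

definition adic_cut :: "nat \<Rightarrow> (nat \<Rightarrow> nat) \<Rightarrow> real set" where
  "adic_cut n \<omega> =
     {x \<in> adic_rationals n. 0 \<le> x \<and> (\<exists>k. x \<le> real (prefix_value n \<omega> k) / real n ^ k)}"

text \<open>An intrinsic description of the sets \<open>adic_cut n \<omega>\<close>. A lower set may
  contain an interior adic supremum or omit it, which accounts for the two expansions of such a
  point.\<close>

definition cut_family :: "nat \<Rightarrow> real set set" where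
  "cut_family n = {C. C \<subseteq> adic_rationals n \<inter> {0..<1} \<and> 0 \<in> C \<and>
     (\<forall>x\<in>C. \<forall>y\<in>adic_rationals n. 0 \<le> y \<and> y \<le> x \<longrightarrow> y \<in> C)}"

lemma cut_family_mem:
  assumes "C \<in> cut_family n" "x \<in> C"
  shows "x \<in> adic_rationals n" "0 \<le> x" "x < 1"
  using assms unfolding cut_family_def by auto

lemma cut_family_zero: "C \<in> cut_family n \<Longrightarrow> 0 \<in> C"
  unfolding cut_family_def by simp

lemma cut_family_downward:
  assumes "C \<in> cut_family n" "x \<in> C" "y \<in> adic_rationals n" "0 \<le> y" "y \<le> x"
  shows "y \<in> C"
  using assms unfolding cut_family_def by simp

lemma topspace_cantor: "\<omega> \<in> topspace (cantor n) \<longleftrightarrow> (\<forall>i. \<omega> i < n)"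
  unfolding cantor_def by (auto simp: PiE_iff)

lemma cantor_digit_less: "\<omega> \<in> topspace (cantor n) \<Longrightarrow> \<omega> i < n"
  using topspace_cantor by blast

lemma adic_rationals_nonneg:
  assumes "x \<in> adic_rationals n" "0 \<le> x" "n \<ge> 1"
  shows "\<exists>a k. x = real a / real n ^ k"
proof -
  obtain z k where x: "x = of_int z / real n ^ k" using assms unfolding adic_rationals_def by auto
  have "0 \<le> z"
  proof (rule ccontr)
    assume "\<not> ?thesis"
    then have "x < 0" unfolding x using assms(3) by (intro divide_neg_pos) auto
    then show False using assms(2) by simp
  qed
  then have "x = real (nat z) / real n ^ k" using x by simp
  then show ?thesis by blast
qed

lemma adic_rationals_nat: "real a / real n ^ k \<in> adic_rationals n"
  unfolding adic_rationals_def by (rule CollectI, rule exI[of _ "int a"], rule exI[of _ k]) simp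

lemma prefix_value_less:
  assumes "\<omega> \<in> topspace (cantor n)"
  shows "prefix_value n \<omega> k < n ^ k"
proof (induction k)
  case (Suc k)
  then have "n * Suc (prefix_value n \<omega> k) \<le> n * n ^ k" by (intro mult_le_mono2) simp
  then show ?case using cantor_digit_less[OF assms, of k] by simp
qed simp

lemma prefix_value_bounds:
  assumes "\<omega> \<in> topspace (cantor n)"
  shows "n ^ l * prefix_value n \<omega> k \<le> prefix_value n \<omega> (k + l)"
    "prefix_value n \<omega> (k + l) < n ^ l * (prefix_value n \<omega> k + 1)"
proof (induction l)
  case (Suc l)
  {
    case 1
    have "n * (n ^ l * prefix_value n \<omega> k) \<le> n * prefix_value n \<omega> (k + l)" using Suc by (intro mult_le_mono2)
    also have "\<dots> \<le> prefix_value n \<omega> (k + Suc l)" by simp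
    finally show ?case by (simp only: power_Suc mult.assoc)
  next
    case 2
    have "n * Suc (prefix_value n \<omega> (k + l)) \<le> n * (n ^ l * (prefix_value n \<omega> k + 1))"
      using Suc by (intro mult_le_mono2) simp
    then show ?case using cantor_digit_less[OF assms, of "k + l"] by (simp add: algebra_simps)
  }
qed simp_all

text \<open>Further digits keep the value of a prefix strictly below the next multiple of
  \<open>1 / n ^ k\<close>, so membership at this denominator is decided by the first
  \<open>k\<close> digits.\<close>

lemma mem_adic_cut_iff:
  assumes n: "n \<ge> 2" and \<omega>: "\<omega> \<in> topspace (cantor n)"
  shows "real a / real n ^ k \<in> adic_cut n \<omega> \<longleftrightarrow> a \<le> prefix_value n \<omega> k"
proof
  assume "a \<le> prefix_value n \<omega> k"
  then have "real a / real n ^ k \<le> real (prefix_value n \<omega> k) / real n ^ k" by (simp add: divide_right_mono)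
  then show "real a / real n ^ k \<in> adic_cut n \<omega>"
    unfolding adic_cut_def using adic_rationals_nat by auto
next
  assume "real a / real n ^ k \<in> adic_cut n \<omega>"
  then obtain l where l: "real a / real n ^ k \<le> real (prefix_value n \<omega> l) / real n ^ l"
    unfolding adic_cut_def by auto
  have n0: "real n > 0" using n by simp
  have "real a / real n ^ k < (real (prefix_value n \<omega> k) + 1) / real n ^ k"
  proof (cases "l \<le> k")
    case True
    then obtain j where j: "k = l + j" using le_Suc_ex by blast
    have "real (n ^ j * prefix_value n \<omega> l) \<le> real (prefix_value n \<omega> k)"
      using prefix_value_bounds(1)[OF \<omega>, of j l] unfolding j by (simp only: of_nat_le_iff)
    then have "real n ^ j * real (prefix_value n \<omega> l) / real n ^ k \<le> real (prefix_value n \<omega> k) / real n ^ k"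
      using n0 by (intro divide_right_mono) auto
    moreover have "real n ^ j * real (prefix_value n \<omega> l) / real n ^ k = real (prefix_value n \<omega> l) / real n ^ l"
      using n0 unfolding j power_add by simp
    moreover have "real (prefix_value n \<omega> k) / real n ^ k < (real (prefix_value n \<omega> k) + 1) / real n ^ k"
      using n0 by (intro divide_strict_right_mono) auto
    ultimately show ?thesis using l by linarith
  next
    case False
    then obtain j where j: "l = k + j" using le_Suc_ex nat_le_linear by blast
    have "real (prefix_value n \<omega> l) < real (n ^ j * (prefix_value n \<omega> k + 1))"
      using prefix_value_bounds(2)[OF \<omega>, of k j] unfolding j by (simp only: of_nat_less_iff)
    then have "real (prefix_value n \<omega> l) < real n ^ j * (real (prefix_value n \<omega> k) + 1)"
      by (simp only: of_nat_mult of_nat_add of_nat_power of_nat_1)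
    then have "real (prefix_value n \<omega> l) / real n ^ l < real n ^ j * (real (prefix_value n \<omega> k) + 1) / real n ^ l"
      using n0 by (intro divide_strict_right_mono) auto
    also have "\<dots> = (real (prefix_value n \<omega> k) + 1) / real n ^ k"
      using n0 unfolding j power_add by simp
    finally show ?thesis using l by linarith
  qed
  then have "real a < real (prefix_value n \<omega> k) + 1" using n0 by (simp add: divide_less_cancel)
  then show "a \<le> prefix_value n \<omega> k" by linarith
qed

lemma adic_cut_in_family:
  assumes n: "n \<ge> 2" and \<omega>: "\<omega> \<in> topspace (cantor n)"
  shows "adic_cut n \<omega> \<in> cut_family n"
proof -
  have lt1: "real (prefix_value n \<omega> k) / real n ^ k < 1" for k
  proof -
    have "real (prefix_value n \<omega> k) < real (n ^ k)" using prefix_value_less[OF \<omega>] by (simp only: of_nat_less_iff)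
    then show ?thesis using n by simp
  qed
  have a: "x < 1" if x: "x \<in> adic_cut n \<omega>" for x
  proof -
    obtain k where "x \<le> real (prefix_value n \<omega> k) / real n ^ k" using x unfolding adic_cut_def by blast
    then show ?thesis using lt1[of k] by linarith
  qed
  have b: "0 \<in> adic_cut n \<omega>" unfolding adic_cut_def by simp
  have c: "x \<in> adic_rationals n \<and> 0 \<le> x" if "x \<in> adic_cut n \<omega>" for x
    using that unfolding adic_cut_def by blast
  have d: "y \<in> adic_cut n \<omega>" if xy: "x \<in> adic_cut n \<omega>" "y \<in> adic_rationals n" "0 \<le> y \<and> y \<le> x" for x y
  proof -
    obtain k where "x \<le> real (prefix_value n \<omega> k) / real n ^ k" using xy(1) unfolding adic_cut_def by blast
    then have "y \<le> real (prefix_value n \<omega> k) / real n ^ k" using xy(3) by linarith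
    then show ?thesis using xy(2,3) unfolding adic_cut_def by blast
  qed
  have "adic_cut n \<omega> \<subseteq> adic_rationals n \<inter> {0..<1}" using a c by fastforce
  then show ?thesis unfolding cut_family_def using b d by blast
qed

lemma adic_cut_inj:
  assumes n: "n \<ge> 2" and \<omega>: "\<omega> \<in> topspace (cantor n)" and \<eta>: "\<eta> \<in> topspace (cantor n)" and eq: "adic_cut n \<omega> = adic_cut n \<eta>"
  shows "\<omega> = \<eta>"
proof
  have pv: "prefix_value n \<omega> k = prefix_value n \<eta> k" for k
    using mem_adic_cut_iff[OF n \<omega>, of "prefix_value n \<eta> k" k] mem_adic_cut_iff[OF n \<eta>, of "prefix_value n \<eta> k" k]
      mem_adic_cut_iff[OF n \<omega>, of "prefix_value n \<omega> k" k] mem_adic_cut_iff[OF n \<eta>, of "prefix_value n \<omega> k" k] eq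
    by simp
  show "\<omega> k = \<eta> k" for k using pv[of "Suc k"] pv[of k] by simp
qed

text \<open>Let \<open>P k\<close> be the largest numerator occurring in \<open>C\<close> over
  \<open>n ^ k\<close>. The lower-set property gives
  \<open>n * P k \<le> P (Suc k) < n * P k + n\<close>, and the excess is the next digit.\<close>

lemma adic_cut_surj:
  assumes n: "n \<ge> 2" and C: "C \<in> cut_family n"
  obtains \<omega> where "\<omega> \<in> topspace (cantor n)" "adic_cut n \<omega> = C"
proof -
  have n0: "real n > 0" using n by simp
  note C1 = cut_family_mem(3,2,1)[OF C] and C0 = cut_family_zero[OF C] and down = cut_family_downward[OF C]
  define P where "P k = (GREATEST j. real j / real n ^ k \<in> C)" for k
  have bound: "j \<le> n ^ k" if "real j / real n ^ k \<in> C" for j k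
  proof -
    have "real j < real (n ^ k)" using C1(1)[OF that] n0 by (simp add: divide_less_eq)
    then show ?thesis by (simp only: of_nat_less_iff)
  qed
  have P: "real (P k) / real n ^ k \<in> C" for k
    unfolding P_def by (rule GreatestI_nat[of _ 0 "n ^ k"]) (use C0 bound in auto)
  have Pmax: "j \<le> P k" if "real j / real n ^ k \<in> C" for j k
    unfolding P_def by (rule Greatest_le_nat[of _ _ "n ^ k"]) (use that bound in auto)
  have P_iff: "real j / real n ^ k \<in> C \<longleftrightarrow> j \<le> P k" for j k
  proof
    assume "j \<le> P k"
    then have "real j / real n ^ k \<le> real (P k) / real n ^ k" by (simp add: divide_right_mono)
    then show "real j / real n ^ k \<in> C" using down[OF P adic_rationals_nat] by simp
  qed (rule Pmax)
  have scale: "real (n * j) / real n ^ Suc k = real j / real n ^ k" for j k using n0 by simp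
  have lo: "n * P k \<le> P (Suc k)" for k using P_iff[of "n * P k" "Suc k"] P[of k] unfolding scale by simp
  have hi: "P (Suc k) < n * P k + n" for k
  proof (rule ccontr)
    assume "\<not> ?thesis"
    then have "n * (P k + 1) \<le> P (Suc k)" by simp
    then have "real (P k + 1) / real n ^ k \<in> C" using P_iff[of "n * (P k + 1)" "Suc k"] unfolding scale by simp
    then show False using P_iff[of "P k + 1" k] by simp
  qed
  define \<omega> where "\<omega> k = P (Suc k) - n * P k" for k
  have \<omega>: "\<omega> \<in> topspace (cantor n)"
    unfolding topspace_cantor
  proof
    show "\<omega> k < n" for k unfolding \<omega>_def using hi[of k] lo[of k] by linarith
  qed
  have "P 0 \<le> 0"
  proof (rule ccontr)
    assume "\<not> ?thesis"
    then have "1 \<le> real (P 0) / real n ^ 0" by simp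
    then show False using C1(1)[OF P[of 0]] by simp
  qed
  then have pv: "prefix_value n \<omega> k = P k" for k
  proof (induction k)
    case (Suc k)
    then show ?case unfolding \<omega>_def using lo[of k] by simp
  qed simp
  have "x \<in> adic_cut n \<omega> \<longleftrightarrow> x \<in> C" for x
  proof (cases "x \<in> adic_rationals n \<and> 0 \<le> x")
    case True
    then obtain a k where x: "x = real a / real n ^ k" using adic_rationals_nonneg[of x n] n by auto
    show ?thesis unfolding x mem_adic_cut_iff[OF n \<omega>] P_iff pv ..
  next
    case False
    then show ?thesis using C1(2,3) unfolding adic_cut_def by blast
  qed
  then have "adic_cut n \<omega> = C" by blast
  then show thesis using that \<omega> by blast
qed

section \<open>The value \<open>rho\<close> as the supremum of a cut\<close>

lemma prefix_value_tendsto_rho: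
  assumes n: "n \<ge> 2" and \<omega>: "\<omega> \<in> topspace (cantor n)"
  shows "(\<lambda>k. real (prefix_value n \<omega> k) / real n ^ k) \<longlonglongrightarrow> rho n \<omega>"
proof -
  have n0: "real n > 0" using n by simp
  have s: "(\<Sum>j<k. real (\<omega> j) / real n ^ Suc j) = real (prefix_value n \<omega> k) / real n ^ k" for k
    using n0 by (induction k) (simp_all add: add_divide_distrib)
  have le1: "real (prefix_value n \<omega> k) / real n ^ k \<le> 1" for k
  proof -
    have "real (prefix_value n \<omega> k) < real (n ^ k)" using prefix_value_less[OF \<omega>] by (simp only: of_nat_less_iff)
    then show ?thesis using n by simp
  qed
  have "summable (\<lambda>j. real (\<omega> j) / real n ^ Suc j)"
  proof (rule summableI_nonneg_bounded)
    show "0 \<le> real (\<omega> j) / real n ^ Suc j" for j by simp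
    show "(\<Sum>j<k. real (\<omega> j) / real n ^ Suc j) \<le> 1" for k unfolding s by (rule le1)
  qed
  from summable_LIMSEQ[OF this] show ?thesis unfolding s rho_def .
qed

lemma adic_cut_le_rho:
  assumes n: "n \<ge> 2" and \<omega>: "\<omega> \<in> topspace (cantor n)" and x: "x \<in> adic_cut n \<omega>"
  shows "x \<le> rho n \<omega>"
proof -
  obtain k where k: "x \<le> real (prefix_value n \<omega> k) / real n ^ k" using x unfolding adic_cut_def by blast
  have n0: "real n > 0" using n by simp
  have "x \<le> real (prefix_value n \<omega> (k + l)) / real n ^ (k + l)" for l
  proof -
    have "real (n ^ l * prefix_value n \<omega> k) \<le> real (prefix_value n \<omega> (k + l))"
      using prefix_value_bounds(1)[OF \<omega>, of l k] by (simp only: of_nat_le_iff)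
    then have "real n ^ l * real (prefix_value n \<omega> k) / real n ^ (k + l) \<le> real (prefix_value n \<omega> (k + l)) / real n ^ (k + l)"
      using n0 by (intro divide_right_mono) auto
    moreover have "real n ^ l * real (prefix_value n \<omega> k) / real n ^ (k + l) = real (prefix_value n \<omega> k) / real n ^ k"
      using n0 unfolding power_add by simp
    ultimately show ?thesis using k by linarith
  qed
  then have "x \<le> real (prefix_value n \<omega> j) / real n ^ j" if "j \<ge> k" for j
    using le_Suc_ex[OF that] by blast
  then show ?thesis using LIMSEQ_le_const[OF prefix_value_tendsto_rho[OF n \<omega>], of x] by blast
qed

lemma adic_cut_approximates_rho:
  assumes n: "n \<ge> 2" and \<omega>: "\<omega> \<in> topspace (cantor n)" and t: "t < rho n \<omega>"
  shows "\<exists>x\<in>adic_cut n \<omega>. t < x"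
proof -
  have "eventually (\<lambda>k. t < real (prefix_value n \<omega> k) / real n ^ k) sequentially"
    using order_tendstoD(1)[OF prefix_value_tendsto_rho[OF n \<omega>] t] .
  then obtain k where "t < real (prefix_value n \<omega> k) / real n ^ k" unfolding eventually_sequentially by blast
  moreover have "real (prefix_value n \<omega> k) / real n ^ k \<in> adic_cut n \<omega>" using mem_adic_cut_iff[OF n \<omega>] by blast
  ultimately show ?thesis by blast
qed

lemma rho_unit_interval:
  assumes n: "n \<ge> 2" and \<omega>: "\<omega> \<in> topspace (cantor n)"
  shows "rho n \<omega> \<in> {0..1}"
proof -
  have f: "adic_cut n \<omega> \<in> cut_family n" by (rule adic_cut_in_family[OF n \<omega>])
  then have "0 \<in> adic_cut n \<omega>" by (rule cut_family_zero)
  then have "0 \<le> rho n \<omega>" by (rule adic_cut_le_rho[OF n \<omega>])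
  moreover have "rho n \<omega> \<le> 1"
  proof (rule ccontr)
    assume "\<not> ?thesis"
    then obtain x where "x \<in> adic_cut n \<omega>" "1 < x" using adic_cut_approximates_rho[OF n \<omega>, of 1] by auto
    then show False using cut_family_mem(3)[OF f, of x] by simp
  qed
  ultimately show ?thesis by simp
qed

lemma cut_family_chain:
  assumes "C \<in> cut_family n" "D \<in> cut_family n" "x \<in> C" "x \<notin> D" "y \<in> D" "y \<notin> C"
  shows False
proof -
  have "x \<in> D" if "x \<le> y"
    using cut_family_downward[OF assms(2,5)] cut_family_mem[OF assms(1,3)] that by simp
  moreover have "y \<in> C" if "y \<le> x"
    using cut_family_downward[OF assms(1,3)] cut_family_mem[OF assms(2,5)] that by simp
  ultimately show False using assms(4,6) by linarith
qed

text \<open>The separating point is the prefix of \<open>\<eta>\<close> up to and including the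
  first digit that differs.\<close>

lemma lex_lt_adic_cut:
  assumes n: "n \<ge> 2" and \<omega>: "\<omega> \<in> topspace (cantor n)" and \<eta>: "\<eta> \<in> topspace (cantor n)" and lt: "lex_lt \<omega> \<eta>"
  shows "\<exists>x\<in>adic_cut n \<eta>. x \<notin> adic_cut n \<omega>"
proof -
  obtain k where k: "\<And>j. j < k \<Longrightarrow> \<omega> j = \<eta> j" "\<omega> k < \<eta> k" using lt unfolding lex_lt_def by blast
  have "i \<le> k \<Longrightarrow> prefix_value n \<omega> i = prefix_value n \<eta> i" for i
    by (induction i) (use k in auto)
  then have "prefix_value n \<omega> (Suc k) < prefix_value n \<eta> (Suc k)" using k by simp
  then have "real (prefix_value n \<eta> (Suc k)) / real n ^ Suc k \<notin> adic_cut n \<omega>"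
    unfolding mem_adic_cut_iff[OF n \<omega>] by simp
  moreover have "real (prefix_value n \<eta> (Suc k)) / real n ^ Suc k \<in> adic_cut n \<eta>"
    unfolding mem_adic_cut_iff[OF n \<eta>] by simp
  ultimately show ?thesis by blast
qed

lemma lex_lt_total:
  assumes "\<omega> \<noteq> \<eta>" shows "lex_lt \<omega> \<eta> \<or> lex_lt \<eta> \<omega>"
proof -
  have ex: "\<exists>k. \<omega> k \<noteq> \<eta> k" using assms by auto
  define k where "k = (LEAST k. \<omega> k \<noteq> \<eta> k)"
  have "\<omega> k \<noteq> \<eta> k" unfolding k_def using ex by (rule LeastI_ex)
  moreover have "\<omega> j = \<eta> j" if "j < k" for j using not_less_Least[of j] that unfolding k_def by blast
  ultimately show ?thesis unfolding lex_lt_def by (metis linorder_neqE_nat)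
qed

text \<open>With each of its points such a set contains the whole cylinder over the first
  \<open>k\<close> digits.\<close>

lemma openin_cantor_finite_dependence:
  assumes "\<And>\<omega> \<eta>. \<lbrakk>\<omega> \<in> topspace (cantor n); \<eta> \<in> topspace (cantor n); \<And>i. i < k \<Longrightarrow> \<omega> i = \<eta> i\<rbrakk> \<Longrightarrow> P \<omega> = P \<eta>"
  shows "openin (cantor n) {\<omega> \<in> topspace (cantor n). P \<omega>}"
proof (subst openin_subopen, intro ballI)
  fix \<omega> assume \<omega>: "\<omega> \<in> {\<omega> \<in> topspace (cantor n). P \<omega>}"
  then have \<omega>n: "\<omega> i < n" for i using topspace_cantor by auto
  define X where "X i = (if i < k then {\<omega> i} else {..<n})" for i
  have fin: "finite {i. X i \<noteq> topspace (discrete_topology {..<n})}"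
    by (rule finite_subset[of _ "{..<k}"]) (auto simp: X_def split: if_splits)
  have "openin (cantor n) (PiE UNIV X)"
    unfolding cantor_def by (rule product_topology_basis[OF _ fin]) (use \<omega>n in \<open>auto simp: X_def\<close>)
  moreover have "\<omega> \<in> PiE UNIV X" using \<omega>n by (auto simp: X_def PiE_iff)
  moreover have "PiE UNIV X \<subseteq> {\<omega> \<in> topspace (cantor n). P \<omega>}"
  proof
    fix \<eta> assume "\<eta> \<in> PiE UNIV X"
    then have \<eta>: "\<eta> i \<in> X i" for i by (auto simp: PiE_iff)
    have "\<eta> i < n" for i using \<eta>[of i] \<omega>n[of i] by (auto simp: X_def split: if_splits)
    then have \<eta>t: "\<eta> \<in> topspace (cantor n)" using topspace_cantor by blast
    moreover have "\<omega> i = \<eta> i" if "i < k" for i using \<eta>[of i] that by (simp add: X_def)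
    ultimately show "\<eta> \<in> {\<omega> \<in> topspace (cantor n). P \<omega>}" using assms[of \<omega> \<eta>] \<omega> by auto
  qed
  ultimately show "\<exists>T. openin (cantor n) T \<and> \<omega> \<in> T \<and> T \<subseteq> {\<omega> \<in> topspace (cantor n). P \<omega>}" by blast
qed

section \<open>Transport of cuts and the lift\<close>

lemma image_cut_family:
  assumes \<psi>: "\<psi> \<in> homeo_plus {0..1}"
    and ad: "\<And>x. x \<in> {0..1} \<Longrightarrow> \<psi> x \<in> adic_rationals m \<longleftrightarrow> x \<in> adic_rationals n"
    and C: "C \<in> cut_family n"
  shows "\<psi> ` C \<in> cut_family m"
proof -
  note D = homeo_plusD[OF \<psi>]
  note C1 = cut_family_mem(3,2,1)[OF C] and C0 = cut_family_zero[OF C] and down = cut_family_downward[OF C]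
  show ?thesis unfolding cut_family_def
  proof (intro CollectI conjI ballI impI subsetI)
    fix y assume "y \<in> \<psi> ` C"
    then obtain x where x: "x \<in> C" "y = \<psi> x" by blast
    have xI: "x \<in> {0..1}" using C1[OF x(1)] by simp
    show "y \<in> adic_rationals m \<inter> {0..<1}"
      using ad[OF xI] C1[OF x(1)] D(7)[OF xI] D(8)[OF xI, of 1] D(6) x(2) by auto
  next
    show "0 \<in> \<psi> ` C" using C0 D(5) by force
  next
    fix y z assume "y \<in> \<psi> ` C" and z: "z \<in> adic_rationals m" "0 \<le> z \<and> z \<le> y"
    then obtain x where x: "x \<in> C" "y = \<psi> x" by blast
    have xI: "x \<in> {0..1}" using C1[OF x(1)] by simp
    have zI: "z \<in> {0..1}" using z x(2) D(7)[OF xI] by auto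
    define u where "u = inverse_map \<psi> z"
    have u: "u \<in> {0..1}" "\<psi> u = z" unfolding u_def using inverse_map[OF \<psi> zI] by auto
    have "u \<in> C" using down[OF x(1), of u] ad[OF u(1)] u z D(9)[OF u(1) xI] x(2) by auto
    then show "z \<in> \<psi> ` C" using u(2) by blast
  qed
qed

text \<open>The lift sends \<open>\<omega>\<close> to the point whose cut is the
  \<open>\<psi>\<close>-image of the cut of \<open>\<omega>\<close>; by \<open>ad\<close> this image
  is again a cut. Lexicographic order is strict inclusion of cuts and \<open>rho\<close> is their
  supremum, so both compatibilities come from the monotonicity of \<open>\<psi>\<close>.\<close>

lemma cantor_lift_exists:
  assumes n: "n \<ge> 2" and m: "m \<ge> 2" and \<psi>: "\<psi> \<in> homeo_plus {0..1}"
    and ad: "\<And>x. x \<in> {0..1} \<Longrightarrow> \<psi> x \<in> adic_rationals m \<longleftrightarrow> x \<in> adic_rationals n"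
  shows "\<exists>\<Phi>. homeomorphic_map (cantor n) (cantor m) \<Phi> \<and>
    (\<forall>\<omega>\<in>topspace (cantor n). rho m (\<Phi> \<omega>) = \<psi> (rho n \<omega>)) \<and> lex_preserving n \<Phi>"
proof -
  note D = homeo_plusD[OF \<psi>]
  have cutI: "x \<in> {0..1}" if "x \<in> adic_cut n \<omega>" "\<omega> \<in> topspace (cantor n)" for x \<omega>
    using cut_family_mem[OF adic_cut_in_family[OF n that(2)] that(1)] by simp
  have "\<exists>\<eta>. \<eta> \<in> topspace (cantor m) \<and> adic_cut m \<eta> = \<psi> ` adic_cut n \<omega>" if \<omega>: "\<omega> \<in> topspace (cantor n)" for \<omega>
  proof -
    obtain \<eta> where "\<eta> \<in> topspace (cantor m)" "adic_cut m \<eta> = \<psi> ` adic_cut n \<omega>"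
      using adic_cut_surj[OF m image_cut_family[OF \<psi> ad adic_cut_in_family[OF n \<omega>]]] .
    then show ?thesis by blast
  qed
  then obtain \<Phi> where \<Phi>: "\<And>\<omega>. \<omega> \<in> topspace (cantor n) \<Longrightarrow> \<Phi> \<omega> \<in> topspace (cantor m)"
    "\<And>\<omega>. \<omega> \<in> topspace (cantor n) \<Longrightarrow> adic_cut m (\<Phi> \<omega>) = \<psi> ` adic_cut n \<omega>" by metis
  have inj: "\<omega> = \<eta>" if w: "\<omega> \<in> topspace (cantor n)" "\<eta> \<in> topspace (cantor n)" "\<Phi> \<omega> = \<Phi> \<eta>" for \<omega> \<eta>
  proof (rule adic_cut_inj[OF n w(1,2)])
    have "\<psi> ` adic_cut n \<omega> = \<psi> ` adic_cut n \<eta>" using \<Phi>(2)[OF w(1)] \<Phi>(2)[OF w(2)] w(3) by simp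
    moreover have "inj_on \<psi> {0..1}" using D(4) by (simp add: bij_betw_def)
    moreover have "adic_cut n \<omega> \<subseteq> {0..1}" "adic_cut n \<eta> \<subseteq> {0..1}" using cutI w by blast+
    ultimately show "adic_cut n \<omega> = adic_cut n \<eta>" by (simp add: inj_on_image_eq_iff)
  qed
  have surj: "\<exists>\<omega>\<in>topspace (cantor n). \<Phi> \<omega> = \<eta>" if \<eta>: "\<eta> \<in> topspace (cantor m)" for \<eta>
  proof -
    have ad': "inverse_map \<psi> y \<in> adic_rationals n \<longleftrightarrow> y \<in> adic_rationals m" if "y \<in> {0..1}" for y
      using ad[OF inverse_map(3)[OF \<psi> that]] inverse_map(2)[OF \<psi> that] by simp
    obtain \<omega> where \<omega>: "\<omega> \<in> topspace (cantor n)" "adic_cut n \<omega> = inverse_map \<psi> ` adic_cut m \<eta>"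
      using adic_cut_surj[OF n image_cut_family[OF inverse_map_homeo[OF \<psi>] ad' adic_cut_in_family[OF m \<eta>]]] by blast
    have "\<psi> (inverse_map \<psi> y) = y" if "y \<in> adic_cut m \<eta>" for y
      using inverse_map(2)[OF \<psi>, of y] cut_family_mem[OF adic_cut_in_family[OF m \<eta>] that] by simp
    then have "\<psi> ` adic_cut n \<omega> = adic_cut m \<eta>" unfolding \<omega>(2) image_image by simp
    then have "adic_cut m (\<Phi> \<omega>) = adic_cut m \<eta>" using \<Phi>(2)[OF \<omega>(1)] by simp
    then have "\<Phi> \<omega> = \<eta>" using adic_cut_inj[OF m \<Phi>(1)[OF \<omega>(1)] \<eta>] by blast
    then show ?thesis using \<omega>(1) by blast
  qed
  \<comment> \<open>The first \<open>k\<close> digits of \<open>\<Phi> \<omega>\<close> record which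
    of the finitely many points \<open>j / m ^ k\<close> lie in its cut. Their preimages are adic
    with denominators \<open>n ^ l j\<close>, so boundedly many digits of \<open>\<omega>\<close>
    decide this.\<close>
  have prefix_dep: "\<exists>L. \<forall>\<omega> \<eta>. \<omega> \<in> topspace (cantor n) \<longrightarrow> \<eta> \<in> topspace (cantor n) \<longrightarrow> (\<forall>i<L. \<omega> i = \<eta> i) \<longrightarrow>
      prefix_value m (\<Phi> \<omega>) k = prefix_value m (\<Phi> \<eta>) k" for k
  proof -
    have "\<forall>j<m ^ k. \<exists>a l. inverse_map \<psi> (real j / real m ^ k) = real a / real n ^ l"
    proof (intro allI impI)
      fix j assume j: "j < m ^ k"
      then have "real j \<le> real (m ^ k)" by (simp only: of_nat_le_iff less_imp_le)
      then have I: "real j / real m ^ k \<in> {0..1}" using m by simp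
      have "inverse_map \<psi> (real j / real m ^ k) \<in> adic_rationals n"
        using ad[OF inverse_map(3)[OF \<psi> I]] inverse_map(2)[OF \<psi> I] adic_rationals_nat by simp
      moreover have "0 \<le> inverse_map \<psi> (real j / real m ^ k)" using inverse_map(3)[OF \<psi> I] by simp
      ultimately show "\<exists>a l. inverse_map \<psi> (real j / real m ^ k) = real a / real n ^ l"
        using n by (intro adic_rationals_nonneg) auto
    qed
    then obtain a l where al: "\<And>j. j < m ^ k \<Longrightarrow> inverse_map \<psi> (real j / real m ^ k) = real (a j) / real n ^ l j"
      by metis
    define L where "L = (\<Sum>j<m ^ k. l j)"
    have lL: "l j \<le> L" if "j < m ^ k" for j unfolding L_def using that by (intro member_le_sum) auto
    have iff: "j \<le> prefix_value m (\<Phi> \<omega>) k \<longleftrightarrow> a j \<le> prefix_value n \<omega> (l j)"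
      if \<omega>: "\<omega> \<in> topspace (cantor n)" and j: "j < m ^ k" for \<omega> j
    proof -
      have "real j \<le> real (m ^ k)" using j by (simp only: of_nat_le_iff less_imp_le)
      then have I: "real j / real m ^ k \<in> {0..1}" using m by simp
      define u where "u = inverse_map \<psi> (real j / real m ^ k)"
      have u: "u \<in> {0..1}" "\<psi> u = real j / real m ^ k" unfolding u_def using inverse_map[OF \<psi> I] by auto
      have "j \<le> prefix_value m (\<Phi> \<omega>) k \<longleftrightarrow> \<psi> u \<in> \<psi> ` adic_cut n \<omega>"
        using mem_adic_cut_iff[OF m \<Phi>(1)[OF \<omega>], of j k] \<Phi>(2)[OF \<omega>] u(2) by simp
      also have "\<dots> \<longleftrightarrow> u \<in> adic_cut n \<omega>"
        using D(10)[OF u(1)] cutI[OF _ \<omega>] by blast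
      also have "\<dots> \<longleftrightarrow> a j \<le> prefix_value n \<omega> (l j)"
        unfolding u_def al[OF j] by (rule mem_adic_cut_iff[OF n \<omega>])
      finally show ?thesis .
    qed
    have "prefix_value m (\<Phi> \<omega>) k = prefix_value m (\<Phi> \<eta>) k"
      if w: "\<omega> \<in> topspace (cantor n)" "\<eta> \<in> topspace (cantor n)" "\<forall>i<L. \<omega> i = \<eta> i" for \<omega> \<eta>
    proof -
      have "i \<le> L \<Longrightarrow> prefix_value n \<omega> i = prefix_value n \<eta> i" for i
        by (induction i) (use w in auto)
      then have eq: "j \<le> prefix_value m (\<Phi> \<omega>) k \<longleftrightarrow> j \<le> prefix_value m (\<Phi> \<eta>) k" if "j < m ^ k" for j
        using iff[of \<omega> j] iff[of \<eta> j] w that lL[OF that] by simp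
      have "prefix_value m (\<Phi> \<omega>) k < m ^ k" "prefix_value m (\<Phi> \<eta>) k < m ^ k"
        using prefix_value_less[OF \<Phi>(1)] w by blast+
      then show ?thesis using eq[of "prefix_value m (\<Phi> \<omega>) k"] eq[of "prefix_value m (\<Phi> \<eta>) k"] by simp
    qed
    then show ?thesis by blast
  qed
  have digit_dep: "\<exists>L. \<forall>\<omega> \<eta>. \<omega> \<in> topspace (cantor n) \<longrightarrow> \<eta> \<in> topspace (cantor n) \<longrightarrow> (\<forall>i<L. \<omega> i = \<eta> i) \<longrightarrow> \<Phi> \<omega> k = \<Phi> \<eta> k" for k
  proof -
    obtain L1 where L1: "\<forall>\<omega> \<eta>. \<omega> \<in> topspace (cantor n) \<longrightarrow> \<eta> \<in> topspace (cantor n) \<longrightarrow> (\<forall>i<L1. \<omega> i = \<eta> i) \<longrightarrow>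
      prefix_value m (\<Phi> \<omega>) k = prefix_value m (\<Phi> \<eta>) k" using prefix_dep by blast
    obtain L2 where L2: "\<forall>\<omega> \<eta>. \<omega> \<in> topspace (cantor n) \<longrightarrow> \<eta> \<in> topspace (cantor n) \<longrightarrow> (\<forall>i<L2. \<omega> i = \<eta> i) \<longrightarrow>
      prefix_value m (\<Phi> \<omega>) (Suc k) = prefix_value m (\<Phi> \<eta>) (Suc k)" using prefix_dep by blast
    have "\<Phi> \<omega> k = \<Phi> \<eta> k" if "\<omega> \<in> topspace (cantor n)" "\<eta> \<in> topspace (cantor n)" "\<forall>i<max L1 L2. \<omega> i = \<eta> i" for \<omega> \<eta>
    proof -
      have "prefix_value m (\<Phi> \<omega>) k = prefix_value m (\<Phi> \<eta>) k"
        using L1[rule_format, of \<omega> \<eta>] that by simp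
      moreover have "prefix_value m (\<Phi> \<omega>) (Suc k) = prefix_value m (\<Phi> \<eta>) (Suc k)"
        using L2[rule_format, of \<omega> \<eta>] that by simp
      ultimately show ?thesis by simp
    qed
    then show ?thesis by (intro exI[of _ "max L1 L2"]) blast
  qed
  have comp: "continuous_map (cantor n) (discrete_topology {..<m}) (\<lambda>\<omega>. \<Phi> \<omega> k)" for k
    unfolding continuous_map_def
  proof (intro conjI allI impI)
    show "(\<lambda>\<omega>. \<Phi> \<omega> k) \<in> topspace (cantor n) \<rightarrow> topspace (discrete_topology {..<m})"
      by (rule funcsetI) (simp add: cantor_digit_less[OF \<Phi>(1)])
    fix U assume "openin (discrete_topology {..<m}) U"
    obtain L where L: "\<And>\<omega> \<eta>. \<omega> \<in> topspace (cantor n) \<Longrightarrow> \<eta> \<in> topspace (cantor n) \<Longrightarrow> (\<forall>i<L. \<omega> i = \<eta> i) \<Longrightarrow> \<Phi> \<omega> k = \<Phi> \<eta> k"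
      using digit_dep by blast
    show "openin (cantor n) {\<omega> \<in> topspace (cantor n). \<Phi> \<omega> k \<in> U}"
    proof (rule openin_cantor_finite_dependence[of n L "\<lambda>\<omega>. \<Phi> \<omega> k \<in> U"])
      fix \<omega> \<eta> assume "\<omega> \<in> topspace (cantor n)" "\<eta> \<in> topspace (cantor n)" "\<And>i. i < L \<Longrightarrow> \<omega> i = \<eta> i"
      then have "\<Phi> \<omega> k = \<Phi> \<eta> k" by (intro L) auto
      then show "(\<Phi> \<omega> k \<in> U) = (\<Phi> \<eta> k \<in> U)" by simp
    qed
  qed
  then have cont: "continuous_map (cantor n) (cantor m) \<Phi>"
    unfolding cantor_def[of m] continuous_map_componentwise_UNIV by blast
  have "homeomorphic_map (cantor n) (cantor m) \<Phi>"
  proof (rule bijective_closed_imp_homeomorphic_map[OF cont T1_Spaces.continuous_imp_closed_map[OF cont]])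
    show "compact_space (cantor n)" unfolding cantor_def
      by (simp add: compact_space_product_topology compact_space_discrete_topology)
    show "Hausdorff_space (cantor m)" unfolding cantor_def
      by (simp add: Hausdorff_space_product_topology)
    show "\<Phi> ` topspace (cantor n) = topspace (cantor m)"
    proof (intro equalityI subsetI)
      fix \<eta> assume "\<eta> \<in> \<Phi> ` topspace (cantor n)"
      then show "\<eta> \<in> topspace (cantor m)" by (elim imageE) (simp add: \<Phi>(1))
    next
      fix \<eta> assume "\<eta> \<in> topspace (cantor m)"
      then obtain \<omega> where "\<omega> \<in> topspace (cantor n)" "\<Phi> \<omega> = \<eta>" using surj by blast
      then show "\<eta> \<in> \<Phi> ` topspace (cantor n)" by blast
    qed
    show "inj_on \<Phi> (topspace (cantor n))" using inj by (intro inj_onI)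
  qed
  moreover have "rho m (\<Phi> \<omega>) = \<psi> (rho n \<omega>)" if "\<omega> \<in> topspace (cantor n)" for \<omega>
  proof -
    note \<omega> = that
    have \<eta>: "\<Phi> \<omega> \<in> topspace (cantor m)" by (rule \<Phi>(1)[OF \<omega>])
    have rI: "rho n \<omega> \<in> {0..1}" by (rule rho_unit_interval[OF n \<omega>])
    have rI': "rho m (\<Phi> \<omega>) \<in> {0..1}" by (rule rho_unit_interval[OF m \<eta>])
    have "\<not> \<psi> (rho n \<omega>) < rho m (\<Phi> \<omega>)"
    proof
      assume "\<psi> (rho n \<omega>) < rho m (\<Phi> \<omega>)"
      then obtain y where y: "y \<in> adic_cut m (\<Phi> \<omega>)" "\<psi> (rho n \<omega>) < y"
        using adic_cut_approximates_rho[OF m \<eta>] by blast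
      then obtain x where x: "x \<in> adic_cut n \<omega>" "y = \<psi> x" using \<Phi>(2)[OF \<omega>] by auto
      then show False using D(9)[OF cutI[OF x(1) \<omega>] rI] adic_cut_le_rho[OF n \<omega> x(1)] y(2) by simp
    qed
    moreover have "\<not> rho m (\<Phi> \<omega>) < \<psi> (rho n \<omega>)"
    proof
      assume lt: "rho m (\<Phi> \<omega>) < \<psi> (rho n \<omega>)"
      define u where "u = inverse_map \<psi> (rho m (\<Phi> \<omega>))"
      have u: "u \<in> {0..1}" "\<psi> u = rho m (\<Phi> \<omega>)" unfolding u_def using inverse_map[OF \<psi> rI'] by auto
      have "u < rho n \<omega>" using D(8)[OF u(1) rI] lt u(2) by simp
      then obtain x where x: "x \<in> adic_cut n \<omega>" "u < x" using adic_cut_approximates_rho[OF n \<omega>] by blast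
      have "\<psi> x \<le> rho m (\<Phi> \<omega>)" using adic_cut_le_rho[OF m \<eta>] \<Phi>(2)[OF \<omega>] x(1) by blast
      then show False using D(8)[OF u(1) cutI[OF x(1) \<omega>]] x(2) u(2) by simp
    qed
    ultimately show ?thesis by simp
  qed
  moreover have "lex_preserving n \<Phi>"
    unfolding lex_preserving_def
  proof (intro ballI impI)
    fix \<omega> \<eta> assume w: "\<omega> \<in> topspace (cantor n)" "\<eta> \<in> topspace (cantor n)" and lt: "lex_lt \<omega> \<eta>"
    have \<Phi>w: "\<Phi> \<omega> \<in> topspace (cantor m)" "\<Phi> \<eta> \<in> topspace (cantor m)" using \<Phi>(1) w by blast+
    obtain x where x: "x \<in> adic_cut n \<eta>" "x \<notin> adic_cut n \<omega>" using lex_lt_adic_cut[OF n w lt] by blast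
    have x': "\<psi> x \<in> adic_cut m (\<Phi> \<eta>)" using \<Phi>(2)[OF w(2)] x(1) by blast
    have x'': "\<psi> x \<notin> adic_cut m (\<Phi> \<omega>)"
      unfolding \<Phi>(2)[OF w(1)] using D(10)[OF cutI[OF x(1) w(2)]] cutI[OF _ w(1)] x(2) by blast
    have "\<Phi> \<omega> \<noteq> \<Phi> \<eta>" using x' x'' by auto
    moreover have "\<not> lex_lt (\<Phi> \<eta>) (\<Phi> \<omega>)"
    proof
      assume "lex_lt (\<Phi> \<eta>) (\<Phi> \<omega>)"
      then obtain y where "y \<in> adic_cut m (\<Phi> \<omega>)" "y \<notin> adic_cut m (\<Phi> \<eta>)"
        using lex_lt_adic_cut[OF m \<Phi>w(2,1)] by blast
      then show False
        using cut_family_chain[OF adic_cut_in_family[OF m \<Phi>w(1)] adic_cut_in_family[OF m \<Phi>w(2)]] x' x'' by blast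
    qed
    ultimately show "lex_lt (\<Phi> \<omega>) (\<Phi> \<eta>)" using lex_lt_total by blast
  qed
  ultimately show ?thesis by blast
qed

section \<open>The group structure\<close>

lemma F_set_Bij: "f \<in> F_set n \<Longrightarrow> f \<in> Bij {0..1}"
  using F_setD(1,4) unfolding Bij_def by blast

lemma F_group_simps:
  "carrier (F_group n) = F_set n" "one (F_group n) = (\<lambda>x\<in>{0..1}. x)"
  by (simp_all add: F_group_def BijGroup_def)

lemma F_group_mult:
  "f \<in> F_set n \<Longrightarrow> g \<in> F_set n \<Longrightarrow> mult (F_group n) f g = f \<circ>\<^sub>I g"
  by (simp add: F_group_def BijGroup_def F_set_Bij)

lemma inverse_map_compose:
  assumes "f \<in> F_set n"
  shows "inverse_map f \<circ>\<^sub>I f = (\<lambda>x\<in>{0..1}. x)"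
proof (rule extensionalityI[of _ "{0..1}"])
  fix x :: real assume "x \<in> {0..1}"
  then show "(inverse_map f \<circ>\<^sub>I f) x = (\<lambda>x\<in>{0..1}. x) x"
    using inverse_map(1)[OF F_set_homeo[OF assms], of x] by (simp add: compose_def)
qed (simp_all add: compose_def)

lemma group_F_group:
  assumes n: "n \<ge> 2" shows "group (F_group n)"
proof (rule groupI, unfold F_group_simps)
  fix f g assume fg: "f \<in> F_set n" "g \<in> F_set n"
  show "mult (F_group n) f g \<in> F_set n" using fg by (simp add: F_group_mult F_set_compose[OF n])
next
  show "(\<lambda>x\<in>{0..1}. x) \<in> F_set n" by (rule F_set_id[OF n])
next
  fix f g h assume fgh: "f \<in> F_set n" "g \<in> F_set n" "h \<in> F_set n"
  have "(f \<circ>\<^sub>I g) \<circ>\<^sub>I h = f \<circ>\<^sub>I (g \<circ>\<^sub>I h)"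
    by (rule compose_assoc[symmetric]) (use F_setD(7)[OF fgh(3)] in blast)
  then show "mult (F_group n) (mult (F_group n) f g) h = mult (F_group n) f (mult (F_group n) g h)"
    using fgh by (simp add: F_group_mult F_set_compose[OF n])
next
  fix f assume f: "f \<in> F_set n"
  show "mult (F_group n) (\<lambda>x\<in>{0..1}. x) f = f"
    unfolding F_group_mult[OF F_set_id[OF n] f]
    by (rule Id_compose) (use F_setD(1)[OF f] F_setD(7)[OF f] in \<open>blast+\<close>)
next
  fix f assume f: "f \<in> F_set n"
  show "\<exists>g\<in>F_set n. mult (F_group n) g f = (\<lambda>x\<in>{0..1}. x)"
    by (rule bexI[OF _ F_set_inverse[OF n f]])
      (simp only: F_group_mult[OF F_set_inverse[OF n f] f] inverse_map_compose[OF f])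
qed

lemma F_group_inv:
  assumes n: "n \<ge> 2" and f: "f \<in> F_set n"
  shows "m_inv (F_group n) f = inverse_map f"
proof (rule group.inv_equality[OF group_F_group[OF n]], unfold F_group_simps)
  show "mult (F_group n) (inverse_map f) f = (\<lambda>x\<in>{0..1}. x)"
    unfolding F_group_mult[OF F_set_inverse[OF n f] f] by (rule inverse_map_compose[OF f])
qed (rule f, rule F_set_inverse[OF n f])

text \<open>The passage from the algebraic hypotheses to the closure conditions of
  \<open>F_embedding\<close>, used for \<open>H\<close> and for the competitors in its
  maximality.\<close>

lemma subgroup_F_group_iff:
  assumes n: "n \<ge> 2"
  shows "subgroup K (F_group n) \<longleftrightarrow> K \<subseteq> F_set n \<and> (\<lambda>x\<in>{0..1}. x) \<in> K \<and>
    (\<forall>f\<in>K. \<forall>g\<in>K. f \<circ>\<^sub>I g \<in> K) \<and> (\<forall>f\<in>K. inverse_map f \<in> K)" (is "_ \<longleftrightarrow> ?R")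
proof
  assume K: "subgroup K (F_group n)"
  interpret subgroup K "F_group n" by fact
  have s: "K \<subseteq> F_set n" using subset unfolding F_group_simps .
  show ?R
  proof (intro conjI ballI s)
    show "(\<lambda>x\<in>{0..1}. x) \<in> K" using one_closed unfolding F_group_simps .
    show "f \<circ>\<^sub>I g \<in> K" if fg: "f \<in> K" "g \<in> K" for f g
      using m_closed[OF fg] unfolding F_group_mult[OF subsetD[OF s fg(1)] subsetD[OF s fg(2)]] .
    show "inverse_map f \<in> K" if f: "f \<in> K" for f
      using m_inv_closed[OF f] unfolding F_group_inv[OF n subsetD[OF s f]] .
  qed
next
  assume R: ?R
  then have s: "f \<in> F_set n" if "f \<in> K" for f using that by blast
  show "subgroup K (F_group n)"
  proof (rule subgroup.intro)
    show "K \<subseteq> carrier (F_group n)" using R by (simp add: F_group_simps)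
    show "one (F_group n) \<in> K" using R by (simp add: F_group_simps)
    show "mult (F_group n) f g \<in> K" if "f \<in> K" "g \<in> K" for f g
      using R F_group_mult[OF s[OF that(1)] s[OF that(2)]] that by simp
    show "m_inv (F_group n) f \<in> K" if "f \<in> K" for f
      using R F_group_inv[OF n s[OF that]] that by simp
  qed
qed

theorem proposition3p4:
  fixes n m :: nat and H :: "(real \<Rightarrow> real) set"
  assumes "n \<ge> m" and "m \<ge> 2"
    and "maximal_subgroup H (F_group m)"
    and "closed_in_F m H"
    and "(F_group m)\<lparr>carrier := H\<rparr> \<cong> F_group n"
  shows "\<exists>\<phi> \<in> homeo_plus {0<..<1}.
           H = F_conj n \<phi> \<and>
           bij_betw \<phi> (adic_rationals n \<inter> {0<..<1}) (adic_rationals m \<inter> {0<..<1}) \<and>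
           (\<exists>\<Phi>. is_lift n m \<phi> \<Phi> \<and> lex_preserving n \<Phi>)"
proof -
  have m: "m \<ge> 2" and n: "n \<ge> 2" using assms by auto
  have "subgroup H (F_group m)"
    and max: "\<And>K. subgroup K (F_group m) \<Longrightarrow> H \<subseteq> K \<Longrightarrow> K = H \<or> K = F_set m"
    using assms(3) unfolding maximal_subgroup_def F_group_simps by blast+
  then have H: "H \<subseteq> F_set m" "(\<lambda>x\<in>{0..1}. x) \<in> H" "\<And>f g. f \<in> H \<Longrightarrow> g \<in> H \<Longrightarrow> f \<circ>\<^sub>I g \<in> H"
    "\<And>f. f \<in> H \<Longrightarrow> inverse_map f \<in> H"
    unfolding subgroup_F_group_iff[OF m] by blast+
  obtain \<tau> where \<tau>: "\<tau> \<in> iso ((F_group m)\<lparr>carrier := H\<rparr>) (F_group n)"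
    using assms(5) unfolding is_iso_def by blast
  have \<tau>bij: "bij_betw \<tau> H (F_set n)" using \<tau> by (simp add: iso_def F_group_simps)
  then have \<tau>F: "\<tau> f \<in> F_set n" if "f \<in> H" for f using that by (auto simp: bij_betw_def)
  have \<tau>hom: "\<tau> (f \<circ>\<^sub>I g) = \<tau> f \<circ>\<^sub>I \<tau> g" if fg: "f \<in> H" "g \<in> H" for f g
  proof -
    have "\<tau> (mult (F_group m) f g) = mult (F_group n) (\<tau> f) (\<tau> g)" using \<tau> fg by (simp add: iso_def hom_def)
    then show ?thesis
      unfolding F_group_mult[OF subsetD[OF H(1) fg(1)] subsetD[OF H(1) fg(2)]]
        F_group_mult[OF \<tau>F[OF fg(1)] \<tau>F[OF fg(2)]] .
  qed
  \<comment> \<open>The given isomorphism starts at \<open>H\<close>; the embedding of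
    \<open>F_set n\<close> is its inverse.\<close>
  define \<theta>\<^sub>0 where "\<theta>\<^sub>0 = inv_into H \<tau>"
  have \<theta>bij: "bij_betw \<theta>\<^sub>0 (F_set n) H" unfolding \<theta>\<^sub>0_def by (rule bij_betw_inv_into[OF \<tau>bij])
  then have \<theta>H: "\<theta>\<^sub>0 f \<in> H" if "f \<in> F_set n" for f using that by (auto simp: bij_betw_def)
  have \<tau>\<theta>: "\<tau> (\<theta>\<^sub>0 f) = f" if "f \<in> F_set n" for f
    unfolding \<theta>\<^sub>0_def using \<tau>bij that by (simp add: bij_betw_inv_into_right)
  have \<theta>\<tau>: "\<theta>\<^sub>0 (\<tau> f) = f" if "f \<in> H" for f
    unfolding \<theta>\<^sub>0_def using \<tau>bij that by (simp add: bij_betw_inv_into_left)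
  have emb\<^sub>0: "F_embedding n m H \<theta>\<^sub>0"
  proof (rule F_embedding.intro[OF n m H(1,2)])
    show "f \<circ>\<^sub>I g \<in> H" if "f \<in> H" "g \<in> H" for f g by (rule H(3)[OF that])
    show "inverse_map f \<in> H" if "f \<in> H" for f by (rule H(4)[OF that])
    show "bij_betw \<theta>\<^sub>0 (F_set n) H" by (rule \<theta>bij)
    show "\<theta>\<^sub>0 (f \<circ>\<^sub>I g) = \<theta>\<^sub>0 f \<circ>\<^sub>I \<theta>\<^sub>0 g" if fg: "f \<in> F_set n" "g \<in> F_set n" for f g
      using \<tau>hom[OF \<theta>H[OF fg(1)] \<theta>H[OF fg(2)]] \<theta>\<tau>[OF H(3)[OF \<theta>H[OF fg(1)] \<theta>H[OF fg(2)]]]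
      unfolding \<tau>\<theta>[OF fg(1)] \<tau>\<theta>[OF fg(2)] by simp
    show "K = H \<or> K = F_set m"
      if K: "K \<subseteq> F_set m" "(\<lambda>x\<in>{0..1}. x) \<in> K" "\<And>f g. f \<in> K \<Longrightarrow> g \<in> K \<Longrightarrow> f \<circ>\<^sub>I g \<in> K"
        "\<And>f. f \<in> K \<Longrightarrow> inverse_map f \<in> K" "H \<subseteq> K" for K
      by (rule max[OF _ K(5)]) (use K(1-4) in \<open>simp add: subgroup_F_group_iff[OF m]\<close>)
  qed
  \<comment> \<open>Here \<open>\<theta>\<close> may differ from \<open>\<theta>\<^sub>0\<close> by
    the reflection; the conclusion sees only its image, which is \<open>H\<close> in either
    case.\<close>
  obtain \<theta> \<phi> where emb: "F_embedding n m H \<theta>" and \<phi>: "\<phi> \<in> homeo_plus {0<..<1}"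
    "\<forall>g\<in>F_set n. \<forall>x\<in>{0<..<1}. \<phi> (g x) = \<theta> g (\<phi> x)"
    using conjugating_homeo[OF emb\<^sub>0] by blast
  interpret F_conjugacy n m H \<theta> \<phi>
  proof (intro F_conjugacy.intro F_conjugacy_axioms.intro emb \<phi>(1))
    show "\<phi> (g x) = \<theta> g (\<phi> x)" if "g \<in> F_set n" "x \<in> {0<..<1}" for g x
      using \<phi>(2) that by blast
    show "f \<in> H" if "f \<in> F_set m" "piecewise_in H f" for f
      using assms(4) that unfolding closed_in_F_def by blast
  qed
  have "\<psi> x \<in> adic_rationals m \<longleftrightarrow> x \<in> adic_rationals n" if x: "x \<in> {0..1}" for x
  proof -
    consider "x = 0" | "x = 1" | "0 < x" "x < 1" using x by force
    then show ?thesis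
    proof cases
      case 3
      then show ?thesis using \<psi>_adic[of x] \<psi>_adic_converse[of x] by blast
    qed (simp_all add: \<psi>D(5,6))
  qed
  then obtain \<Phi> where "homeomorphic_map (cantor n) (cantor m) \<Phi>"
    "\<forall>\<omega>\<in>topspace (cantor n). rho m (\<Phi> \<omega>) = \<psi> (rho n \<omega>)" "lex_preserving n \<Phi>"
    using cantor_lift_exists[OF n m \<psi>_homeo] by blast
  then have "is_lift n m \<phi> \<Phi> \<and> lex_preserving n \<Phi>" by (simp add: is_lift_def \<psi>_def)
  then show ?thesis using \<phi>(1) H_eq_F_conj \<phi>_bij_adic by blast
qed

end
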